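(* For $\lambda$ outside a countable subset of $\mathbb{C}$ containing $0$, the Verma module $W(\lambda)$ of the insertion-elimination Lie algebra $\mathfrak{g}$ is irreducible.
   Context: A rooted tree is a finite non-empty tree $t$ (finite one-dimensional contractible simplicial complex) with a distinguished vertex, its root; rooted trees are considered up to isomorphism, and $\mathbb{T}$ denotes the set of rooted trees. $V(t)$ and $E(t)$ are the sets of vertices and edges of $t$, and $|t| = \#V(t)$. For $e \in E(t)$, cutting $e$ divides $t$ into two components: $R_e(t)$, the one containing the root of $t$, with the same root as $t$; and $P_e(t)$, the remaining one, rooted at the endpoint of $e$ it contains. For $s,t \in \mathbb{T}$ and $v \in V(s)$, $s \cup_v t$ is the rooted tree obtained by joining the root of $t$ to $s$ at the vertex $v$ by a single edge, with root that of $s$. The insertion-elimination Lie algebra $\mathfrak{g}$ is the Lie algebra over $\mathbb{C}$ with generators $D^+_t, D^-_t$ ($t \in \mathbb{T}$) and $d$, and relations $$[D^+_{t_1}, D^+_{t_2}] = \sum_{v \in V(t_2)} D^+_{t_2 \cup_v t_1} - \sum_{v \in V(t_1)} D^+_{t_1 \cup_v t_2},$$ $$[D^-_{t_1}, D^-_{t_2}] = \sum_{v \in V(t_1)} D^-_{t_1 \cup_v t_2} - \sum_{v \in V(t_2)} D^-_{t_2 \cup_v t_1},$$ $$[D^-_{t_1}, D^+_{t_2}] = \sum_{t\in\mathbb{T}} \alpha(t_1,t_2;t) D^+_t + \sum_{t \in \mathbb{T}} \beta(t_1,t_2;t) D^-_t \quad (t_1 \neq t_2),$$ $$[D^-_t,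 D^+_t] = d, \qquad [d, D^-_t] = -|t|\, D^-_t, \qquad [d, D^+_t] = |t|\, D^+_t,$$ where $\alpha(t_1,t_2;t) = \#\{e \in E(t_2) : R_e(t_2) = t,\ P_e(t_2) = t_1\}$ and $\beta(t_1,t_2;t) = \#\{e \in E(t_1) : R_e(t_1) = t,\ P_e(t_1) = t_2\}$. Let $\mathfrak{n}_+$ and $\mathfrak{n}_-$ be the Lie subalgebras of $\mathfrak{g}$ generated by the $D^+_t$ and by the $D^-_t$, $t \in \mathbb{T}$, respectively, so that $\mathfrak{g} = \mathfrak{n}_+ \oplus \mathbb{C} d \oplus \mathfrak{n}_-$. For $\lambda \in \mathbb{C}$, let $\mathbb{C}_\lambda$ be the one-dimensional representation of $\mathbb{C} d \oplus \mathfrak{n}_-$ on which $\mathfrak{n}_-$ acts trivially and $d$ acts by multiplication by $\lambda$. The Verma module of lowest weight $\lambda$ is the $\mathfrak{g}$-module $W(\lambda) = U(\mathfrak{g}) \otimes_{\mathbb{C}[d] \otimes U(\mathfrak{n}_-)} \mathbb{C}_\lambda$, where $U(\cdot)$ denotes the universal enveloping algebra and $\mathbb{C}[d]\otimes U(\mathfrak{n}_-)$ is $U(\mathbb{C}d\oplus\mathfrak{n}_-)$.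
   Formalization: The printed relations force d = 0 and g = 0; corrected so that the coefficient of D^-_t in [D^-_{t1},D^-_{t2}] counts edges e of t with (R_e,P_e)=(t1,t2), minus those with (t2,t1), and β(t1,t2;t) counts vertices v of t with t ∪_v t2 = t1. *)

theory Defs
  imports Complex_Main "HOL-Library.Countable_Set" "HOL-Algebra.Free_Abelian_Groups"
begin

section \<open>Rooted trees up to isomorphism\<close>

text \<open>A concrete graph is a triple (vertices, edges, root). Every finite tree is isomorphic to
  one whose vertices are natural numbers.\<close>

type_synonym rgraph = "nat set \<times> nat set set \<times> nat"

fun verts :: "rgraph \<Rightarrow> nat set" where "verts (V, E, r) = V"
fun edgs :: "rgraph \<Rightarrow> nat set set" where "edgs (V, E, r) = E"
fun rt :: "rgraph \<Rightarrow> nat" where "rt (V, E, r) = r"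

definition reachable :: "nat set set \<Rightarrow> nat \<Rightarrow> nat set" where
  "reachable E v = {w. (v, w) \<in> {(a, b). {a, b} \<in> E}\<^sup>*}"

definition is_cycle :: "nat set set \<Rightarrow> nat list \<Rightarrow> bool" where
  "is_cycle E vs \<longleftrightarrow> length vs \<ge> 3 \<and> distinct vs \<and>
     (\<forall>i<length vs. {vs ! i, vs ! (Suc i mod length vs)} \<in> E)"

fun is_rooted_tree :: "rgraph \<Rightarrow> bool" where
  "is_rooted_tree (V, E, r) \<longleftrightarrow> finite V \<and> r \<in> V
     \<and> E \<subseteq> {{a, b} | a b. a \<in> V \<and> b \<in> V \<and> a \<noteq> b}
     \<and> (\<forall>v\<in>V. \<forall>w\<in>V. w \<in> reachable E v)
     \<and> (\<nexists>vs. is_cycle E vs)"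

fun rgraph_iso :: "rgraph \<Rightarrow> rgraph \<Rightarrow> bool" where
  "rgraph_iso (V, E, r) (V', E', r') \<longleftrightarrow>
     (\<exists>f. bij_betw f V V' \<and> f r = r' \<and> E' = (\<lambda>e. f ` e) ` E)"

lemma rgraph_iso_refl: "rgraph_iso t t"
proof (cases t)
  case (fields V E r)
  then show ?thesis by (auto intro!: exI[of _ "\<lambda>x. x"] simp: bij_betw_def)
qed

lemma rgraph_iso_sym:
  assumes "is_rooted_tree s" "rgraph_iso s t" shows "rgraph_iso t s"
proof (cases s, cases t)
  fix V E r V' E' r' assume eq: "s = (V, E, r)" "t = (V', E', r')"
  with assms obtain f where f: "bij_betw f V V'" "f r = r'" "E' = (\<lambda>e. f ` e) ` E" by auto
  have "r \<in> V" and sub: "\<And>e. e \<in> E \<Longrightarrow> e \<subseteq> V" using assms(1) eq by auto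
  let ?g = "inv_into V f"
  have inj: "inj_on f V" using f(1) by (simp add: bij_betw_def)
  have "bij_betw ?g V' V" using f(1) by (rule bij_betw_inv_into)
  moreover have "?g r' = r" using f(2) \<open>r \<in> V\<close> inj by (metis inv_into_f_f)
  moreover have "?g ` f ` e = e" if "e \<in> E" for e
    using inj sub[OF that] by (rule inv_into_image_cancel)
  then have "E = (\<lambda>e. ?g ` e) ` E'" unfolding f(3) image_image by force
  ultimately show ?thesis using eq by auto
qed

lemma rgraph_iso_trans:
  assumes "rgraph_iso s t" "rgraph_iso t u" shows "rgraph_iso s u"
proof (cases s, cases t, cases u)
  fix V E r V' E' r' V'' E'' r''
  assume eq: "s = (V, E, r)" "t = (V', E', r')" "u = (V'', E'', r'')"
  with assms obtain f g where
    f: "bij_betw f V V'" "f r = r'" "E' = (\<lambda>e. f ` e) ` E" and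
    g: "bij_betw g V' V''" "g r' = r''" "E'' = (\<lambda>e. g ` e) ` E'" by auto
  have "bij_betw (g \<circ> f) V V''" using f(1) g(1) by (rule bij_betw_trans)
  moreover have "E'' = (\<lambda>e. (g \<circ> f) ` e) ` E" by (simp add: f(3) g(3) image_image image_comp)
  ultimately show ?thesis using eq f(2) g(2) by (auto intro!: exI[of _ "g \<circ> f"])
qed

quotient_type rtree = rgraph /
  partial: "\<lambda>s t. is_rooted_tree s \<and> is_rooted_tree t \<and> rgraph_iso s t"
proof (rule part_equivpI)
  have "is_rooted_tree ({0}, {}, 0)" by (auto simp: reachable_def is_cycle_def intro!: exI[of _ 0])
  then show "\<exists>x. is_rooted_tree x \<and> is_rooted_tree x \<and> rgraph_iso x x"
    using rgraph_iso_refl by blast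
  show "symp (\<lambda>s t. is_rooted_tree s \<and> is_rooted_tree t \<and> rgraph_iso s t)"
    by (auto intro!: sympI rgraph_iso_sym)
  show "transp (\<lambda>s t. is_rooted_tree s \<and> is_rooted_tree t \<and> rgraph_iso s t)"
    by (auto intro!: transpI intro: rgraph_iso_trans)
qed

text \<open>\<open>rep_rtree t\<close> is some rooted tree in the isomorphism class \<open>t\<close>; the sets of vertices and
  edges below are those of this representative.\<close>

definition vertices :: "rtree \<Rightarrow> nat set" where "vertices t = verts (rep_rtree t)"
definition edges :: "rtree \<Rightarrow> nat set set" where "edges t = edgs (rep_rtree t)"
definition tsize :: "rtree \<Rightarrow> nat" where "tsize t = card (vertices t)"

text \<open>Joining uses the even numbers for the vertices of the first tree and the odd numbers for
  those of the second one.\<close>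

fun join_raw :: "rgraph \<Rightarrow> nat \<Rightarrow> rgraph \<Rightarrow> rgraph" where
  "join_raw (V, E, r) v (V', E', r') =
     ((\<lambda>x. 2 * x) ` V \<union> (\<lambda>x. 2 * x + 1) ` V',
      (\<lambda>e. (\<lambda>x. 2 * x) ` e) ` E \<union> (\<lambda>e. (\<lambda>x. 2 * x + 1) ` e) ` E' \<union> {{2 * v, 2 * r' + 1}},
      2 * r)"

fun root_part_raw :: "nat set \<Rightarrow> rgraph \<Rightarrow> rgraph" where
  "root_part_raw e (V, E, r) =
     (let C = reachable (E - {e}) r in (C, {f \<in> E - {e}. f \<subseteq> C}, r))"

fun pruned_part_raw :: "nat set \<Rightarrow> rgraph \<Rightarrow> rgraph" where
  "pruned_part_raw e (V, E, r) =
     (let C = V - reachable (E - {e}) r in (C, {f \<in> E - {e}. f \<subseteq> C}, THE x. x \<in> e \<inter> C))"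

definition join :: "rtree \<Rightarrow> nat \<Rightarrow> rtree \<Rightarrow> rtree" where
  "join s v t = abs_rtree (join_raw (rep_rtree s) v (rep_rtree t))"

definition root_part :: "nat set \<Rightarrow> rtree \<Rightarrow> rtree" where
  "root_part e t = abs_rtree (root_part_raw e (rep_rtree t))"

definition pruned_part :: "nat set \<Rightarrow> rtree \<Rightarrow> rtree" where
  "pruned_part e t = abs_rtree (pruned_part_raw e (rep_rtree t))"

text \<open>\<open>cuts s u t\<close> is the number of edges of \<open>t\<close> whose removal leaves \<open>s\<close> (with the root) and
  \<open>u\<close>; \<open>joins s u t\<close> is the number of vertices of \<open>s\<close> at which joining \<open>u\<close> gives \<open>t\<close>.\<close>

definition cuts :: "rtree \<Rightarrow> rtree \<Rightarrow> rtree \<Rightarrow> nat" where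
  "cuts s u t = card {e \<in> edges t. root_part e t = s \<and> pruned_part e t = u}"

definition joins :: "rtree \<Rightarrow> rtree \<Rightarrow> rtree \<Rightarrow> nat" where
  "joins s u t = card {v \<in> vertices s. join s v u = t}"

definition alpha :: "rtree \<Rightarrow> rtree \<Rightarrow> rtree \<Rightarrow> nat" where
  "alpha t1 t2 t = cuts t t1 t2"

definition beta :: "rtree \<Rightarrow> rtree \<Rightarrow> rtree \<Rightarrow> nat" where
  "beta t1 t2 t = joins t t2 t1"



section \<open>Complex vector spaces, algebras and Lie algebras\<close>

class cvector = ab_group_add +
  fixes scaleC :: "complex \<Rightarrow> 'a \<Rightarrow> 'a"  (infixr "*\<^sub>C" 75)
  assumes scaleC_add_right: "a *\<^sub>C (x + y) = a *\<^sub>C x + a *\<^sub>C y"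
    and scaleC_add_left: "(a + b) *\<^sub>C x = a *\<^sub>C x + b *\<^sub>C x"
    and scaleC_scaleC: "a *\<^sub>C b *\<^sub>C x = (a * b) *\<^sub>C x"
    and scaleC_one: "1 *\<^sub>C x = x"

class calgebra = cvector + ring_1 +
  assumes scaleC_mult_left: "(a *\<^sub>C x) * y = a *\<^sub>C (x * y)"
    and scaleC_mult_right: "x * (a *\<^sub>C y) = a *\<^sub>C (x * y)"

class clie_algebra = cvector +
  fixes lie :: "'a \<Rightarrow> 'a \<Rightarrow> 'a"
  assumes lie_add_left: "lie (x + y) z = lie x z + lie y z"
    and lie_add_right: "lie x (y + z) = lie x y + lie x z"
    and lie_scaleC_left: "lie (a *\<^sub>C x) y = a *\<^sub>C lie x y"
    and lie_scaleC_right: "lie x (a *\<^sub>C y) = a *\<^sub>C lie x y"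
    and lie_self: "lie x x = 0"
    and jacobi: "lie x (lie y z) + lie y (lie z x) + lie z (lie x y) = 0"

instantiation complex :: calgebra
begin
definition scaleC_complex :: "complex \<Rightarrow> complex \<Rightarrow> complex" where "scaleC_complex = (*)"
instance by standard (simp_all add: scaleC_complex_def algebra_simps)
end

context cvector
begin

lemma scaleC_zero_left: "0 *\<^sub>C x = 0"
  using scaleC_add_left[of 0 0 x] by simp

lemma scaleC_zero_right: "a *\<^sub>C 0 = 0"
  using scaleC_add_right[of a 0 0] by simp

lemma scaleC_minus_one: "(- 1) *\<^sub>C x = - x"
proof -
  have "x + (- 1) *\<^sub>C x = 0"
    using scaleC_add_left[of 1 "- 1" x] by (simp add: scaleC_one scaleC_zero_left)
  then show ?thesis by (simp add: add_eq_0_iff)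
qed

lemma scaleC_minus_right: "a *\<^sub>C (- x) = - (a *\<^sub>C x)"
  using scaleC_add_right[of a x "- x"] by (simp add: scaleC_zero_right eq_neg_iff_add_eq_0 add.commute)

lemma scaleC_diff_right: "a *\<^sub>C (x - y) = a *\<^sub>C x - a *\<^sub>C y"
  using scaleC_add_right[of a x "- y"] by (simp add: scaleC_minus_right)

end

context clie_algebra
begin

lemma lie_zero_left: "lie 0 x = 0" using lie_add_left[of 0 0 x] by simp
lemma lie_zero_right: "lie x 0 = 0" using lie_add_right[of x 0 0] by simp

lemma lie_swap: "lie x y = - lie y x"
proof -
  have "lie x y + lie y x = 0"
    using lie_self[of "x + y"] unfolding lie_add_left
    unfolding lie_add_right lie_self by simp
  then show ?thesis by (simp add: eq_neg_iff_add_eq_0)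
qed

lemma lie_minus_left: "lie (- x) y = - lie x y"
  using lie_add_left[of x "- x" y] by (simp add: lie_zero_left eq_neg_iff_add_eq_0 add.commute)

lemma lie_minus_right: "lie x (- y) = - lie x y"
  using lie_add_right[of x y "- y"] by (simp add: lie_zero_right eq_neg_iff_add_eq_0 add.commute)

lemma lie_diff_left: "lie (x - y) z = lie x z - lie y z"
  using lie_add_left[of x "- y" z] by (simp add: lie_minus_left)

lemma lie_diff_right: "lie x (y - z) = lie x y - lie x z"
  using lie_add_right[of x y "- z"] by (simp add: lie_minus_right)

end

subsection \<open>Free Lie algebras\<close>

datatype 'x lterm = LGen 'x | LZero | LAdd "'x lterm" "'x lterm" | LScale complex "'x lterm"
  | LBr "'x lterm" "'x lterm"

inductive lterm_eq :: "'x lterm \<Rightarrow> 'x lterm \<Rightarrow> bool" where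
  refl: "lterm_eq s s"
| sym: "lterm_eq s t \<Longrightarrow> lterm_eq t s"
| trans: "lterm_eq s t \<Longrightarrow> lterm_eq t u \<Longrightarrow> lterm_eq s u"
| add_cong: "lterm_eq s s' \<Longrightarrow> lterm_eq t t' \<Longrightarrow> lterm_eq (LAdd s t) (LAdd s' t')"
| scale_cong: "lterm_eq s s' \<Longrightarrow> lterm_eq (LScale a s) (LScale a s')"
| br_cong: "lterm_eq s s' \<Longrightarrow> lterm_eq t t' \<Longrightarrow> lterm_eq (LBr s t) (LBr s' t')"
| add_assoc: "lterm_eq (LAdd (LAdd s t) u) (LAdd s (LAdd t u))"
| add_comm: "lterm_eq (LAdd s t) (LAdd t s)"
| add_zero: "lterm_eq (LAdd LZero s) s"
| add_neg: "lterm_eq (LAdd (LScale (- 1) s) s) LZero"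
| scale_add_right: "lterm_eq (LScale a (LAdd s t)) (LAdd (LScale a s) (LScale a t))"
| scale_add_left: "lterm_eq (LScale (a + b) s) (LAdd (LScale a s) (LScale b s))"
| scale_scale: "lterm_eq (LScale a (LScale b s)) (LScale (a * b) s)"
| scale_one: "lterm_eq (LScale 1 s) s"
| br_add_left: "lterm_eq (LBr (LAdd s t) u) (LAdd (LBr s u) (LBr t u))"
| br_add_right: "lterm_eq (LBr s (LAdd t u)) (LAdd (LBr s t) (LBr s u))"
| br_scale_left: "lterm_eq (LBr (LScale a s) t) (LScale a (LBr s t))"
| br_scale_right: "lterm_eq (LBr s (LScale a t)) (LScale a (LBr s t))"
| br_self: "lterm_eq (LBr s s) LZero"
| br_jacobi: "lterm_eq (LAdd (LAdd (LBr s (LBr t u)) (LBr t (LBr u s))) (LBr u (LBr s t))) LZero"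

quotient_type 'x free_lie = "'x lterm" / lterm_eq
  by (intro equivpI reflpI sympI transpI) (auto intro: lterm_eq.refl lterm_eq.sym lterm_eq.trans)

instantiation free_lie :: (type) clie_algebra
begin
lift_definition zero_free_lie :: "'a free_lie" is LZero .
lift_definition plus_free_lie :: "'a free_lie \<Rightarrow> 'a free_lie \<Rightarrow> 'a free_lie" is LAdd
  by (rule lterm_eq.add_cong)
lift_definition scaleC_free_lie :: "complex \<Rightarrow> 'a free_lie \<Rightarrow> 'a free_lie" is LScale
  by (rule lterm_eq.scale_cong)
lift_definition uminus_free_lie :: "'a free_lie \<Rightarrow> 'a free_lie" is "LScale (- 1)"
  by (rule lterm_eq.scale_cong)
lift_definition lie_free_lie :: "'a free_lie \<Rightarrow> 'a free_lie \<Rightarrow> 'a free_lie" is LBr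
  by (rule lterm_eq.br_cong)
definition minus_free_lie :: "'a free_lie \<Rightarrow> 'a free_lie \<Rightarrow> 'a free_lie" where
  "minus_free_lie x y = x + - y"
instance
  by standard
    (rule minus_free_lie_def | (transfer, rule
        lterm_eq.add_assoc lterm_eq.add_comm lterm_eq.add_zero lterm_eq.add_neg
        lterm_eq.scale_add_right lterm_eq.scale_add_left lterm_eq.scale_scale
        lterm_eq.scale_one lterm_eq.br_add_left lterm_eq.br_add_right lterm_eq.br_scale_left
        lterm_eq.br_scale_right lterm_eq.br_self lterm_eq.br_jacobi))+
end

lift_definition fgen :: "'x \<Rightarrow> 'x free_lie" is LGen .

subsection \<open>Universal enveloping algebras\<close>

text \<open>The unital associative algebra generated by the symbols \<open>UInc x\<close> for \<open>x\<close> in the Lie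
  algebra, subject to linearity of \<open>UInc\<close> and \<open>[x, y] = xy - yx\<close>.\<close>

datatype 'l uterm = UInc 'l | UZero | UOne | UAdd "'l uterm" "'l uterm"
  | UScale complex "'l uterm" | UMul "'l uterm" "'l uterm"

inductive uterm_eq :: "'l::clie_algebra uterm \<Rightarrow> 'l uterm \<Rightarrow> bool" where
  refl: "uterm_eq s s"
| sym: "uterm_eq s t \<Longrightarrow> uterm_eq t s"
| trans: "uterm_eq s t \<Longrightarrow> uterm_eq t u \<Longrightarrow> uterm_eq s u"
| add_cong: "uterm_eq s s' \<Longrightarrow> uterm_eq t t' \<Longrightarrow> uterm_eq (UAdd s t) (UAdd s' t')"
| scale_cong: "uterm_eq s s' \<Longrightarrow> uterm_eq (UScale a s) (UScale a s')"
| mul_cong: "uterm_eq s s' \<Longrightarrow> uterm_eq t t' \<Longrightarrow> uterm_eq (UMul s t) (UMul s' t')"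
| add_assoc: "uterm_eq (UAdd (UAdd s t) u) (UAdd s (UAdd t u))"
| add_comm: "uterm_eq (UAdd s t) (UAdd t s)"
| add_zero: "uterm_eq (UAdd UZero s) s"
| add_neg: "uterm_eq (UAdd (UScale (- 1) s) s) UZero"
| scale_add_right: "uterm_eq (UScale a (UAdd s t)) (UAdd (UScale a s) (UScale a t))"
| scale_add_left: "uterm_eq (UScale (a + b) s) (UAdd (UScale a s) (UScale b s))"
| scale_scale: "uterm_eq (UScale a (UScale b s)) (UScale (a * b) s)"
| scale_one: "uterm_eq (UScale 1 s) s"
| mul_assoc: "uterm_eq (UMul (UMul s t) u) (UMul s (UMul t u))"
| mul_one_left: "uterm_eq (UMul UOne s) s"
| mul_one_right: "uterm_eq (UMul s UOne) s"
| mul_add_left: "uterm_eq (UMul (UAdd s t) u) (UAdd (UMul s u) (UMul t u))"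
| mul_add_right: "uterm_eq (UMul s (UAdd t u)) (UAdd (UMul s t) (UMul s u))"
| mul_scale_left: "uterm_eq (UMul (UScale a s) t) (UScale a (UMul s t))"
| mul_scale_right: "uterm_eq (UMul s (UScale a t)) (UScale a (UMul s t))"
| inc_add: "uterm_eq (UInc (x + y)) (UAdd (UInc x) (UInc y))"
| inc_scale: "uterm_eq (UInc (a *\<^sub>C x)) (UScale a (UInc x))"
| inc_lie: "uterm_eq (UInc (lie x y))
    (UAdd (UMul (UInc x) (UInc y)) (UScale (- 1) (UMul (UInc y) (UInc x))))"

text \<open>\<open>ring_1\<close> requires \<open>0 \<noteq> 1\<close>, which for an enveloping algebra is seen through the augmentation.\<close>

primrec augmentation :: "'l uterm \<Rightarrow> complex" where
  "augmentation (UInc x) = 0"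
| "augmentation UZero = 0"
| "augmentation UOne = 1"
| "augmentation (UAdd s t) = augmentation s + augmentation t"
| "augmentation (UScale a s) = a * augmentation s"
| "augmentation (UMul s t) = augmentation s * augmentation t"

lemma uterm_eq_augmentation: "uterm_eq s t \<Longrightarrow> augmentation s = augmentation t"
  by (induction rule: uterm_eq.induct) (simp_all add: algebra_simps)

quotient_type (overloaded) 'l uea = "'l::clie_algebra uterm" / uterm_eq
  by (intro equivpI reflpI sympI transpI) (auto intro: uterm_eq.refl uterm_eq.sym uterm_eq.trans)

instantiation uea :: (clie_algebra) calgebra
begin
lift_definition zero_uea :: "'a uea" is UZero .
lift_definition one_uea :: "'a uea" is UOne .
lift_definition plus_uea :: "'a uea \<Rightarrow> 'a uea \<Rightarrow> 'a uea" is UAdd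
  by (rule uterm_eq.add_cong)
lift_definition scaleC_uea :: "complex \<Rightarrow> 'a uea \<Rightarrow> 'a uea" is UScale
  by (rule uterm_eq.scale_cong)
lift_definition uminus_uea :: "'a uea \<Rightarrow> 'a uea" is "UScale (- 1)"
  by (rule uterm_eq.scale_cong)
lift_definition times_uea :: "'a uea \<Rightarrow> 'a uea \<Rightarrow> 'a uea" is UMul
  by (rule uterm_eq.mul_cong)
definition minus_uea :: "'a uea \<Rightarrow> 'a uea \<Rightarrow> 'a uea" where "minus_uea x y = x + - y"
instance
proof
  show "(0 :: 'a uea) \<noteq> 1"
    by transfer (use uterm_eq_augmentation in fastforce)
qed (rule minus_uea_def | (transfer, rule
        uterm_eq.add_assoc uterm_eq.add_comm uterm_eq.add_zero uterm_eq.add_neg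
        uterm_eq.scale_add_right uterm_eq.scale_add_left uterm_eq.scale_scale
        uterm_eq.scale_one uterm_eq.mul_assoc uterm_eq.mul_one_left uterm_eq.mul_one_right
        uterm_eq.mul_add_left uterm_eq.mul_add_right uterm_eq.mul_scale_left
        uterm_eq.mul_scale_right))+
end

lift_definition uinc :: "'l::clie_algebra \<Rightarrow> 'l uea" is UInc .

primrec uterm_eval :: "('l \<Rightarrow> 'a::calgebra) \<Rightarrow> 'l uterm \<Rightarrow> 'a" where
  "uterm_eval \<phi> (UInc x) = \<phi> x"
| "uterm_eval \<phi> UZero = 0"
| "uterm_eval \<phi> UOne = 1"
| "uterm_eval \<phi> (UAdd s t) = uterm_eval \<phi> s + uterm_eval \<phi> t"
| "uterm_eval \<phi> (UScale a s) = a *\<^sub>C uterm_eval \<phi> s"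
| "uterm_eval \<phi> (UMul s t) = uterm_eval \<phi> s * uterm_eval \<phi> t"

text \<open>For a Lie algebra homomorphism \<open>\<phi>\<close> into an associative algebra this is the algebra
  homomorphism extending \<open>\<phi>\<close>; the result does not depend on the chosen representative.\<close>

definition uea_extend :: "('l::clie_algebra \<Rightarrow> 'a::calgebra) \<Rightarrow> 'l uea \<Rightarrow> 'a" where
  "uea_extend \<phi> u = uterm_eval \<phi> (rep_uea u)"

lemma uea_extend_abs:
  assumes add: "\<And>x y. \<phi> (x + y) = \<phi> x + \<phi> y"
    and scale: "\<And>a x. \<phi> (a *\<^sub>C x) = a *\<^sub>C \<phi> x"
    and lie: "\<And>x y. \<phi> (lie x y) = \<phi> x * \<phi> y - \<phi> y * \<phi> x"
  shows "uea_extend \<phi> (abs_uea s) = uterm_eval \<phi> s"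
proof -
  have "uterm_eq s t \<Longrightarrow> uterm_eval \<phi> s = uterm_eval \<phi> t" for s t
    by (induction rule: uterm_eq.induct)
      (simp_all add: add scale lie algebra_simps scaleC_add_right scaleC_add_left scaleC_scaleC
        scaleC_one scaleC_minus_one scaleC_mult_left scaleC_mult_right)
  then show ?thesis
    unfolding uea_extend_def by (meson Quotient3_uea rep_abs_rsp_left uterm_eq.refl)
qed


section \<open>The insertion-elimination Lie algebra\<close>

datatype gen = GPlus rtree | GMinus rtree | GD

abbreviation (input) fP :: "rtree \<Rightarrow> gen free_lie" where "fP t \<equiv> fgen (GPlus t)"
abbreviation (input) fM :: "rtree \<Rightarrow> gen free_lie" where "fM t \<equiv> fgen (GMinus t)"
abbreviation (input) fD :: "gen free_lie" where "fD \<equiv> fgen GD"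

text \<open>
  Normalisation. \<open>cuts s u t\<close> and \<open>joins s u t\<close> differ when \<open>t\<close> has more symmetries than \<open>s\<close> and
  \<open>u\<close>: with \<open>c\<close> the chain on two vertices and \<open>w\<close> the root with two leaves, \<open>joins c \<bullet> w = 1\<close>
  but \<open>cuts c \<bullet> w = 2\<close>. The operators \<open>D\<^sup>+\<^sub>t s = \<Sum>v. s \<union>\<^sub>v t\<close> and
  \<open>D\<^sup>-\<^sub>t s = \<Sum>e with P\<^sub>e(s) = t. R\<^sub>e(s)\<close> on the span of all rooted trees, which the presentation
  axiomatises, force \<open>joins\<close> in \<open>[D\<^sup>+, D\<^sup>+]\<close>, \<open>cuts\<close> in \<open>[D\<^sup>-, D\<^sup>-]\<close>, and \<open>cuts\<close> and \<open>joins\<close>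
  respectively in the coefficients \<open>alpha\<close> and \<open>beta\<close> of \<open>[D\<^sup>-, D\<^sup>+]\<close>.

  The presentation is also found in print with \<open>joins\<close> in \<open>[D\<^sup>-, D\<^sup>-]\<close> and with \<open>cuts\<close> in \<open>beta\<close>.
  Read literally, those relations define the zero Lie algebra: they give
  \<open>[D\<^sup>-\<^sub>\<bullet>, D\<^sup>-\<^sub>c] = - D\<^sup>-\<^sub>w\<close>, \<open>[D\<^sup>-\<^sub>\<bullet>, D\<^sup>+\<^sub>w] = 2 D\<^sup>+\<^sub>c\<close> and \<open>[D\<^sup>-\<^sub>c, D\<^sup>+\<^sub>w] = 0\<close>, so that
  \<open>- d = [[D\<^sup>-\<^sub>\<bullet>, D\<^sup>-\<^sub>c], D\<^sup>+\<^sub>w] = - [D\<^sup>-\<^sub>c, [D\<^sup>-\<^sub>\<bullet>, D\<^sup>+\<^sub>w]] = - 2 d\<close>, whence \<open>d = 0\<close> and all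
  \<open>D\<^sup>\<plusminus>\<^sub>t = 0\<close>.
\<close>

definition ie_relators :: "gen free_lie set" where
  "ie_relators =
     {lie (fP t1) (fP t2) - ((\<Sum>v\<in>vertices t2. fP (join t2 v t1)) - (\<Sum>v\<in>vertices t1. fP (join t1 v t2)))
        | t1 t2. True}
   \<union> {lie (fM t1) (fM t2) -
        ((\<Sum>t | cuts t1 t2 t \<noteq> 0. of_nat (cuts t1 t2 t) *\<^sub>C fM t)
         - (\<Sum>t | cuts t2 t1 t \<noteq> 0. of_nat (cuts t2 t1 t) *\<^sub>C fM t))
        | t1 t2. True}
   \<union> {lie (fM t1) (fP t2) -
        ((\<Sum>t | alpha t1 t2 t \<noteq> 0. of_nat (alpha t1 t2 t) *\<^sub>C fP t)
         + (\<Sum>t | beta t1 t2 t \<noteq> 0. of_nat (beta t1 t2 t) *\<^sub>C fM t))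
        | t1 t2. t1 \<noteq> t2}
   \<union> {lie (fM t) (fP t) - fD | t. True}
   \<union> {lie fD (fM t) - (- of_nat (tsize t)) *\<^sub>C fM t | t. True}
   \<union> {lie fD (fP t) - of_nat (tsize t) *\<^sub>C fP t | t. True}"

inductive_set lie_ideal :: "'l::clie_algebra set \<Rightarrow> 'l set" for X where
  base: "x \<in> X \<Longrightarrow> x \<in> lie_ideal X"
| zero: "0 \<in> lie_ideal X"
| add: "x \<in> lie_ideal X \<Longrightarrow> y \<in> lie_ideal X \<Longrightarrow> x + y \<in> lie_ideal X"
| scale: "x \<in> lie_ideal X \<Longrightarrow> a *\<^sub>C x \<in> lie_ideal X"
| lie_right: "x \<in> lie_ideal X \<Longrightarrow> lie x y \<in> lie_ideal X"
| lie_left: "x \<in> lie_ideal X \<Longrightarrow> lie y x \<in> lie_ideal X"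

lemma lie_ideal_uminus: "x \<in> lie_ideal X \<Longrightarrow> - x \<in> lie_ideal X"
  using lie_ideal.scale[of x X "- 1"] by (simp add: scaleC_minus_one)

lemma lie_ideal_diff: "x \<in> lie_ideal X \<Longrightarrow> y \<in> lie_ideal X \<Longrightarrow> x - y \<in> lie_ideal X"
  using lie_ideal.add[OF _ lie_ideal_uminus, of x X y] by simp

quotient_type ie_lie = "gen free_lie" / "\<lambda>x y. x - y \<in> lie_ideal ie_relators"
proof (intro equivpI reflpI sympI transpI)
  fix x y z :: "gen free_lie"
  show "x - x \<in> lie_ideal ie_relators" by (simp add: lie_ideal.zero)
  show "y - x \<in> lie_ideal ie_relators" if "x - y \<in> lie_ideal ie_relators"
    using lie_ideal_uminus[OF that] by simp
  show "x - z \<in> lie_ideal ie_relators"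
    if "x - y \<in> lie_ideal ie_relators" "y - z \<in> lie_ideal ie_relators"
    using lie_ideal.add[OF that] by simp
qed

instantiation ie_lie :: clie_algebra
begin
lift_definition zero_ie_lie :: ie_lie is 0 .
lift_definition plus_ie_lie :: "ie_lie \<Rightarrow> ie_lie \<Rightarrow> ie_lie" is "(+)"
  by (drule (1) lie_ideal.add) (simp add: algebra_simps)
lift_definition minus_ie_lie :: "ie_lie \<Rightarrow> ie_lie \<Rightarrow> ie_lie" is "(-)"
  by (drule (1) lie_ideal_diff) (simp add: algebra_simps)
lift_definition uminus_ie_lie :: "ie_lie \<Rightarrow> ie_lie" is uminus
  by (drule lie_ideal_uminus) (simp add: algebra_simps)
lift_definition scaleC_ie_lie :: "complex \<Rightarrow> ie_lie \<Rightarrow> ie_lie" is "(*\<^sub>C)"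
  by (drule lie_ideal.scale) (simp add: scaleC_diff_right)
lift_definition lie_ie_lie :: "ie_lie \<Rightarrow> ie_lie \<Rightarrow> ie_lie" is lie
proof -
  fix x x' y y' :: "gen free_lie"
  assume "x - x' \<in> lie_ideal ie_relators" "y - y' \<in> lie_ideal ie_relators"
  then have "lie (x - x') y + lie x' (y - y') \<in> lie_ideal ie_relators"
    by (intro lie_ideal.add lie_ideal.lie_left lie_ideal.lie_right)
  then show "lie x y - lie x' y' \<in> lie_ideal ie_relators"
    by (simp add: lie_diff_left lie_diff_right)
qed
instance
proof -
  have eq: "s = t \<Longrightarrow> s - t \<in> lie_ideal ie_relators" for s t :: "gen free_lie"
    by (simp add: lie_ideal.zero)
  show "OFCLASS(ie_lie, clie_algebra_class)"
    by standard
      (transfer, rule eq, rule add.assoc add.commute add_0_left left_minus diff_conv_add_uminus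
        scaleC_add_right scaleC_add_left scaleC_scaleC
        scaleC_one lie_add_left lie_add_right lie_scaleC_left lie_scaleC_right lie_self jacobi)+
qed
end

lift_definition D_plus :: "rtree \<Rightarrow> ie_lie" is "\<lambda>t. fP t" .
lift_definition D_minus :: "rtree \<Rightarrow> ie_lie" is "\<lambda>t. fM t" .
lift_definition d_elem :: ie_lie is fD .

inductive_set lie_subalgebra :: "'l::clie_algebra set \<Rightarrow> 'l set" for X where
  base: "x \<in> X \<Longrightarrow> x \<in> lie_subalgebra X"
| zero: "0 \<in> lie_subalgebra X"
| add: "x \<in> lie_subalgebra X \<Longrightarrow> y \<in> lie_subalgebra X \<Longrightarrow> x + y \<in> lie_subalgebra X"
| scale: "x \<in> lie_subalgebra X \<Longrightarrow> a *\<^sub>C x \<in> lie_subalgebra X"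
| lie: "x \<in> lie_subalgebra X \<Longrightarrow> y \<in> lie_subalgebra X \<Longrightarrow> lie x y \<in> lie_subalgebra X"

definition n_minus :: "ie_lie set" where "n_minus = lie_subalgebra (range D_minus)"

lemma lie_d_D_minus: "lie d_elem (D_minus t) = (- of_nat (tsize t)) *\<^sub>C D_minus t"
  by transfer (rule lie_ideal.base, auto simp: ie_relators_def)

lemma lie_d_n_minus:
  assumes "x \<in> n_minus" shows "lie d_elem x \<in> n_minus"
  using assms unfolding n_minus_def
proof induction
  case (base x)
  then obtain t where "x = D_minus t" by blast
  then show ?case unfolding lie_d_D_minus \<open>x = D_minus t\<close>
    by (intro lie_subalgebra.scale lie_subalgebra.base rangeI)
next
  case (lie x y)
  have "lie d_elem (lie x y) = lie (lie d_elem x) y + lie x (lie d_elem y)"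
  proof -
    have "lie x (lie y d_elem) = - lie x (lie d_elem y)"
      unfolding lie_swap[of y d_elem] by (rule lie_minus_right)
    moreover have "lie y (lie d_elem x) = - lie (lie d_elem x) y" by (rule lie_swap)
    ultimately have "lie d_elem (lie x y) - lie x (lie d_elem y) - lie (lie d_elem x) y = 0"
      using jacobi[of d_elem x y] by simp
    then show ?thesis by (simp add: algebra_simps)
  qed
  then show ?case using lie by (auto intro: lie_subalgebra.intros)
qed (auto simp: lie_zero_right lie_add_right lie_scaleC_right intro: lie_subalgebra.intros)

subsection \<open>The subalgebra \<open>\<complex>d \<oplus> \<nn>\<^sub>-\<close>\<close>

definition bsub :: "ie_lie set" where "bsub = {a *\<^sub>C d_elem + x | a x. x \<in> n_minus}"

lemma bsubE:
  assumes "b \<in> bsub" obtains a x where "b = a *\<^sub>C d_elem + x" "x \<in> n_minus"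
  using assms unfolding bsub_def by blast

lemma bsubI: "x \<in> n_minus \<Longrightarrow> b = a *\<^sub>C d_elem + x \<Longrightarrow> b \<in> bsub"
  unfolding bsub_def by blast

lemma bsub_zero: "0 \<in> bsub"
  by (rule bsubI[of 0 _ 0]) (simp_all add: n_minus_def scaleC_zero_left lie_subalgebra.zero)

lemma bsub_add:
  assumes "x \<in> bsub" "y \<in> bsub" shows "x + y \<in> bsub"
proof -
  obtain a u b v where xy:
    "x = a *\<^sub>C d_elem + u" "u \<in> n_minus" "y = b *\<^sub>C d_elem + v" "v \<in> n_minus"
    using assms by (metis bsubE)
  show ?thesis
  proof (rule bsubI)
    show "u + v \<in> n_minus" using xy unfolding n_minus_def by (intro lie_subalgebra.add)
    show "x + y = (a + b) *\<^sub>C d_elem + (u + v)" by (simp add: xy scaleC_add_left)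
  qed
qed

lemma bsub_scale:
  assumes "x \<in> bsub" shows "c *\<^sub>C x \<in> bsub"
proof -
  obtain a u where x: "x = a *\<^sub>C d_elem + u" "u \<in> n_minus" using assms by (rule bsubE)
  show ?thesis
  proof (rule bsubI)
    show "c *\<^sub>C u \<in> n_minus" using x unfolding n_minus_def by (intro lie_subalgebra.scale)
    show "c *\<^sub>C x = (c * a) *\<^sub>C d_elem + c *\<^sub>C u" by (simp add: x scaleC_add_right scaleC_scaleC)
  qed
qed

lemma bsub_lie:
  assumes "x \<in> bsub" "y \<in> bsub" shows "lie x y \<in> bsub"
proof -
  obtain a u b v where xy:
    "x = a *\<^sub>C d_elem + u" "u \<in> n_minus" "y = b *\<^sub>C d_elem + v" "v \<in> n_minus"
    using assms by (metis bsubE)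
  show ?thesis
  proof (rule bsubI)
    have "(- b) *\<^sub>C lie d_elem u = b *\<^sub>C lie u d_elem"
      using scaleC_scaleC[of b "- 1" "lie d_elem u"] lie_swap[of u d_elem] by (simp add: scaleC_minus_one)
    then show "lie x y = 0 *\<^sub>C d_elem + (a *\<^sub>C lie d_elem v + (- b) *\<^sub>C lie d_elem u + lie u v)"
      by (simp add: xy lie_add_left lie_add_right lie_scaleC_left lie_scaleC_right lie_self
          scaleC_zero_left scaleC_zero_right)
    show "a *\<^sub>C lie d_elem v + (- b) *\<^sub>C lie d_elem u + lie u v \<in> n_minus"
      using lie_d_n_minus[OF xy(2)] lie_d_n_minus[OF xy(4)] xy(2,4) unfolding n_minus_def
      by (blast intro: lie_subalgebra.add lie_subalgebra.scale lie_subalgebra.lie)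
  qed
qed

typedef bsub_lie = bsub
  using bsub_zero by blast

setup_lifting type_definition_bsub_lie

instantiation bsub_lie :: clie_algebra
begin
lift_definition zero_bsub_lie :: bsub_lie is 0 by (rule bsub_zero)
lift_definition plus_bsub_lie :: "bsub_lie \<Rightarrow> bsub_lie \<Rightarrow> bsub_lie" is "(+)"
  by (rule bsub_add)
lift_definition scaleC_bsub_lie :: "complex \<Rightarrow> bsub_lie \<Rightarrow> bsub_lie" is "(*\<^sub>C)"
  by (rule bsub_scale)
lift_definition lie_bsub_lie :: "bsub_lie \<Rightarrow> bsub_lie \<Rightarrow> bsub_lie" is lie
  by (rule bsub_lie)
definition uminus_bsub_lie :: "bsub_lie \<Rightarrow> bsub_lie" where "uminus_bsub_lie x = (- 1) *\<^sub>C x"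
definition minus_bsub_lie :: "bsub_lie \<Rightarrow> bsub_lie \<Rightarrow> bsub_lie" where
  "minus_bsub_lie x y = x + - y"
instance
proof
  fix x y z :: bsub_lie and a b :: complex
  show "- x + x = 0" unfolding uminus_bsub_lie_def
    by transfer (simp add: scaleC_minus_one)
  show "x - y = x + - y" by (rule minus_bsub_lie_def)
qed (transfer, rule add.assoc add.commute add_0_left
  scaleC_add_right scaleC_add_left scaleC_scaleC
  scaleC_one lie_add_left lie_add_right lie_scaleC_left lie_scaleC_right lie_self jacobi)+
end


section \<open>Tensor products and the Verma module\<close>

text \<open>\<open>M \<otimes>\<^sub>A N\<close> for a right \<open>A\<close>-module \<open>M\<close> with action \<open>ra\<close> and a left \<open>A\<close>-module \<open>N\<close> with
  action \<open>la\<close>: the free abelian group on \<open>M \<times> N\<close> modulo the subgroup generated by the usual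
  relators.\<close>

definition tensor_relators ::
  "('m::ab_group_add \<Rightarrow> 'r \<Rightarrow> 'm) \<Rightarrow> ('r \<Rightarrow> 'n::ab_group_add \<Rightarrow> 'n) \<Rightarrow> ('m \<times> 'n \<Rightarrow>\<^sub>0 int) set" where
  "tensor_relators ra la =
     {frag_of (x + y, z) - (frag_of (x, z) + frag_of (y, z)) | x y z. True}
   \<union> {frag_of (x, z + w) - (frag_of (x, z) + frag_of (x, w)) | x z w. True}
   \<union> {frag_of (ra x r, z) - frag_of (x, la r z) | x r z. True}"

definition tensor_subgroup ::
  "('m::ab_group_add \<Rightarrow> 'r \<Rightarrow> 'm) \<Rightarrow> ('r \<Rightarrow> 'n::ab_group_add \<Rightarrow> 'n) \<Rightarrow> ('m \<times> 'n \<Rightarrow>\<^sub>0 int) set" where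
  "tensor_subgroup ra la = generate (free_Abelian_group UNIV) (tensor_relators ra la)"

definition tensor_product ::
  "('m::ab_group_add \<Rightarrow> 'r \<Rightarrow> 'm) \<Rightarrow> ('r \<Rightarrow> 'n::ab_group_add \<Rightarrow> 'n) \<Rightarrow> ('m \<times> 'n \<Rightarrow>\<^sub>0 int) set monoid"
  where "tensor_product ra la = free_Abelian_group UNIV Mod tensor_subgroup ra la"

text \<open>The endomorphism \<open>f \<otimes> id\<close> of \<open>M \<otimes>\<^sub>A N\<close>, for \<open>f\<close> an endomorphism of the right module \<open>M\<close>:
  the coset of \<open>u\<close> is sent to the coset of the image of \<open>u\<close>.\<close>

definition tensor_map ::
  "('m::ab_group_add \<Rightarrow> 'r \<Rightarrow> 'm) \<Rightarrow> ('r \<Rightarrow> 'n::ab_group_add \<Rightarrow> 'n) \<Rightarrow> ('m \<Rightarrow> 'm)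
     \<Rightarrow> ('m \<times> 'n \<Rightarrow>\<^sub>0 int) set \<Rightarrow> ('m \<times> 'n \<Rightarrow>\<^sub>0 int) set" where
  "tensor_map ra la f X =
     (\<Union>u\<in>X. tensor_subgroup ra la #>\<^bsub>free_Abelian_group UNIV\<^esub> frag_extend (\<lambda>(x, z). frag_of (f x, z)) u)"

definition irreducible_module :: "'w monoid \<Rightarrow> ('r \<Rightarrow> 'w \<Rightarrow> 'w) \<Rightarrow> bool" where
  "irreducible_module W act \<longleftrightarrow> carrier W \<noteq> {\<one>\<^bsub>W\<^esub>} \<and>
     (\<forall>S. subgroup S W \<and> (\<forall>u. \<forall>x\<in>S. act u x \<in> S) \<longrightarrow> S = {\<one>\<^bsub>W\<^esub>} \<or> S = carrier W)"

text \<open>The character \<open>a d + x \<mapsto> a lam\<close> (\<open>x \<in> \<nn>\<^sub>-\<close>) through which \<open>\<complex>d \<oplus> \<nn>\<^sub>-\<close> acts on the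
  one-dimensional representation of weight \<open>lam\<close>.\<close>

definition weight_char :: "complex \<Rightarrow> bsub_lie \<Rightarrow> complex" where
  "weight_char lam b = (THE a. \<exists>x\<in>n_minus. Rep_bsub_lie b = a *\<^sub>C d_elem + x) * lam"

definition C_act :: "complex \<Rightarrow> bsub_lie uea \<Rightarrow> complex \<Rightarrow> complex" where
  "C_act lam u z = uea_extend (weight_char lam) u * z"

definition U_right_act :: "ie_lie uea \<Rightarrow> bsub_lie uea \<Rightarrow> ie_lie uea" where
  "U_right_act x u = x * uea_extend (\<lambda>b. uinc (Rep_bsub_lie b)) u"

definition verma :: "complex \<Rightarrow> (ie_lie uea \<times> complex \<Rightarrow>\<^sub>0 int) set monoid" where
  "verma lam = tensor_product U_right_act (C_act lam)"

definition verma_act ::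
  "complex \<Rightarrow> ie_lie uea \<Rightarrow> (ie_lie uea \<times> complex \<Rightarrow>\<^sub>0 int) set \<Rightarrow> (ie_lie uea \<times> complex \<Rightarrow>\<^sub>0 int) set"
  where "verma_act lam u = tensor_map U_right_act (C_act lam) (\<lambda>x. u * x)"

end

theory Submission
  imports Defs "HOL-Library.Multiset" "Jordan_Normal_Form.Determinant"
begin

text \<open>
  Let \<open>U\<close> be the enveloping algebra of the insertion-elimination algebra. As a \<open>U\<close>-module the Verma
  module of weight \<open>lam\<close> is \<open>U / J\<close>, where the left ideal \<open>J\<close> (\<open>verma_ideal\<close>) consists of the \<open>x\<close> with
  \<open>x \<otimes> 1 = 0\<close>; it contains all \<open>D\<^sup>-\<^sub>t\<close> and \<open>d - lam\<close>. So the Verma module is irreducible if and only if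
  \<open>J\<close> is a maximal left ideal, and the proof has three parts.

  \<open>J\<close> is proper. This needs a representation with a vector killed by every \<open>D\<^sup>-\<^sub>t\<close> on which \<open>d\<close> acts by
  \<open>lam\<close>. On the span of all rooted trees, joining and cutting trees satisfies the defining relations,
  and the one-vertex tree \<open>\<bullet>\<close> is such a vector of weight 1. These operators extend to derivations of the
  polynomials in one variable \<open>x\<^sub>t\<close> for each tree \<open>t\<close>, and further to monomials with complex exponents,
  among which \<open>x\<^sub>\<bullet>\<close> to the power \<open>lam\<close> is the vector wanted. The relations on trees are the identities \<open>sum_join_join\<close>, \<open>sum_cut_join\<close> and \<open>sum_cut_cut\<close>.

  Pairing of words. Modulo \<open>J\<close>, words \<open>D\<^sup>+\<^sub>t\<^sub>1 \<dots> D\<^sup>+\<^sub>t\<^sub>k\<close> span \<open>U\<close>, and the order of the letters matters only up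
  to shorter words. If \<open>S\<close> and \<open>T\<close> have the same total number of vertices, the product of the
  \<open>D\<^sup>-\<^sub>s\<close> for \<open>s\<close> in \<open>S\<close> with the \<open>D\<^sup>+\<^sub>t\<close> for \<open>t\<close> in \<open>T\<close> is congruent to a polynomial in \<open>lam\<close>. A factor
  \<open>lam\<close> comes only from \<open>[D\<^sup>-\<^sub>t, D\<^sup>+\<^sub>t] = d\<close>, which uses up one letter on each side. Hence twice the
  degree is at most \<open>|S| + |T|\<close>, with equality exactly if \<open>S\<close> and \<open>T\<close> are the same multiset
  (\<open>pairing_lead\<close>). In each weight the matrix of these polynomials is finite and its determinant is
  nonzero, being dominated by the diagonal (\<open>poly_matrix_det_nonzero\<close>). So it is singular for only finitely
  many \<open>lam\<close> (\<open>finite_degenerate\<close>), and the exceptional set is the union over the countably many weights.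

  Maximality. Let \<open>lam\<close> be outside this set and \<open>L\<close> a left ideal properly containing \<open>J\<close>. Because \<open>d\<close>
  has different eigenvalues on different weights, \<open>L\<close> contains a weight vector outside \<open>J\<close>. By
  nondegeneracy some product of \<open>D\<^sup>-\<^sub>s\<close> maps it to a nonzero scalar modulo \<open>J\<close>, so \<open>1 \<in> L\<close>
  (\<open>left_ideal_contains_one\<close>).
\<close>

section \<open>Rooted trees as graphs\<close>

lemma reachable_refl: "v \<in> reachable E v"
  by (simp add: reachable_def)

lemma reachable_step: "x \<in> reachable E v \<Longrightarrow> {x, y} \<in> E \<Longrightarrow> y \<in> reachable E v"
  unfolding reachable_def by (auto intro: rtrancl_into_rtrancl)

lemma reachable_least:
  assumes "v \<in> X" and closed: "\<And>x y. x \<in> X \<Longrightarrow> {x, y} \<in> E \<Longrightarrow> y \<in> X"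
  shows "reachable E v \<subseteq> X"
proof
  fix w assume "w \<in> reachable E v"
  then have "(v, w) \<in> {(a, b). {a, b} \<in> E}\<^sup>*" by (simp add: reachable_def)
  then show "w \<in> X" by induction (use assms in auto)
qed

lemma reachable_mono: "E \<subseteq> E' \<Longrightarrow> reachable E v \<subseteq> reachable E' v"
  by (rule reachable_least) (auto intro: reachable_refl reachable_step)

lemma reachable_trans: "w \<in> reachable E v \<Longrightarrow> x \<in> reachable E w \<Longrightarrow> x \<in> reachable E v"
  unfolding reachable_def by auto

lemma reachable_sym: "w \<in> reachable E v \<Longrightarrow> v \<in> reachable E w"
proof -
  have "reachable E v \<subseteq> {w. v \<in> reachable E w}"
  proof (rule reachable_least)
    fix x y assume "x \<in> {w. v \<in> reachable E w}" "{x, y} \<in> E"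
    then show "y \<in> {w. v \<in> reachable E w}"
      using reachable_trans[of x E y v] reachable_step[of y E y x] reachable_refl[of y E]
      by (simp add: insert_commute)
  qed (simp add: reachable_refl)
  then show "w \<in> reachable E v \<Longrightarrow> v \<in> reachable E w" by auto
qed

text \<open>A connected component stays connected when only the edges inside it are kept; used for the two
  components left by a cut.\<close>

lemma reachable_restrict:
  assumes "C = reachable E v" shows "reachable {f \<in> E. f \<subseteq> C} v = C"
proof
  show "reachable {f \<in> E. f \<subseteq> C} v \<subseteq> C"
    unfolding assms by (rule reachable_mono) auto
  have "reachable E v \<subseteq> C \<inter> reachable {f \<in> E. f \<subseteq> C} v"
  proof (rule reachable_least)
    fix x y assume x: "x \<in> C \<inter> reachable {f \<in> E. f \<subseteq> C} v" and e: "{x, y} \<in> E"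
    then have "y \<in> C" using assms reachable_step by blast
    with x e show "y \<in> C \<inter> reachable {f \<in> E. f \<subseteq> C} v"
      by (auto intro: reachable_step)
  qed (simp add: assms reachable_refl)
  then show "C \<subseteq> reachable {f \<in> E. f \<subseteq> C} v" using assms by auto
qed

lemma reachable_distinct_path:
  assumes "w \<in> reachable E v"
  shows "\<exists>vs. vs \<noteq> [] \<and> hd vs = v \<and> last vs = w \<and> distinct vs \<and> successively (\<lambda>a b. {a, b} \<in> E) vs"
proof -
  let ?P = "\<lambda>w vs. vs \<noteq> [] \<and> hd vs = v \<and> last vs = w \<and> distinct vs \<and> successively (\<lambda>a b. {a, b} \<in> E) vs"
  have "reachable E v \<subseteq> {w. \<exists>vs. ?P w vs}"
  proof (rule reachable_least)
    show "v \<in> {w. \<exists>vs. ?P w vs}" by (auto intro!: exI[of _ "[v]"])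
    fix x y assume "x \<in> {w. \<exists>vs. ?P w vs}" and e: "{x, y} \<in> E"
    then obtain vs where vs: "?P x vs" by auto
    show "y \<in> {w. \<exists>vs. ?P w vs}"
    proof (cases "y \<in> set vs")
      case True
      then obtain p q where "vs = p @ y # q" by (meson split_list)
      then have pq: "vs = (p @ [y]) @ q" by simp
      have "successively (\<lambda>a b. {a, b} \<in> E) (p @ [y])"
        using vs unfolding pq successively_append_iff by blast
      moreover have "hd (p @ [y]) = v" using vs unfolding pq by (cases p) auto
      ultimately have "?P y (p @ [y])" using vs unfolding pq by auto
      then show ?thesis by blast
    next
      case False
      have "?P y (vs @ [y])" using vs False e by (auto simp: successively_append_iff)
      then show ?thesis by blast
    qed
  qed
  then show ?thesis using assms by blast
qed

text \<open>A path from \<open>a\<close> to \<open>b\<close> that avoids the edge \<open>{a, b}\<close> closes up to a cycle, and a cycle without one of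
  its edges is such a path. Unlike cycles, bridges behave well under gluing and restriction, so this
  form of acyclicity is the one used for joins and cuts.\<close>

lemma acyclic_iff_bridges:
  assumes E: "\<forall>e\<in>E. \<exists>a b. a \<noteq> b \<and> e = {a, b}"
  shows "(\<nexists>vs. is_cycle E vs) \<longleftrightarrow> (\<forall>a b. {a, b} \<in> E \<longrightarrow> b \<notin> reachable (E - {{a, b}}) a)"
proof
  assume acyc: "\<nexists>vs. is_cycle E vs"
  show "\<forall>a b. {a, b} \<in> E \<longrightarrow> b \<notin> reachable (E - {{a, b}}) a"
  proof (intro allI impI notI)
    fix a b assume ab: "{a, b} \<in> E" "b \<in> reachable (E - {{a, b}}) a"
    from ab(1) E have ne: "a \<noteq> b" by (metis doubleton_eq_iff)
    obtain vs where vs: "vs \<noteq> []" "hd vs = a" "last vs = b" "distinct vs"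
      "successively (\<lambda>x y. {x, y} \<in> E - {{a, b}}) vs"
      using reachable_distinct_path[OF ab(2)] by blast
    have nth: "\<And>i. Suc i < length vs \<Longrightarrow> {vs ! i, vs ! Suc i} \<in> E - {{a, b}}"
      using vs(5) by (simp add: successively_conv_nth)
    have ends: "vs ! 0 = a" "vs ! (length vs - 1) = b"
      using vs by (simp_all add: hd_conv_nth last_conv_nth)
    have len: "length vs \<ge> 3"
    proof (rule ccontr)
      assume "\<not> length vs \<ge> 3"
      moreover have "length vs \<noteq> 0" "length vs \<noteq> 1" using vs(1) ends ne by auto
      ultimately have l2: "length vs = 2" by linarith
      show False using nth[of 0] ends by (simp add: l2)
    qed
    have "is_cycle E vs" unfolding is_cycle_def
    proof (intro conjI allI impI)
      fix i assume i: "i < length vs"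
      show "{vs ! i, vs ! (Suc i mod length vs)} \<in> E"
      proof (cases "Suc i < length vs")
        case True then show ?thesis using nth[of i] by simp
      next
        case False
        then have "i = length vs - 1" "Suc i mod length vs = 0" using i
          by (auto simp: less_Suc_eq not_less_eq dest: le_antisym)
        then show ?thesis using ends ab(1) by (simp add: insert_commute)
      qed
    qed (use len vs in auto)
    then show False using acyc by blast
  qed
next
  assume br: "\<forall>a b. {a, b} \<in> E \<longrightarrow> b \<notin> reachable (E - {{a, b}}) a"
  show "\<nexists>vs. is_cycle E vs"
  proof
    assume "\<exists>vs. is_cycle E vs"
    then obtain vs where vs: "length vs \<ge> 3" "distinct vs"
      "\<And>i. i < length vs \<Longrightarrow> {vs ! i, vs ! (Suc i mod length vs)} \<in> E"
      by (auto simp: is_cycle_def)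
    define n where "n = length vs"
    define e where "e = {vs ! 0, vs ! (n - 1)}"
    have "Suc (n - 1) = length vs" "n - 1 < length vs" using vs(1) by (auto simp: n_def)
    then have e: "e \<in> E" using vs(3)[of "n - 1"] by (simp add: e_def insert_commute)
    have "i < n \<Longrightarrow> vs ! i \<in> reachable (E - {e}) (vs ! 0)" for i
    proof (induction i)
      case (Suc i)
      have "{vs ! i, vs ! Suc i} \<noteq> e"
      proof
        assume "{vs ! i, vs ! Suc i} = e"
        then have "vs ! i = vs ! 0 \<and> vs ! Suc i = vs ! (n - 1) \<or> vs ! i = vs ! (n - 1)"
          by (auto simp: e_def doubleton_eq_iff)
        then have "i = 0 \<and> Suc i = n - 1 \<or> i = n - 1"
          using Suc.prems vs(1,2) \<open>n - 1 < length vs\<close> nth_eq_iff_index_eq[of vs i 0] nth_eq_iff_index_eq[of vs i "n - 1"]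
            nth_eq_iff_index_eq[of vs "Suc i" "n - 1"]
          by (cases "vs = []") (auto simp: n_def)
        then show False using Suc.prems vs(1) by (auto simp: n_def)
      qed
      moreover have "{vs ! i, vs ! Suc i} \<in> E" using vs(3)[of i] Suc.prems by (simp add: n_def)
      ultimately show ?case using Suc by (auto intro: reachable_step)
    qed (simp add: reachable_refl)
    from this[of "n - 1"] have "vs ! (n - 1) \<in> reachable (E - {e}) (vs ! 0)"
      using vs(1) by (simp add: n_def)
    then show False using br e unfolding e_def by blast
  qed
qed

lemma is_rooted_tree_iff:
  "is_rooted_tree (V, E, r) \<longleftrightarrow> finite V \<and> r \<in> V \<and> (\<forall>e\<in>E. \<exists>a\<in>V. \<exists>b\<in>V. a \<noteq> b \<and> e = {a, b})
     \<and> reachable E r = V \<and> (\<forall>a b. {a, b} \<in> E \<longrightarrow> b \<notin> reachable (E - {{a, b}}) a)"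
  (is "_ \<longleftrightarrow> ?fin \<and> ?r \<and> ?E \<and> ?conn \<and> ?bri")
proof -
  have E: "E \<subseteq> {{a, b} | a b. a \<in> V \<and> b \<in> V \<and> a \<noteq> b} \<longleftrightarrow> ?E" by (auto 0 4)
  have c: "(\<forall>v\<in>V. \<forall>w\<in>V. w \<in> reachable E v) \<longleftrightarrow> ?conn" if rV: ?r and EE: ?E
  proof
    assume c: "\<forall>v\<in>V. \<forall>w\<in>V. w \<in> reachable E v"
    have "reachable E r \<subseteq> V"
    proof (rule reachable_least[OF rV])
      fix x y assume "{x, y} \<in> E"
      then obtain a b where "a \<in> V" "b \<in> V" "{x, y} = {a, b}" using EE by blast
      then show "y \<in> V" by (auto simp: doubleton_eq_iff)
    qed
    then show ?conn using c rV by blast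
  next
    assume ?conn
    then show "\<forall>v\<in>V. \<forall>w\<in>V. w \<in> reachable E v"
      by (metis reachable_sym reachable_trans)
  qed
  have cyc: "(\<nexists>vs. is_cycle E vs) \<longleftrightarrow> ?bri" if EE: ?E
  proof (rule acyclic_iff_bridges)
    show "\<forall>e\<in>E. \<exists>a b. a \<noteq> b \<and> e = {a, b}" using EE by blast
  qed
  show ?thesis unfolding is_rooted_tree.simps E using c cyc by blast
qed

lemma edge_subset_verts: "is_rooted_tree G \<Longrightarrow> e \<in> edgs G \<Longrightarrow> e \<subseteq> verts G"
  by (cases G) (force simp: is_rooted_tree_iff)

lemma rt_in_verts: "is_rooted_tree G \<Longrightarrow> rt G \<in> verts G"
  by (cases G) (simp add: is_rooted_tree_iff)

lemma finite_verts: "is_rooted_tree G \<Longrightarrow> finite (verts G)"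
  by (cases G) (simp add: is_rooted_tree_iff)

lemma finite_edgs: "is_rooted_tree G \<Longrightarrow> finite (edgs G)"
  using edge_subset_verts finite_verts by (metis Pow_iff finite_Pow_iff finite_subset subsetI)

subsection \<open>Joining disjoint trees\<close>

text \<open>Joining without relabelling, for trees with disjoint vertex sets. The point of the literal unions is
  that joins performed in a different order give equal graphs and not merely isomorphic ones.\<close>

fun gjoin :: "rgraph \<Rightarrow> nat \<Rightarrow> rgraph \<Rightarrow> rgraph" where
  "gjoin (V, E, r) v (V', E', r') = (V \<union> V', insert {v, r'} (E \<union> E'), r)"

lemma verts_gjoin [simp]: "verts (gjoin S v T) = verts S \<union> verts T"
  by (cases S; cases T) simp

lemma edgs_gjoin [simp]: "edgs (gjoin S v T) = insert {v, rt T} (edgs S \<union> edgs T)"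
  by (cases S; cases T) simp

lemma rt_gjoin [simp]: "rt (gjoin S v T) = rt S"
  by (cases S; cases T) simp

definition joinable :: "rgraph \<Rightarrow> nat \<Rightarrow> rgraph \<Rightarrow> bool" where
  "joinable S v T \<longleftrightarrow> is_rooted_tree S \<and> is_rooted_tree T \<and> verts S \<inter> verts T = {} \<and> v \<in> verts S"

text \<open>Deleting an edge of one tree leaves the other tree attached to the part containing the joining
  vertex, if that part is reached at all.\<close>

lemma bridge_join:
  assumes disj: "V \<inter> W = {}"
    and EV: "\<And>x y. {x, y} \<in> E \<Longrightarrow> x \<in> V \<and> y \<in> V" and FW: "\<And>x y. {x, y} \<in> F \<Longrightarrow> x \<in> W \<and> y \<in> W"
    and v: "v \<in> V" and w: "w \<in> W" and ab: "{a, b} \<in> E" and bri: "b \<notin> reachable (E - {{a, b}}) a"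
  shows "b \<notin> reachable (insert {v, w} (E \<union> F) - {{a, b}}) a"
proof -
  let ?X = "reachable (E - {{a, b}}) a"
  let ?Y = "?X \<union> (if v \<in> ?X then W else {})"
  have abV: "a \<in> V" "b \<in> V" using EV[OF ab] by auto
  have X: "?X \<subseteq> V" by (rule reachable_least) (use abV EV in auto)
  have "reachable (insert {v, w} (E \<union> F) - {{a, b}}) a \<subseteq> ?Y"
  proof (rule reachable_least)
    show "a \<in> ?Y" by (simp add: reachable_refl)
    fix x y assume x: "x \<in> ?Y" and "{x, y} \<in> insert {v, w} (E \<union> F) - {{a, b}}"
    then consider "{x, y} \<in> E - {{a, b}}" | "{x, y} \<in> F" | "x = v" "y = w" | "x = w" "y = v"
      unfolding Diff_iff insert_iff Un_iff doubleton_eq_iff by blast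
    then show "y \<in> ?Y"
    proof cases
      case 1
      then have "x \<in> ?X" using x EV[of x y] FW[of x y] disj by (auto split: if_splits)
      then show ?thesis using 1 by (simp add: reachable_step)
    qed (use x X disj EV[of x y] FW[of x y] v w in \<open>auto split: if_splits\<close>)
  qed
  then show ?thesis using bri abV disj by (auto split: if_splits)
qed

lemma tree_gjoin:
  assumes "joinable S v T" shows "is_rooted_tree (gjoin S v T)"
proof (cases S, cases T)
  fix V E r V' E' r' assume eq: "S = (V, E, r)" "T = (V', E', r')"
  let ?F = "insert {v, r'} (E \<union> E')"
  note a = assms[unfolded joinable_def eq is_rooted_tree_iff verts.simps]
  have disj: "V \<inter> V' = {}" and v: "v \<in> V" and r': "r' \<in> V'" and r: "r \<in> V" using a by auto
  have EV: "x \<in> V \<and> y \<in> V \<and> x \<noteq> y" if "{x, y} \<in> E" for x y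
    using a that by (metis doubleton_eq_iff)
  have EV': "x \<in> V' \<and> y \<in> V' \<and> x \<noteq> y" if "{x, y} \<in> E'" for x y
    using a that by (metis doubleton_eq_iff)
  have brS: "\<forall>a b. {a, b} \<in> E \<longrightarrow> b \<notin> reachable (E - {{a, b}}) a"
    and brT: "\<forall>a b. {a, b} \<in> E' \<longrightarrow> b \<notin> reachable (E' - {{a, b}}) a"
    and edS: "\<forall>e\<in>E. \<exists>a\<in>V. \<exists>b\<in>V. a \<noteq> b \<and> e = {a, b}"
    and edT: "\<forall>e\<in>E'. \<exists>a\<in>V'. \<exists>b\<in>V'. a \<noteq> b \<and> e = {a, b}"
    using a by - (elim conjE, assumption)+
  have conn: "reachable ?F r = V \<union> V'"
  proof
    show "reachable ?F r \<subseteq> V \<union> V'"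
      by (rule reachable_least) (use r v r' EV EV' in \<open>auto simp: doubleton_eq_iff\<close>)
    have V: "V \<subseteq> reachable ?F r"
      using a reachable_mono[of E ?F r] by auto
    have "r' \<in> reachable ?F r" using V v by (auto intro: reachable_step)
    moreover have "V' \<subseteq> reachable ?F r'"
      using a reachable_mono[of E' ?F r'] by auto
    ultimately show "V \<union> V' \<subseteq> reachable ?F r" using V reachable_trans by blast
  qed
  have bri: "b \<notin> reachable (?F - {{a, b}}) a" if ab: "{a, b} \<in> ?F" for a b
  proof -
    consider "{a, b} \<in> E" | "{a, b} \<in> E'" | "a = v" "b = r'" | "b = v" "a = r'"
      using ab unfolding insert_iff Un_iff doubleton_eq_iff by blast
    then show ?thesis
    proof cases
      case 1
      then show ?thesis using bridge_join[of V V' E E' v r' a b] disj EV EV' v r' brS by blast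
    next
      case 2
      then have "b \<notin> reachable (insert {r', v} (E' \<union> E) - {{a, b}}) a"
        using bridge_join[of V' V E' E r' v a b] disj EV EV' v r' brT by blast
      then show ?thesis by (simp add: insert_commute Un_commute)
    next
      case 3
      have "reachable (?F - {{a, b}}) a \<subseteq> V"
        by (rule reachable_least) (use 3 v r' disj EV EV' in \<open>auto simp: doubleton_eq_iff\<close>)
      then show ?thesis using 3 r' disj by auto
    next
      case 4
      have "reachable (?F - {{a, b}}) a \<subseteq> V'"
        by (rule reachable_least) (use 4 v r' disj EV EV' in \<open>auto simp: doubleton_eq_iff\<close>)
      then show ?thesis using 4 v disj by auto
    qed
  qed
  have ed: "\<forall>e\<in>?F. \<exists>a\<in>V \<union> V'. \<exists>b\<in>V \<union> V'. a \<noteq> b \<and> e = {a, b}"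
  proof
    fix e assume "e \<in> ?F"
    then consider "e = {v, r'}" | "e \<in> E" | "e \<in> E'" by blast
    then show "\<exists>a\<in>V \<union> V'. \<exists>b\<in>V \<union> V'. a \<noteq> b \<and> e = {a, b}"
    proof cases
      case 1
      moreover have "v \<noteq> r'" using v r' disj by auto
      ultimately show ?thesis using v r' by blast
    next
      case 2 then show ?thesis using edS by (meson UnI1)
    next
      case 3 then show ?thesis using edT by (meson UnI2)
    qed
  qed
  show ?thesis unfolding eq gjoin.simps is_rooted_tree_iff
  proof (intro conjI)
    show "finite (V \<union> V')" "r \<in> V \<union> V'" using a by auto
    show "\<forall>a b. {a, b} \<in> ?F \<longrightarrow> b \<notin> reachable (?F - {{a, b}}) a" using bri by blast
  qed (fact ed conn)+
qed

lemma new_edge_notin: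
  assumes "joinable S v T" shows "{v, rt T} \<notin> edgs S \<union> edgs T"
  using assms edge_subset_verts[of S "{v, rt T}"] edge_subset_verts[of T "{v, rt T}"]
    rt_in_verts[of T] unfolding joinable_def by blast

text \<open>Cutting the new edge undoes the join. Together with \<open>tree_cut\<close>, by which every cut arises in this way,
  it turns each statement about cuts into a statement about decompositions as a join.\<close>

lemma cut_gjoin:
  assumes "joinable S v T"
  shows root_part_gjoin: "root_part_raw {v, rt T} (gjoin S v T) = S"
    and pruned_part_gjoin: "pruned_part_raw {v, rt T} (gjoin S v T) = T"
proof -
  obtain V E r V' E' r' where eq: "S = (V, E, r)" "T = (V', E', r')" by (cases S; cases T) blast
  note a = assms[unfolded joinable_def eq is_rooted_tree_iff verts.simps]
  have disj: "V \<inter> V' = {}" and v: "v \<in> V" and r': "r' \<in> V'" and r: "r \<in> V" using a by auto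
  have edS: "\<forall>e\<in>E. \<exists>a\<in>V. \<exists>b\<in>V. a \<noteq> b \<and> e = {a, b}"
    and edT: "\<forall>e\<in>E'. \<exists>a\<in>V'. \<exists>b\<in>V'. a \<noteq> b \<and> e = {a, b}"
    using a by - (elim conjE, assumption)+
  have new: "{v, r'} \<notin> E" "{v, r'} \<notin> E'" using new_edge_notin[OF assms] by (auto simp: eq)
  then have F: "insert {v, r'} (E \<union> E') - {{v, r'}} = E \<union> E'" by blast
  have EV: "e \<subseteq> V \<and> e \<noteq> {}" if "e \<in> E" for e using edS[rule_format, OF that] by auto
  have EV': "e \<subseteq> V' \<and> e \<noteq> {}" if "e \<in> E'" for e using edT[rule_format, OF that] by auto
  have C: "reachable (E \<union> E') r = V"
  proof
    show "reachable (E \<union> E') r \<subseteq> V"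
    proof (rule reachable_least[OF r])
      fix x y assume "x \<in> V" "{x, y} \<in> E \<union> E'"
      then show "y \<in> V" using EV[of "{x, y}"] EV'[of "{x, y}"] disj by auto
    qed
    have "reachable E r = V" using a by (elim conjE)
    then show "V \<subseteq> reachable (E \<union> E') r"
      using reachable_mono[of E "E \<union> E'" r] by auto
  qed
  have E1: "{f \<in> E \<union> E'. f \<subseteq> V} = E"
  proof -
    have "\<not> f \<subseteq> V" if "f \<in> E'" for f using EV'[OF that] disj by blast
    then show ?thesis using EV by blast
  qed
  have E2: "{f \<in> E \<union> E'. f \<subseteq> V'} = E'"
  proof -
    have "\<not> f \<subseteq> V'" if "f \<in> E" for f using EV[OF that] disj by blast
    then show ?thesis using EV' by blast
  qed
  have V2: "V \<union> V' - V = V'" using disj by blast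
  have "{v, r'} \<inter> V' = {r'}" using v r' disj by auto
  then have r2: "(THE x. x \<in> {v, r'} \<inter> V') = r'" by simp
  show "root_part_raw {v, rt T} (gjoin S v T) = S"
    unfolding eq rt.simps gjoin.simps root_part_raw.simps Let_def F C E1 ..
  show "pruned_part_raw {v, rt T} (gjoin S v T) = T"
    unfolding eq rt.simps gjoin.simps pruned_part_raw.simps Let_def F C V2 E2 r2 ..
qed

text \<open>Since \<open>e\<close> is a bridge, it has exactly one endpoint \<open>x\<close> in the component \<open>C\<close> of the root; the
  component \<open>D\<close> of the other endpoint \<open>y\<close> is the rest.\<close>

lemma tree_cut:
  assumes "is_rooted_tree G" "e \<in> edgs G"
  obtains S v T where "joinable S v T" "e = {v, rt T}" "G = gjoin S v T"
proof -
  obtain V E r where G: "G = (V, E, r)" by (cases G)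
  note a = assms[unfolded G is_rooted_tree_iff edgs.simps]
  have e: "e \<in> E" and r: "r \<in> V" and conn: "reachable E r = V" using a by auto
  have EV: "x \<in> V \<and> y \<in> V \<and> x \<noteq> y" if "{x, y} \<in> E" for x y
    using a that by (metis doubleton_eq_iff)
  have bri: "b \<notin> reachable (E - {{a, b}}) a" if "{a, b} \<in> E" for a b using a that by blast
  have ed: "\<forall>e\<in>E. \<exists>a\<in>V. \<exists>b\<in>V. a \<noteq> b \<and> e = {a, b}" using a(1) by (elim conjE)
  let ?E = "E - {e}"
  define C where "C = reachable ?E r"
  have clC: "y \<in> C" if "x \<in> C" "{x, y} \<in> E" "{x, y} \<noteq> e" for x y
    using that unfolding C_def by (blast intro: reachable_step)
  obtain x y where xy: "e = {x, y}" "x \<in> C" "y \<notin> C"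
  proof -
    obtain p q where pq: "e = {p, q}" using ed[rule_format, OF e] by (elim bexE conjE)
    have "\<not> (p \<in> C \<and> q \<in> C)"
      using bri[of p q] e unfolding pq[symmetric] C_def
      by (meson reachable_sym reachable_trans)
    moreover have "p \<in> C \<or> q \<in> C"
    proof (rule ccontr)
      assume n: "\<not> (p \<in> C \<or> q \<in> C)"
      have "reachable E r \<subseteq> C"
      proof (rule reachable_least)
        show "r \<in> C" by (simp add: C_def reachable_refl)
        fix u w assume "u \<in> C" "{u, w} \<in> E"
        then show "w \<in> C" using clC[of u w] n by (auto simp: pq doubleton_eq_iff)
      qed
      then show False using conn n EV[of p q] e pq by auto
    qed
    ultimately show ?thesis using that[of p q] that[of q p] pq by (auto simp: insert_commute)
  qed
  have CV: "C \<subseteq> V" unfolding C_def using reachable_mono[of ?E E r] conn by auto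
  have xyV: "x \<in> V" "y \<in> V" "x \<noteq> y" using EV[of x y] e xy by auto
  define D where "D = reachable ?E y"
  have disj: "C \<inter> D = {}"
    using xy(3) unfolding C_def D_def by (meson disjoint_iff reachable_sym reachable_trans)
  have clD: "w \<in> D" if "u \<in> D" "{u, w} \<in> E" "{u, w} \<noteq> e" for u w
    using that unfolding D_def by (blast intro: reachable_step)
  have DV: "D \<subseteq> V" unfolding D_def by (rule reachable_least) (use EV xyV in auto)
  have "V \<subseteq> C \<union> D"
    unfolding conn[symmetric]
  proof (rule reachable_least)
    show "r \<in> C \<union> D" by (simp add: C_def reachable_refl)
    have "y \<in> D" by (simp add: D_def reachable_refl)
    then show "w \<in> C \<union> D" if "u \<in> C \<union> D" "{u, w} \<in> E" for u w
      using that clC[of u w] clD[of u w] xy by (auto simp: doubleton_eq_iff)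
  qed
  then have V: "V = C \<union> D" using CV DV by auto
  define S where "S = (C, {f \<in> ?E. f \<subseteq> C}, r)"
  define T where "T = (D, {f \<in> ?E. f \<subseteq> D}, y)"
  have sub: "is_rooted_tree (X, {f \<in> ?E. f \<subseteq> X}, z)" if X: "X = reachable ?E z" "X \<subseteq> V" for X z
    unfolding is_rooted_tree_iff
  proof (intro conjI allI impI ballI)
    show "finite X" using X a finite_subset by auto
    show "z \<in> X" using X reachable_refl by blast
    show "reachable {f \<in> ?E. f \<subseteq> X} z = X" by (rule reachable_restrict) (rule X)
    fix p q assume "{p, q} \<in> {f \<in> ?E. f \<subseteq> X}"
    then have "q \<notin> reachable (E - {{p, q}}) p" using bri by blast
    moreover have "reachable ({f \<in> ?E. f \<subseteq> X} - {{p, q}}) p \<subseteq> reachable (E - {{p, q}}) p"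
      by (rule reachable_mono) auto
    ultimately show "q \<notin> reachable ({f \<in> ?E. f \<subseteq> X} - {{p, q}}) p" by blast
  next
    fix f assume f: "f \<in> {f \<in> ?E. f \<subseteq> X}"
    then have "f \<in> E" "f \<subseteq> X" by auto
    from ed[rule_format, OF this(1)] obtain p q where "p \<noteq> q" "f = {p, q}" by (elim bexE conjE)
    then show "\<exists>a\<in>X. \<exists>b\<in>X. a \<noteq> b \<and> f = {a, b}" using \<open>f \<subseteq> X\<close>
      by (intro bexI[of _ p] bexI[of _ q]) auto
  qed
  have "joinable S x T"
    unfolding joinable_def S_def T_def using sub[OF C_def CV] sub[OF D_def DV] disj xy by simp
  moreover have "E = insert {x, y} ({f \<in> ?E. f \<subseteq> C} \<union> {f \<in> ?E. f \<subseteq> D})"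
  proof -
    have "f \<subseteq> C \<or> f \<subseteq> D" if f: "f \<in> E" "f \<noteq> e" for f
    proof -
      from ed[rule_format, OF f(1)] obtain p q where "f = {p, q}" by (elim bexE conjE)
      then show ?thesis using f V EV[of p q] clC[of p q] clD[of p q] by auto
    qed
    then show ?thesis using e xy(1) by auto
  qed
  then have "G = gjoin S x T" unfolding G S_def T_def gjoin.simps V by simp
  moreover have "e = {x, rt T}" by (simp add: T_def xy)
  ultimately show thesis using that by blast
qed

declare is_rooted_tree.simps [simp del]

lemma tree_induct [consumes 1, case_names vertex join]:
  assumes "is_rooted_tree G"
    and vertex: "\<And>r. P ({r}, {}, r)"
    and join: "\<And>S v T. joinable S v T \<Longrightarrow> P S \<Longrightarrow> P T \<Longrightarrow> P (gjoin S v T)"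
  shows "P G"
  using assms(1)
proof (induction "card (verts G)" arbitrary: G rule: less_induct)
  case less
  show ?case
  proof (cases "edgs G = {}")
    case True
    obtain V r where G: "G = (V, {}, r)" using True by (cases G) simp
    have "V = {r}" using less.prems reachable_least[of r "{r}" "{}"]
      unfolding G is_rooted_tree_iff by auto
    then show ?thesis using vertex G by simp
  next
    case False
    then obtain e where "e \<in> edgs G" by blast
    then obtain S v T where st: "joinable S v T" "G = gjoin S v T"
      using tree_cut less.prems by metis
    have j: "is_rooted_tree S" "is_rooted_tree T" "verts S \<inter> verts T = {}"
      using st by (auto simp: joinable_def)
    have "card (verts G) = card (verts S) + card (verts T)"
      using j by (simp add: st card_Un_disjoint finite_verts)
    moreover have "card (verts S) > 0" "card (verts T) > 0"
      using j finite_verts rt_in_verts[OF j(1)] rt_in_verts[OF j(2)] by (auto simp: card_gt_0_iff)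
    ultimately show ?thesis using less.hyps[of S] less.hyps[of T] join st j by simp
  qed
qed

subsection \<open>Cuts of a literal tree\<close>

abbreviation (input) "R_cut \<equiv> root_part_raw"
abbreviation (input) "P_cut \<equiv> pruned_part_raw"

lemma joinable_facts:
  assumes "joinable S v T"
  shows "is_rooted_tree S" "is_rooted_tree T" "verts S \<inter> verts T = {}" "v \<in> verts S"
  using assms by (auto simp: joinable_def)

lemma edgs_disjoint:
  assumes "is_rooted_tree S" "is_rooted_tree T" "verts S \<inter> verts T = {}"
  shows "edgs S \<inter> edgs T = {}"
proof (rule ccontr)
  assume "edgs S \<inter> edgs T \<noteq> {}"
  then obtain e where e: "e \<in> edgs S" "e \<in> edgs T" by blast
  then have "e \<subseteq> verts S \<inter> verts T" using assms edge_subset_verts by blast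
  then have "e = {}" using assms by simp
  moreover obtain A v B where "e = {v, rt B}" by (rule tree_cut[OF assms(1) e(1)])
  ultimately show False by simp
qed

lemma cut_parts:
  assumes "is_rooted_tree G" "e \<in> edgs G"
  shows "is_rooted_tree (R_cut e G)" (is ?p1) "is_rooted_tree (P_cut e G)" (is ?p2)
    "verts (R_cut e G) \<inter> verts (P_cut e G) = {}" (is ?p3)
    "verts G = verts (R_cut e G) \<union> verts (P_cut e G)" (is ?p4)
    "edgs G = insert e (edgs (R_cut e G) \<union> edgs (P_cut e G))" (is ?p5)
    "e \<notin> edgs (R_cut e G)" (is ?p6) "e \<notin> edgs (P_cut e G)" (is ?p7)
    "edgs (R_cut e G) \<inter> edgs (P_cut e G) = {}" (is ?p8)
proof -
  obtain S v T where st: "joinable S v T" "e = {v, rt T}" "G = gjoin S v T"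
    using tree_cut assms by metis
  have eq: "R_cut e G = S" "P_cut e G = T"
    unfolding st(2,3) using cut_gjoin[OF st(1)] by auto
  show ?p1 ?p2 ?p3 ?p4 ?p5 ?p6 ?p7 ?p8
    unfolding eq using st new_edge_notin[OF st(1)] joinable_facts[OF st(1)] edgs_disjoint
    by auto
qed

text \<open>With \<open>T = gjoin A w B\<close>, both ways of bracketing the join of \<open>S\<close>, \<open>A\<close> and \<open>B\<close> are the same graph, so
  that \<open>cut_gjoin\<close> applies. The same idea gives \<open>cut_gjoin_left\<close>, where the result depends on which part
  of \<open>S\<close> carries the vertex of the join.\<close>

lemma cut_gjoin_right:
  assumes j: "joinable S v T" and e: "e \<in> edgs T"
  shows "R_cut e (gjoin S v T) = gjoin S v (R_cut e T) \<and> P_cut e (gjoin S v T) = P_cut e T"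
proof -
  obtain A w B where ab: "joinable A w B" "e = {w, rt B}" "T = gjoin A w B"
    using tree_cut[OF _ e] j by (metis joinable_def)
  have disj: "verts S \<inter> verts A = {}" "verts S \<inter> verts B = {}" using j ab by (auto simp: joinable_def)
  have sa: "joinable S v A" using j ab disj by (auto simp: joinable_def)
  have b: "joinable (gjoin S v A) w B"
    using j ab disj tree_gjoin[OF sa] by (auto simp: joinable_def)
  have "gjoin S v T = gjoin (gjoin S v A) w B"
    unfolding ab(3) by (cases S; cases A; cases B) auto
  then show ?thesis using cut_gjoin[OF b] cut_gjoin[OF ab(1)] ab(2,3) by simp
qed

lemma cut_gjoin_left:
  assumes j: "joinable S v T" and e: "e \<in> edgs S"
  shows "v \<in> verts (R_cut e S) \<Longrightarrow>
      R_cut e (gjoin S v T) = gjoin (R_cut e S) v T \<and> P_cut e (gjoin S v T) = P_cut e S"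
    and "v \<in> verts (P_cut e S) \<Longrightarrow>
      R_cut e (gjoin S v T) = R_cut e S \<and> P_cut e (gjoin S v T) = gjoin (P_cut e S) v T"
proof -
  obtain A w B where ab: "joinable A w B" "e = {w, rt B}" "S = gjoin A w B"
    using tree_cut[OF _ e] j by (metis joinable_def)
  have eq: "R_cut e S = A" "P_cut e S = B" using cut_gjoin[OF ab(1)] ab by auto
  have disj: "verts A \<inter> verts T = {}" "verts B \<inter> verts T = {}" using j ab by (auto simp: joinable_def)
  {
    assume v: "v \<in> verts (R_cut e S)"
    have "v \<in> verts A" using v eq by simp
    then have at: "joinable A v T" using disj ab j by (auto simp: joinable_def eq)
    have b: "joinable (gjoin A v T) w B"
      using j ab disj tree_gjoin[OF at] by (auto simp: joinable_def)
    have "gjoin S v T = gjoin (gjoin A v T) w B"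
      unfolding ab(3) by (cases T; cases A; cases B) auto
    then show "R_cut e (gjoin S v T) = gjoin (R_cut e S) v T \<and> P_cut e (gjoin S v T) = P_cut e S"
      using cut_gjoin[OF b] eq ab(2) by simp
  next
    assume v: "v \<in> verts (P_cut e S)"
    have "v \<in> verts B" using v eq by simp
    then have bt: "joinable B v T" using disj ab j by (auto simp: joinable_def eq)
    have b: "joinable A w (gjoin B v T)"
      using j ab disj tree_gjoin[OF bt] by (auto simp: joinable_def)
    have "gjoin S v T = gjoin A w (gjoin B v T)"
      unfolding ab(3) by (cases T; cases A; cases B) auto
    then show "R_cut e (gjoin S v T) = R_cut e S \<and> P_cut e (gjoin S v T) = gjoin (P_cut e S) v T"
      using cut_gjoin[OF b] eq ab(2) by simp
  }
qed

text \<open>The two cases: \<open>e\<close> and \<open>f\<close> do not lie on a common path from the root, and the cuts commute; or \<open>f\<close> lies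
  between the root and \<open>e\<close>, and cutting \<open>f\<close> first takes \<open>e\<close> away with the pruned part.\<close>

lemma cut_twice:
  assumes G: "is_rooted_tree G" and e: "e \<in> edgs G" and f: "f \<in> edgs (R_cut e G)"
  shows "e \<in> edgs (R_cut f G) \<and> R_cut f (R_cut e G) = R_cut e (R_cut f G)
        \<and> P_cut f (R_cut e G) = P_cut f G \<and> P_cut e (R_cut f G) = P_cut e G \<and> e \<notin> edgs (P_cut f G)
     \<or> e \<in> edgs (P_cut f G) \<and> R_cut f (R_cut e G) = R_cut f G
        \<and> P_cut f (R_cut e G) = R_cut e (P_cut f G) \<and> P_cut e (P_cut f G) = P_cut e G
        \<and> e \<notin> edgs (R_cut f G)"
proof -
  obtain A w B where ab: "joinable A w B" "e = {w, rt B}" "G = gjoin A w B"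
    using tree_cut[OF G e] by metis
  have eq: "R_cut e G = A" "P_cut e G = B" using cut_gjoin[OF ab(1)] ab by auto
  have fA: "f \<in> edgs A" using f eq by simp
  have A: "is_rooted_tree A" using ab(1) by (simp add: joinable_def)
  note c = cut_gjoin_left[OF ab(1) fA, folded ab(3)]
  note p = cut_parts[OF A fA]
  have fG: "f \<in> edgs G" using ab fA by simp
  note q = cut_parts(8)[OF G fG]
  consider "w \<in> verts (R_cut f A)" | "w \<in> verts (P_cut f A)"
    using ab(1) p by (auto simp: joinable_def)
  then show ?thesis
  proof cases
    case 1
    have j: "joinable (R_cut f A) w B" using 1 p ab(1) by (auto simp: joinable_def)
    have "e \<in> edgs (R_cut f G)" using c(1)[OF 1] ab(2) by simp
    then show ?thesis using c(1)[OF 1] cut_gjoin[OF j] eq ab(2) q by auto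
  next
    case 2
    have j: "joinable (P_cut f A) w B" using 2 p ab(1) by (auto simp: joinable_def)
    have "e \<in> edgs (P_cut f G)" using c(2)[OF 2] ab(2) by simp
    then show ?thesis using c(2)[OF 2] cut_gjoin[OF j] eq ab(2) q by auto
  qed
qed

lemma cut_below:
  assumes G: "is_rooted_tree G" and f: "f \<in> edgs G" and e: "e \<in> edgs (P_cut f G)"
  shows "e \<in> edgs G" "f \<in> edgs (R_cut e G)"
proof -
  obtain A w B where ab: "joinable A w B" "f = {w, rt B}" "G = gjoin A w B"
    using tree_cut[OF G f] by metis
  have eB: "e \<in> edgs B" using e cut_gjoin[OF ab(1)] ab by simp
  have B: "is_rooted_tree B" using ab(1) by (simp add: joinable_def)
  show "e \<in> edgs G" using eB ab by simp
  have "rt (R_cut e B) = rt B" by (cases B) (simp add: Let_def)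
  then show "f \<in> edgs (R_cut e G)" using cut_gjoin_right[OF ab(1) eB] ab by simp
qed

subsection \<open>Isomorphism classes\<close>

fun gmap :: "(nat \<Rightarrow> nat) \<Rightarrow> rgraph \<Rightarrow> rgraph" where
  "gmap f (V, E, r) = (f ` V, (`) f ` E, f r)"

lemma gmap_simps [simp]:
  "verts (gmap f G) = f ` verts G" "edgs (gmap f G) = (`) f ` edgs G" "rt (gmap f G) = f (rt G)"
  by (cases G, simp)+

lemma gmap_gjoin: "gmap f (gjoin S v T) = gjoin (gmap f S) (f v) (gmap f T)"
  by (cases S; cases T) (simp add: image_Un)

lemma gmap_gmap: "gmap f (gmap g G) = gmap (f \<circ> g) G"
  by (cases G) (auto simp: image_image image_comp)

lemma gmap_cong:
  assumes "is_rooted_tree G" "\<And>x. x \<in> verts G \<Longrightarrow> f x = g x"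
  shows "gmap f G = gmap g G"
proof -
  have e: "f ` e = g ` e" if "e \<in> edgs G" for e
    using edge_subset_verts[OF assms(1) that] assms(2) by (intro image_cong) auto
  have "(`) f ` edgs G = (`) g ` edgs G" by (rule image_cong[OF HOL.refl e])
  moreover have "f ` verts G = g ` verts G" by (intro image_cong) (auto simp: assms(2))
  ultimately show ?thesis using assms(2)[OF rt_in_verts[OF assms(1)]] by (cases G) auto
qed

lemma joinable_gmap:
  assumes "joinable S v T" "inj_on f (verts S \<union> verts T)"
    "is_rooted_tree (gmap f S)" "is_rooted_tree (gmap f T)"
  shows "joinable (gmap f S) (f v) (gmap f T)"
  using assms inj_on_image_Int[OF assms(2), of "verts S" "verts T"] by (auto simp: joinable_def)

lemma tree_gmap:
  assumes "is_rooted_tree G" "inj_on f (verts G)" shows "is_rooted_tree (gmap f G)"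
  using assms
proof (induction rule: tree_induct)
  case (vertex r)
  show ?case using reachable_least[of "f r" "{f r}" "{}"] reachable_refl[of "f r" "{}"]
    by (auto simp: is_rooted_tree_iff)
next
  case (join S v T)
  then show ?case unfolding gmap_gjoin
    by (intro tree_gjoin joinable_gmap) (auto intro: inj_on_subset)
qed

lemma cut_gmap:
  assumes G: "is_rooted_tree G" and f: "inj_on f (verts G)" and e: "e \<in> edgs G"
  shows "R_cut (f ` e) (gmap f G) = gmap f (R_cut e G)"
    "P_cut (f ` e) (gmap f G) = gmap f (P_cut e G)"
proof -
  obtain S v T where st: "joinable S v T" "e = {v, rt T}" "G = gjoin S v T"
    using tree_cut[OF G e] by metis
  have j: "joinable (gmap f S) (f v) (gmap f T)"
    using st f by (intro joinable_gmap tree_gmap) (auto simp: joinable_def intro: inj_on_subset)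
  show "R_cut (f ` e) (gmap f G) = gmap f (R_cut e G)"
    "P_cut (f ` e) (gmap f G) = gmap f (P_cut e G)"
    using cut_gjoin[OF j] cut_gjoin[OF st(1)] unfolding st(2,3) gmap_gjoin by auto
qed

abbreviation "cls \<equiv> abs_rtree"

lemma rgraph_iso_gmap: "rgraph_iso S T \<longleftrightarrow> (\<exists>f. inj_on f (verts S) \<and> T = gmap f S)"
  by (cases S; cases T) (auto simp: bij_betw_def)

lemma tree_rep: "is_rooted_tree (rep_rtree t)"
  using Quotient3_rep_reflp[OF Quotient3_rtree] by blast

lemma cls_rep: "cls (rep_rtree t) = t"
  using Quotient3_abs_rep[OF Quotient3_rtree] .

lemma cls_eq_iff:
  "is_rooted_tree S \<Longrightarrow> is_rooted_tree T \<Longrightarrow> cls S = cls T \<longleftrightarrow> rgraph_iso S T"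
  using Quotient3_rel[OF Quotient3_rtree, of S T] rgraph_iso_refl by blast

lemma cls_gmap: "is_rooted_tree G \<Longrightarrow> inj_on f (verts G) \<Longrightarrow> cls (gmap f G) = cls G"
  using cls_eq_iff[of G "gmap f G"] rgraph_iso_gmap[of G "gmap f G"] tree_gmap[of G f] by metis

lemma rep_cls:
  assumes "is_rooted_tree G"
  obtains f where "inj_on f (verts G)" "rep_rtree (cls G) = gmap f G"
  using cls_eq_iff[OF assms tree_rep[of "cls G"]] cls_rep[of "cls G"]
  by (auto simp: rgraph_iso_gmap)

lemma join_raw_eq: "join_raw S v T = gjoin (gmap (\<lambda>x. 2 * x) S) (2 * v) (gmap (\<lambda>x. 2 * x + 1) T)"
  by (cases S; cases T) simp

text \<open>Two injections with disjoint images combine to a single injection on the union.\<close>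

lemma cls_gjoin_gmap:
  assumes j: "joinable S v T" and f: "inj_on f (verts S)" and g: "inj_on g (verts T)"
    and disj: "f ` verts S \<inter> g ` verts T = {}"
  shows "cls (gjoin (gmap f S) (f v) (gmap g T)) = cls (gjoin S v T)"
proof -
  let ?h = "\<lambda>x. if x \<in> verts S then f x else g x"
  note js = joinable_facts[OF j]
  have T: "?h x = g x" if "x \<in> verts T" for x using that js(3) by auto
  have inj: "inj_on ?h (verts S \<union> verts T)"
  proof (rule inj_onI)
    fix x y assume xy: "x \<in> verts S \<union> verts T" "y \<in> verts S \<union> verts T" "?h x = ?h y"
    have "f a \<noteq> g b" if "a \<in> verts S" "b \<in> verts T" for a b using disj that by blast
    then have "x \<in> verts S \<longleftrightarrow> y \<in> verts S" using xy by (metis UnE)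
    then show "x = y" using xy inj_onD[OF f, of x y] inj_onD[OF g, of x y] by (cases "x \<in> verts S") auto
  qed
  have "gmap f S = gmap ?h S" "gmap g T = gmap ?h T" "f v = ?h v"
    using js T by (auto intro!: gmap_cong)
  then have "gjoin (gmap f S) (f v) (gmap g T) = gmap ?h (gjoin S v T)"
    by (simp only: gmap_gjoin)
  then show ?thesis using cls_gmap[OF tree_gjoin[OF j], of ?h] inj by simp
qed

lemma join_cls:
  assumes j: "joinable S v T" and f: "inj_on f (verts S)" "rep_rtree (cls S) = gmap f S"
  shows "join (cls S) (f v) (cls T) = cls (gjoin S v T)"
proof -
  obtain g where g: "inj_on g (verts T)" "rep_rtree (cls T) = gmap g T"
    using rep_cls joinable_facts(2)[OF j] by metis
  have "join (cls S) (f v) (cls T)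
      = cls (gjoin (gmap ((\<lambda>x. 2 * x) \<circ> f) S) (((\<lambda>x. 2 * x) \<circ> f) v) (gmap ((\<lambda>x. 2 * x + 1) \<circ> g) T))"
    unfolding join_def join_raw_eq f g gmap_gmap by simp
  also have "\<dots> = cls (gjoin S v T)"
  proof (rule cls_gjoin_gmap[OF j])
    show "inj_on ((\<lambda>x. 2 * x) \<circ> f) (verts S)" "inj_on ((\<lambda>x. 2 * x + 1) \<circ> g) (verts T)"
      using f(1) g(1) by (simp_all add: inj_on_def)
    show "((\<lambda>x. 2 * x) \<circ> f) ` verts S \<inter> ((\<lambda>x. 2 * x + 1) \<circ> g) ` verts T = {}"
      by (auto, presburger)
  qed
  finally show ?thesis .
qed

text \<open>Sums over the vertices or edges of an isomorphism class may be evaluated on any representative,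
  since isomorphisms permute the summands. This and \<open>sum_cut_cls\<close> reduce identities between classes to
  literal graphs.\<close>

lemma sum_join_cls:
  assumes S: "is_rooted_tree S" "is_rooted_tree T" "verts S \<inter> verts T = {}"
  shows "(\<Sum>v\<in>vertices (cls S). f (join (cls S) v (cls T))) = (\<Sum>v\<in>verts S. f (cls (gjoin S v T)))"
proof -
  obtain g where g: "inj_on g (verts S)" "rep_rtree (cls S) = gmap g S" using rep_cls S by metis
  have "vertices (cls S) = g ` verts S" by (simp add: vertices_def g)
  then have "(\<Sum>v\<in>vertices (cls S). f (join (cls S) v (cls T)))
      = (\<Sum>v\<in>verts S. f (join (cls S) (g v) (cls T)))"
    using g by (simp add: sum.reindex)
  also have "\<dots> = (\<Sum>v\<in>verts S. f (cls (gjoin S v T)))"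
  proof (rule sum.cong[OF HOL.refl])
    fix v assume "v \<in> verts S"
    then have "joinable S v T" using S by (simp add: joinable_def)
    then show "f (join (cls S) (g v) (cls T)) = f (cls (gjoin S v T))" using join_cls g by metis
  qed
  finally show ?thesis .
qed

lemma sum_cut_cls:
  assumes G: "is_rooted_tree G"
  shows "(\<Sum>e\<in>edges (cls G). h (root_part e (cls G)) (pruned_part e (cls G)))
    = (\<Sum>e\<in>edgs G. h (cls (R_cut e G)) (cls (P_cut e G)))"
proof -
  obtain g where g: "inj_on g (verts G)" "rep_rtree (cls G) = gmap g G" using rep_cls G by metis
  have "edgs G \<subseteq> Pow (verts G)" using edge_subset_verts[OF G] by blast
  then have inj: "inj_on ((`) g) (edgs G)" using g(1) inj_on_image_Pow inj_on_subset by blast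
  have "edges (cls G) = (`) g ` edgs G" by (simp add: edges_def g)
  then have "(\<Sum>e\<in>edges (cls G). h (root_part e (cls G)) (pruned_part e (cls G)))
      = (\<Sum>e\<in>edgs G. h (root_part (g ` e) (cls G)) (pruned_part (g ` e) (cls G)))"
    using inj by (simp add: sum.reindex)
  also have "\<dots> = (\<Sum>e\<in>edgs G. h (cls (R_cut e G)) (cls (P_cut e G)))"
  proof (rule sum.cong[OF HOL.refl])
    fix e assume e: "e \<in> edgs G"
    have sub: "inj_on g (verts (R_cut e G))" "inj_on g (verts (P_cut e G))"
      using cut_parts(4)[OF G e] g(1) by (auto intro: inj_on_subset)
    have "root_part (g ` e) (cls G) = cls (R_cut e G)"
      unfolding root_part_def g(2) cut_gmap(1)[OF G g(1) e]
      using cls_gmap cut_parts[OF G e] sub by blast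
    moreover have "pruned_part (g ` e) (cls G) = cls (P_cut e G)"
      unfolding pruned_part_def g(2) cut_gmap(2)[OF G g(1) e]
      using cls_gmap cut_parts[OF G e] sub by blast
    ultimately show "h (root_part (g ` e) (cls G)) (pruned_part (g ` e) (cls G))
      = h (cls (R_cut e G)) (cls (P_cut e G))" by simp
  qed
  finally show ?thesis .
qed

lemma obtain_disjoint_reps:
  obtains S T U where "is_rooted_tree S" "is_rooted_tree T" "is_rooted_tree U"
    "cls S = s" "cls T = t" "cls U = u"
    "verts S \<inter> verts T = {}" "verts S \<inter> verts U = {}" "verts T \<inter> verts U = {}"
proof
  let ?f = "\<lambda>i x :: nat. 3 * x + i"
  have inj: "inj_on (?f i) X" for i X by (auto intro: inj_onI)
  show "is_rooted_tree (gmap (?f 0) (rep_rtree s))" "is_rooted_tree (gmap (?f 1) (rep_rtree t))"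
    "is_rooted_tree (gmap (?f 2) (rep_rtree u))"
    by (rule tree_gmap[OF tree_rep inj])+
  show "cls (gmap (?f 0) (rep_rtree s)) = s" "cls (gmap (?f 1) (rep_rtree t)) = t"
    "cls (gmap (?f 2) (rep_rtree u)) = u"
    unfolding cls_gmap[OF tree_rep inj] by (rule cls_rep)+
qed (auto, presburger+)

lemma tsize_cls:
  assumes "is_rooted_tree G" shows "tsize (cls G) = card (verts G)"
proof -
  obtain g where "inj_on g (verts G)" "rep_rtree (cls G) = gmap g G" using rep_cls assms by metis
  then show ?thesis by (simp add: tsize_def vertices_def card_image)
qed

subsection \<open>Sums over joins and cuts\<close>

text \<open>Join \<open>t\<close> to \<open>s\<close> and then \<open>u\<close> to the result. The terms where \<open>u\<close> is attached to a vertex of \<open>s\<close> are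
  symmetric in \<open>t\<close> and \<open>u\<close> and cancel; there remain those where \<open>u\<close> is attached to \<open>t\<close>.\<close>

lemma sum_join_join:
  fixes f :: "rtree \<Rightarrow> 'a::ab_group_add"
  shows "(\<Sum>v\<in>vertices s. \<Sum>w\<in>vertices (join s v t). f (join (join s v t) w u))
       - (\<Sum>v\<in>vertices s. \<Sum>w\<in>vertices (join s v u). f (join (join s v u) w t))
     = (\<Sum>w\<in>vertices t. \<Sum>v\<in>vertices s. f (join s v (join t w u)))
       - (\<Sum>w\<in>vertices u. \<Sum>v\<in>vertices s. f (join s v (join u w t)))"
proof -
  obtain S T U where trees: "is_rooted_tree S" "is_rooted_tree T" "is_rooted_tree U"
    and eq: "cls S = s" "cls T = t" "cls U = u"
    and disj: "verts S \<inter> verts T = {}" "verts S \<inter> verts U = {}" "verts T \<inter> verts U = {}"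
    by (rule obtain_disjoint_reps)
  have double: "(\<Sum>v\<in>vertices (cls S). \<Sum>w\<in>vertices (join (cls S) v (cls T)). f (join (join (cls S) v (cls T)) w (cls U)))
      = (\<Sum>v\<in>verts S. \<Sum>w\<in>verts S. f (cls (gjoin (gjoin S v T) w U)))
      + (\<Sum>w\<in>vertices (cls T). \<Sum>v\<in>vertices (cls S). f (join (cls S) v (join (cls T) w (cls U))))" (is "?lhs = _")
    if trees: "is_rooted_tree S" "is_rooted_tree T" "is_rooted_tree U"
    and disj: "verts S \<inter> verts T = {}" "verts S \<inter> verts U = {}" "verts T \<inter> verts U = {}"
    for S T U
  proof -
    have "?lhs
      = (\<Sum>v\<in>verts S. \<Sum>w\<in>vertices (cls (gjoin S v T)). f (join (cls (gjoin S v T)) w (cls U)))"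
      by (rule sum_join_cls[OF trees(1,2) disj(1)])
    also have "\<dots> = (\<Sum>v\<in>verts S. \<Sum>w\<in>verts S \<union> verts T. f (cls (gjoin (gjoin S v T) w U)))"
    proof (rule sum.cong[OF HOL.refl])
      fix v assume "v \<in> verts S"
      then have "is_rooted_tree (gjoin S v T)" using trees disj by (intro tree_gjoin) (simp add: joinable_def)
      from sum_join_cls[OF this trees(3)] disj
      show "(\<Sum>w\<in>vertices (cls (gjoin S v T)). f (join (cls (gjoin S v T)) w (cls U)))
        = (\<Sum>w\<in>verts S \<union> verts T. f (cls (gjoin (gjoin S v T) w U)))" by (simp add: Int_Un_distrib2)
    qed
    also have "\<dots> = (\<Sum>v\<in>verts S. (\<Sum>w\<in>verts S. f (cls (gjoin (gjoin S v T) w U)))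
        + (\<Sum>w\<in>verts T. f (cls (gjoin (gjoin S v T) w U))))"
      using trees disj by (simp add: sum.union_disjoint finite_verts)
    also have "\<dots> = (\<Sum>v\<in>verts S. \<Sum>w\<in>verts S. f (cls (gjoin (gjoin S v T) w U)))
        + (\<Sum>w\<in>verts T. \<Sum>v\<in>verts S. f (cls (gjoin S v (gjoin T w U))))"
    proof -
      have "gjoin (gjoin S v T) w U = gjoin S v (gjoin T w U)" for v w
        by (cases S; cases T; cases U) auto
      then show ?thesis unfolding sum.distrib by (simp only: sum.swap[of _ "verts T"])
    qed
    also have "(\<Sum>w\<in>verts T. \<Sum>v\<in>verts S. f (cls (gjoin S v (gjoin T w U))))
      = (\<Sum>w\<in>verts T. \<Sum>v\<in>vertices (cls S). f (join (cls S) v (cls (gjoin T w U))))"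
    proof (rule sum.cong[OF HOL.refl])
      fix w assume "w \<in> verts T"
      then have "is_rooted_tree (gjoin T w U)" using trees disj by (intro tree_gjoin) (simp add: joinable_def)
      moreover have "verts S \<inter> verts (gjoin T w U) = {}" using disj by auto
      ultimately show "(\<Sum>v\<in>verts S. f (cls (gjoin S v (gjoin T w U))))
        = (\<Sum>v\<in>vertices (cls S). f (join (cls S) v (cls (gjoin T w U))))"
        by (rule sum_join_cls[OF trees(1), symmetric])
    qed
    also have "\<dots> = (\<Sum>w\<in>vertices (cls T). \<Sum>v\<in>vertices (cls S). f (join (cls S) v (join (cls T) w (cls U))))"
      by (rule sum_join_cls[OF trees(2,3) disj(3), symmetric])
    finally show ?thesis .
  qed
  have swap: "(\<Sum>v\<in>verts S. \<Sum>w\<in>verts S. f (cls (gjoin (gjoin S v T) w U)))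
      = (\<Sum>v\<in>verts S. \<Sum>w\<in>verts S. f (cls (gjoin (gjoin S v U) w T)))"
  proof -
    have "gjoin (gjoin S v T) w U = gjoin (gjoin S w U) v T" for v w
      by (cases S; cases T; cases U) auto
    then show ?thesis by (subst sum.swap) simp
  qed
  have "verts U \<inter> verts T = {}" using disj by auto
  then show ?thesis
    using double[OF trees disj] double[OF trees(1,3,2) disj(2,1)] swap unfolding eq by simp
qed

text \<open>The edges of the join are the new edge, the edges of \<open>t\<close>, and the edges of \<open>s\<close>. For the last
  kind there are two cases, as \<open>t\<close> sits on the root part or on the pruned part.\<close>

lemma sum_cut_join:
  fixes h :: "rtree \<Rightarrow> rtree \<Rightarrow> 'a::ab_group_add"
  shows "(\<Sum>v\<in>vertices s. \<Sum>e\<in>edges (join s v t). h (root_part e (join s v t)) (pruned_part e (join s v t)))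
     = (\<Sum>v\<in>vertices s. h s t)
     + (\<Sum>e\<in>edges t. \<Sum>v\<in>vertices s. h (join s v (root_part e t)) (pruned_part e t))
     + (\<Sum>e\<in>edges s. \<Sum>v\<in>vertices (root_part e s). h (join (root_part e s) v t) (pruned_part e s))
     + (\<Sum>e\<in>edges s. \<Sum>v\<in>vertices (pruned_part e s). h (root_part e s) (join (pruned_part e s) v t))"
proof -
  obtain S T U where trees: "is_rooted_tree S" "is_rooted_tree T"
    and eq: "cls S = s" "cls T = t" and disj: "verts S \<inter> verts T = {}"
    using obtain_disjoint_reps[of s t t] by metis
  have j: "joinable S v T" if "v \<in> verts S" for v using that trees disj by (simp add: joinable_def)
  have fin: "finite (edgs S)" "finite (edgs T)" "finite (verts S)"
    using trees finite_edgs finite_verts by auto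
  let ?h = "\<lambda>A B. h (cls A) (cls B)"
  let ?c = "\<lambda>v e. ?h (R_cut e (gjoin S v T)) (P_cut e (gjoin S v T))"
  let ?K = "\<lambda>c. \<Sum>e\<in>edges c. h (root_part e c) (pruned_part e c)"
  have "(\<Sum>v\<in>vertices (cls S). ?K (join (cls S) v (cls T))) = (\<Sum>v\<in>verts S. ?K (cls (gjoin S v T)))"
    by (rule sum_join_cls[OF trees disj])
  also have "\<dots> = (\<Sum>v\<in>verts S. ?h S T + (\<Sum>e\<in>edgs T. ?h (gjoin S v (R_cut e T)) (P_cut e T))
      + (\<Sum>e\<in>edgs S. ?c v e))"
  proof (rule sum.cong[OF HOL.refl])
    fix v assume v: "v \<in> verts S"
    let ?G = "gjoin S v T"
    have "?K (cls ?G) = (\<Sum>e\<in>edgs ?G. ?c v e)"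
      by (rule sum_cut_cls[OF tree_gjoin[OF j[OF v]]])
    also have "\<dots> = ?h S T + ((\<Sum>e\<in>edgs T. ?c v e)
        + (\<Sum>e\<in>edgs S. ?c v e))"
      using new_edge_notin[OF j[OF v]] edgs_disjoint[OF trees disj] cut_gjoin[OF j[OF v]] fin
      by (simp add: sum.union_disjoint add.commute)
    also have "(\<Sum>e\<in>edgs T. ?c v e) = (\<Sum>e\<in>edgs T. ?h (gjoin S v (R_cut e T)) (P_cut e T))"
      using cut_gjoin_right[OF j[OF v]] by (intro sum.cong) auto
    finally show "?K (cls ?G) = ?h S T + (\<Sum>e\<in>edgs T. ?h (gjoin S v (R_cut e T)) (P_cut e T))
      + (\<Sum>e\<in>edgs S. ?c v e)" by (simp add: add.assoc)
  qed
  also have "\<dots> = (\<Sum>v\<in>verts S. ?h S T)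
      + (\<Sum>e\<in>edgs T. \<Sum>v\<in>verts S. ?h (gjoin S v (R_cut e T)) (P_cut e T))
      + (\<Sum>e\<in>edgs S. \<Sum>v\<in>verts S. ?c v e)"
    unfolding sum.distrib by (simp only: sum.swap[of _ "verts S"])
  also have "(\<Sum>e\<in>edgs S. \<Sum>v\<in>verts S. ?c v e)
      = (\<Sum>e\<in>edgs S. (\<Sum>v\<in>vertices (cls (R_cut e S)). h (join (cls (R_cut e S)) v (cls T)) (cls (P_cut e S)))
        + (\<Sum>v\<in>vertices (cls (P_cut e S)). h (cls (R_cut e S)) (join (cls (P_cut e S)) v (cls T))))"
  proof (rule sum.cong[OF HOL.refl])
    fix e assume e: "e \<in> edgs S"
    note c = cut_parts[OF trees(1) e]
    have d: "verts (R_cut e S) \<inter> verts T = {}" "verts (P_cut e S) \<inter> verts T = {}" using c(4) disj by auto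
    have "(\<Sum>v\<in>verts S. ?c v e)
      = (\<Sum>v\<in>verts (R_cut e S). ?c v e)
      + (\<Sum>v\<in>verts (P_cut e S). ?c v e)"
      unfolding c(4) using c(1-3) by (intro sum.union_disjoint finite_verts) 
    also have "(\<Sum>v\<in>verts (R_cut e S). ?c v e)
       = (\<Sum>v\<in>verts (R_cut e S). ?h (gjoin (R_cut e S) v T) (P_cut e S))"
    proof (rule sum.cong[OF HOL.refl])
      fix v assume v: "v \<in> verts (R_cut e S)"
      then have "joinable S v T" using j c(4) by blast
      from cut_gjoin_left(1)[OF this e v]
      show "?c v e = ?h (gjoin (R_cut e S) v T) (P_cut e S)" by simp
    qed
    also have "\<dots> = (\<Sum>v\<in>vertices (cls (R_cut e S)). h (join (cls (R_cut e S)) v (cls T)) (cls (P_cut e S)))"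
      by (rule sum_join_cls[OF c(1) trees(2) d(1), symmetric])
    also have "(\<Sum>v\<in>verts (P_cut e S). ?c v e)
       = (\<Sum>v\<in>verts (P_cut e S). ?h (R_cut e S) (gjoin (P_cut e S) v T))"
    proof (rule sum.cong[OF HOL.refl])
      fix v assume v: "v \<in> verts (P_cut e S)"
      then have "joinable S v T" using j c(4) by blast
      from cut_gjoin_left(2)[OF this e v]
      show "?c v e = ?h (R_cut e S) (gjoin (P_cut e S) v T)" by simp
    qed
    also have "\<dots> = (\<Sum>v\<in>vertices (cls (P_cut e S)). h (cls (R_cut e S)) (join (cls (P_cut e S)) v (cls T)))"
      by (rule sum_join_cls[OF c(2) trees(2) d(2), symmetric])
    finally show "(\<Sum>v\<in>verts S. ?c v e)
      = (\<Sum>v\<in>vertices (cls (R_cut e S)). h (join (cls (R_cut e S)) v (cls T)) (cls (P_cut e S)))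
        + (\<Sum>v\<in>vertices (cls (P_cut e S)). h (cls (R_cut e S)) (join (cls (P_cut e S)) v (cls T)))" .
  qed
  also have "\<dots> = (\<Sum>e\<in>edges (cls S). (\<Sum>v\<in>vertices (root_part e (cls S)). h (join (root_part e (cls S)) v (cls T)) (pruned_part e (cls S)))
        + (\<Sum>v\<in>vertices (pruned_part e (cls S)). h (root_part e (cls S)) (join (pruned_part e (cls S)) v (cls T))))"
    by (rule sum_cut_cls[OF trees(1), symmetric])
  also have "(\<Sum>e\<in>edgs T. \<Sum>v\<in>verts S. ?h (gjoin S v (R_cut e T)) (P_cut e T))
     = (\<Sum>e\<in>edgs T. \<Sum>v\<in>vertices (cls S). h (join (cls S) v (cls (R_cut e T))) (cls (P_cut e T)))"
  proof (rule sum.cong[OF HOL.refl])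
    fix e assume e: "e \<in> edgs T"
    have "verts S \<inter> verts (R_cut e T) = {}" using cut_parts(4)[OF trees(2) e] disj by auto
    then show "(\<Sum>v\<in>verts S. ?h (gjoin S v (R_cut e T)) (P_cut e T))
     = (\<Sum>v\<in>vertices (cls S). h (join (cls S) v (cls (R_cut e T))) (cls (P_cut e T)))"
      by (rule sum_join_cls[OF trees(1) cut_parts(1)[OF trees(2) e], symmetric])
  qed
  also have "\<dots> = (\<Sum>e\<in>edges (cls T). \<Sum>v\<in>vertices (cls S). h (join (cls S) v (root_part e (cls T))) (pruned_part e (cls T)))"
    by (rule sum_cut_cls[OF trees(2), symmetric])
  also have "(\<Sum>v\<in>verts S. ?h S T) = (\<Sum>v\<in>vertices (cls S). h (cls S) (cls T))"
    by (rule sum_join_cls[OF trees disj, symmetric])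
  finally show ?thesis unfolding eq sum.distrib by (simp add: add.assoc)
qed

text \<open>Of the pairs of successive cuts, those at incomparable edges (the set \<open>I\<close>) are symmetric under
  exchange and cancel. The others (the set \<open>N\<close>) cut first \<open>e\<close> and then an edge \<open>f\<close> nearer to the root,
  which amounts to cutting \<open>f\<close> and then dividing the pruned part at \<open>e\<close>.\<close>

lemma sum_cut_cut:
  fixes k :: "rtree \<Rightarrow> rtree \<Rightarrow> rtree \<Rightarrow> 'a::ab_group_add"
  shows "(\<Sum>e\<in>edges s. \<Sum>f\<in>edges (root_part e s). k (root_part f (root_part e s)) (pruned_part e s) (pruned_part f (root_part e s)))
       - (\<Sum>e\<in>edges s. \<Sum>f\<in>edges (root_part e s). k (root_part f (root_part e s)) (pruned_part f (root_part e s)) (pruned_part e s))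
     = (\<Sum>f\<in>edges s. \<Sum>e\<in>edges (pruned_part f s). k (root_part f s) (pruned_part e (pruned_part f s)) (root_part e (pruned_part f s)))
       - (\<Sum>f\<in>edges s. \<Sum>e\<in>edges (pruned_part f s). k (root_part f s) (root_part e (pruned_part f s)) (pruned_part e (pruned_part f s)))"
proof -
  define G where "G = rep_rtree s"
  have G: "is_rooted_tree G" and s: "cls G = s" by (simp_all add: G_def tree_rep cls_rep)
  define I where "I = {(e, f). e \<in> edgs G \<and> f \<in> edgs G \<and> f \<in> edgs (R_cut e G) \<and> e \<in> edgs (R_cut f G)}"
  define N where "N = {(e, f). f \<in> edgs G \<and> e \<in> edgs (P_cut f G)}"
  have finG: "finite (edgs G)" by (rule finite_edgs[OF G])
  have finR: "finite (edgs (R_cut e G))" "finite (edgs (P_cut e G))" if "e \<in> edgs G" for e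
    using cut_parts(1,2)[OF G that] finite_edgs by auto
  have sub: "f \<in> edgs G" if "e \<in> edgs G" "f \<in> edgs (R_cut e G) \<or> f \<in> edgs (P_cut e G)" for e f
    using cut_parts(5)[OF G that(1)] that(2) by auto
  have "I \<subseteq> edgs G \<times> edgs G" "N \<subseteq> edgs G \<times> edgs G" using sub by (auto simp: I_def N_def)
  then have finIN: "finite I" "finite N" using finG by (auto intro: finite_subset)
  have SN: "Sigma (edgs G) (\<lambda>e. edgs (R_cut e G)) = I \<union> N"
  proof -
    have "(e, f) \<in> I \<union> N" if "e \<in> edgs G" "f \<in> edgs (R_cut e G)" for e f
      using cut_twice[OF G that] sub[OF that(1)] that by (auto simp: I_def N_def)
    moreover have "e \<in> edgs G \<and> f \<in> edgs (R_cut e G)" if "(e, f) \<in> I \<union> N" for e f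
      using that cut_below[OF G] by (auto simp: I_def N_def)
    ultimately show ?thesis by auto
  qed
  have dis: "I \<inter> N = {}" using cut_parts(8)[OF G] by (auto simp: I_def N_def)
  have main: "(\<Sum>e\<in>edges s. \<Sum>f\<in>edges (root_part e s). k (root_part f (root_part e s)) (pruned_part e s) (pruned_part f (root_part e s)))
     = (\<Sum>(e, f)\<in>I. k (cls (R_cut f (R_cut e G))) (cls (P_cut e G)) (cls (P_cut f G)))
     + (\<Sum>f\<in>edges s. \<Sum>e\<in>edges (pruned_part f s). k (root_part f s) (pruned_part e (pruned_part f s)) (root_part e (pruned_part f s)))"
    for k :: "rtree \<Rightarrow> rtree \<Rightarrow> rtree \<Rightarrow> 'a"
  proof -
    let ?k = "\<lambda>A B C. k (cls A) (cls B) (cls C)"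
    have "(\<Sum>e\<in>edges (cls G). \<Sum>f\<in>edges (root_part e (cls G)).
          k (root_part f (root_part e (cls G))) (pruned_part e (cls G)) (pruned_part f (root_part e (cls G))))
      = (\<Sum>e\<in>edgs G. \<Sum>f\<in>edges (cls (R_cut e G)). k (root_part f (cls (R_cut e G))) (cls (P_cut e G)) (pruned_part f (cls (R_cut e G))))"
      by (rule sum_cut_cls[OF G])
    also have "\<dots> = (\<Sum>e\<in>edgs G. \<Sum>f\<in>edgs (R_cut e G). ?k (R_cut f (R_cut e G)) (P_cut e G) (P_cut f (R_cut e G)))"
    proof (rule sum.cong[OF HOL.refl])
      fix e assume e: "e \<in> edgs G"
      show "(\<Sum>f\<in>edges (cls (R_cut e G)). k (root_part f (cls (R_cut e G))) (cls (P_cut e G)) (pruned_part f (cls (R_cut e G))))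
        = (\<Sum>f\<in>edgs (R_cut e G). ?k (R_cut f (R_cut e G)) (P_cut e G) (P_cut f (R_cut e G)))"
        by (rule sum_cut_cls[OF cut_parts(1)[OF G e]])
    qed
    also have "\<dots> = (\<Sum>(e, f)\<in>I \<union> N. ?k (R_cut f (R_cut e G)) (P_cut e G) (P_cut f (R_cut e G)))"
      using finG finR unfolding SN[symmetric] by (subst sum.Sigma) auto
    also have "\<dots> = (\<Sum>(e, f)\<in>I. ?k (R_cut f (R_cut e G)) (P_cut e G) (P_cut f (R_cut e G)))
      + (\<Sum>(e, f)\<in>N. ?k (R_cut f (R_cut e G)) (P_cut e G) (P_cut f (R_cut e G)))"
      by (rule sum.union_disjoint[OF finIN dis])
    also have "(\<Sum>(e, f)\<in>I. ?k (R_cut f (R_cut e G)) (P_cut e G) (P_cut f (R_cut e G)))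
       = (\<Sum>(e, f)\<in>I. ?k (R_cut f (R_cut e G)) (P_cut e G) (P_cut f G))"
    proof (rule sum.cong[OF HOL.refl], clarify)
      fix e f assume "(e, f) \<in> I"
      then show "?k (R_cut f (R_cut e G)) (P_cut e G) (P_cut f (R_cut e G))
        = ?k (R_cut f (R_cut e G)) (P_cut e G) (P_cut f G)"
        using cut_twice[OF G, of e f] by (auto simp: I_def)
    qed
    also have "(\<Sum>(e, f)\<in>N. ?k (R_cut f (R_cut e G)) (P_cut e G) (P_cut f (R_cut e G)))
       = (\<Sum>(e, f)\<in>N. ?k (R_cut f G) (P_cut e (P_cut f G)) (R_cut e (P_cut f G)))"
    proof (rule sum.cong[OF HOL.refl], clarify)
      fix e f assume "(e, f) \<in> N"
      then show "?k (R_cut f (R_cut e G)) (P_cut e G) (P_cut f (R_cut e G))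
        = ?k (R_cut f G) (P_cut e (P_cut f G)) (R_cut e (P_cut f G))"
        using cut_twice[OF G, of e f] cut_below[OF G, of f e] by (auto simp: N_def)
    qed
    also have "\<dots> = (\<Sum>(f, e)\<in>Sigma (edgs G) (\<lambda>f. edgs (P_cut f G)).
         ?k (R_cut f G) (P_cut e (P_cut f G)) (R_cut e (P_cut f G)))"
      by (rule sum.reindex_bij_witness[of _ "\<lambda>(f, e). (e, f)" "\<lambda>(e, f). (f, e)"]) (auto simp: N_def)
    also have "\<dots> = (\<Sum>f\<in>edgs G. \<Sum>e\<in>edgs (P_cut f G).
         ?k (R_cut f G) (P_cut e (P_cut f G)) (R_cut e (P_cut f G)))"
      using finG finR by (subst sum.Sigma) auto
    also have "\<dots> = (\<Sum>f\<in>edgs G. \<Sum>e\<in>edges (cls (P_cut f G)).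
         k (cls (R_cut f G)) (pruned_part e (cls (P_cut f G))) (root_part e (cls (P_cut f G))))"
    proof (rule sum.cong[OF HOL.refl])
      fix f assume f: "f \<in> edgs G"
      show "(\<Sum>e\<in>edgs (P_cut f G). ?k (R_cut f G) (P_cut e (P_cut f G)) (R_cut e (P_cut f G)))
        = (\<Sum>e\<in>edges (cls (P_cut f G)). k (cls (R_cut f G)) (pruned_part e (cls (P_cut f G))) (root_part e (cls (P_cut f G))))"
        by (rule sum_cut_cls[OF cut_parts(2)[OF G f], symmetric])
    qed
    also have "\<dots> = (\<Sum>f\<in>edges (cls G). \<Sum>e\<in>edges (pruned_part f (cls G)).
         k (root_part f (cls G)) (pruned_part e (pruned_part f (cls G))) (root_part e (pruned_part f (cls G))))"
      by (rule sum_cut_cls[OF G, symmetric])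
    finally show ?thesis unfolding s .
  qed
  have swap: "(\<Sum>(e, f)\<in>I. k (cls (R_cut f (R_cut e G))) (cls (P_cut f G)) (cls (P_cut e G)))
     = (\<Sum>(e, f)\<in>I. k (cls (R_cut f (R_cut e G))) (cls (P_cut e G)) (cls (P_cut f G)))"
  proof (rule sum.reindex_bij_witness[of _ "\<lambda>(e, f). (f, e)" "\<lambda>(e, f). (f, e)"]; clarsimp)
    fix e f assume ef: "(e, f) \<in> I"
    then show "(f, e) \<in> I" by (simp add: I_def)
    show "k (cls (R_cut e (R_cut f G))) (cls (P_cut f G)) (cls (P_cut e G))
       = k (cls (R_cut f (R_cut e G))) (cls (P_cut f G)) (cls (P_cut e G))"
      using ef cut_twice[OF G, of e f] by (auto simp: I_def)
  qed (simp add: I_def)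
  show ?thesis
    using main[of k] main[of "\<lambda>a b c. k a c b"] swap by simp
qed

subsection \<open>Sizes\<close>

lemma tsize_pos: "tsize t > 0"
  using finite_verts[OF tree_rep, of t] rt_in_verts[OF tree_rep, of t]
  unfolding tsize_def vertices_def by (auto simp: card_gt_0_iff)

lemma finite_vertices: "finite (vertices t)"
  by (simp add: vertices_def finite_verts tree_rep)

lemma finite_edges: "finite (edges t)"
  by (simp add: edges_def finite_edgs tree_rep)

lemma tsize_cut:
  assumes "e \<in> edges t" shows "tsize (root_part e t) + tsize (pruned_part e t) = tsize t"
proof -
  have e: "e \<in> edgs (rep_rtree t)" using assms by (simp add: edges_def)
  note c = cut_parts[OF tree_rep e]
  show ?thesis unfolding root_part_def pruned_part_def tsize_cls[OF c(1)] tsize_cls[OF c(2)]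
    using c(1-4) by (simp add: tsize_def vertices_def card_Un_disjoint finite_verts)
qed

lemma tsize_join:
  assumes "v \<in> vertices s" shows "tsize (join s v t) = tsize s + tsize t"
proof -
  obtain S T U where trees: "is_rooted_tree S" "is_rooted_tree T"
    and eq: "cls S = s" "cls T = t" and disj: "verts S \<inter> verts T = {}"
    using obtain_disjoint_reps[of s t t] by metis
  obtain g where g: "inj_on g (verts S)" "rep_rtree (cls S) = gmap g S" using rep_cls trees by metis
  obtain w where w: "w \<in> verts S" "v = g w" using assms g eq by (auto simp: vertices_def)
  have j: "joinable S w T" using trees disj w by (simp add: joinable_def)
  have "join s v t = cls (gjoin S w T)" using join_cls[OF j g] eq w by simp
  then show ?thesis using tsize_cls[OF tree_gjoin[OF j]] trees disj eq
    by (simp add: card_Un_disjoint finite_verts tsize_cls[symmetric])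
qed

lemma cuts_tsize: "cuts s u t \<noteq> 0 \<Longrightarrow> tsize t = tsize s + tsize u"
proof -
  assume "cuts s u t \<noteq> 0"
  then have "{e \<in> edges t. root_part e t = s \<and> pruned_part e t = u} \<noteq> {}" unfolding cuts_def by force
  then show ?thesis using tsize_cut by force
qed

lemma joins_tsize: "joins s u t \<noteq> 0 \<Longrightarrow> tsize t = tsize s + tsize u"
proof -
  assume "joins s u t \<noteq> 0"
  then have "{v \<in> vertices s. join s v u = t} \<noteq> {}" unfolding joins_def by force
  then show ?thesis using tsize_join by force
qed

lemma finite_tsize: "finite {t. tsize t = n}"
proof (rule finite_subset)
  let ?X = "Pow {..<n} \<times> Pow (Pow {..<n}) \<times> {..<n}"
  show "{t. tsize t = n} \<subseteq> cls ` ?X"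
  proof
    fix t assume "t \<in> {t. tsize t = n}"
    then have n: "card (verts (rep_rtree t)) = n" by (simp add: tsize_def vertices_def)
    obtain f where f: "bij_betw f (verts (rep_rtree t)) {0..<n}"
      using ex_bij_betw_finite_nat finite_verts[OF tree_rep] n by metis
    have inj: "inj_on f (verts (rep_rtree t))" using f by (simp add: bij_betw_def)
    define G where "G = gmap f (rep_rtree t)"
    have G: "is_rooted_tree G" unfolding G_def by (rule tree_gmap[OF tree_rep inj])
    have "verts G = {..<n}" using f by (auto simp: G_def bij_betw_def)
    moreover have "edgs G \<subseteq> Pow (verts G)" using edge_subset_verts[OF G] by blast
    ultimately have "G \<in> ?X" using rt_in_verts[OF G] by (cases G) auto
    moreover have "cls G = t" unfolding G_def cls_gmap[OF tree_rep inj] by (rule cls_rep)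
    ultimately show "t \<in> cls ` ?X" by blast
  qed
qed auto

definition bullet :: rtree where "bullet = cls ({0}, {}, 0)"

lemma bullet_facts: "edges bullet = {}" "tsize bullet = 1"
proof -
  have G: "is_rooted_tree ({0}, {}, 0)"
    using reachable_least[of 0 "{0}" "{}"] reachable_refl[of 0 "{}"] acyclic_iff_bridges[of "{}"]
    by (auto simp: is_rooted_tree_iff)
  show "tsize bullet = 1" using tsize_cls[OF G] by (simp add: bullet_def)
  obtain f where "rep_rtree (cls ({0}, {}, 0)) = gmap f ({0}, {}, 0)" by (rule rep_cls[OF G])
  then show "edges bullet = {}" unfolding edges_def bullet_def by simp
qed

section \<open>A representation with a lowest weight vector of arbitrary weight\<close>

text \<open>The group algebra of the group of finitely supported exponents \<open>rtree \<rightarrow> \<complex>\<close>: polynomials in variables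
  \<open>x\<^sub>t\<close> whose monomials may have arbitrary complex exponents.\<close>

type_synonym fock = "(rtree \<Rightarrow>\<^sub>0 complex) \<Rightarrow>\<^sub>0 complex"

lemma poly_mapping_induct_single [case_names zero single add]:
  fixes f :: "'k \<Rightarrow>\<^sub>0 'b::comm_monoid_add"
  assumes "P 0" "\<And>k c. P (Poly_Mapping.single k c)" "\<And>f g. P f \<Longrightarrow> P g \<Longrightarrow> P (f + g)"
  shows "P f"
proof (induction f rule: update_induct)
  case (update f a b)
  have "Poly_Mapping.update a b f = f + Poly_Mapping.single a b"
    using update(1) by (intro poly_mapping_eqI) (auto simp: lookup_update lookup_add lookup_single when_def in_keys_iff)
  then show ?case using assms update by simp
qed (rule assms(1))

definition scalar :: "complex \<Rightarrow> fock" where "scalar c = Poly_Mapping.single 0 c"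

definition monomial :: "(rtree \<Rightarrow>\<^sub>0 complex) \<Rightarrow> fock" where "monomial a = Poly_Mapping.single a 1"

definition tvar :: "rtree \<Rightarrow> fock" where "tvar t = monomial (Poly_Mapping.single t 1)"

definition tvar_inv :: "rtree \<Rightarrow> fock" where "tvar_inv t = monomial (Poly_Mapping.single t (- 1))"

lemma scalar_simps [simp]: "scalar 0 = 0" "scalar 1 = 1"
  by (simp_all add: scalar_def)

lemma scalar_add: "scalar (a + b) = scalar a + scalar b"
  by (simp add: scalar_def single_add)

lemma scalar_mult: "scalar (a * b) = scalar a * scalar b"
  by (simp add: scalar_def mult_single)

lemma scalar_uminus: "scalar (- a) = - scalar a"
  by (simp add: scalar_def single_uminus)

lemma scalar_of_nat: "scalar (of_nat n) = of_nat n"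
  by (induction n) (simp_all add: scalar_add)

lemma single_eq: "Poly_Mapping.single a c = scalar c * monomial a"
  by (simp add: scalar_def monomial_def mult_single)

lemma monomial_add: "monomial (a + b) = monomial a * monomial b"
  by (simp add: monomial_def mult_single)

lemma tvar_tvar_inv: "tvar t * tvar_inv t = 1"
  by (simp add: tvar_def tvar_inv_def monomial_add[symmetric] single_add[symmetric])
    (simp add: monomial_def)

lemma fock_induct [case_names zero monomial add]:
  assumes "P 0" "\<And>c a. P (scalar c * monomial a)" "\<And>f g. P f \<Longrightarrow> P g \<Longrightarrow> P (f + g)"
  shows "P (f :: fock)"
  by (induction f rule: poly_mapping_induct_single) (use assms single_eq in auto)

subsection \<open>Linear extension\<close>

definition lin_ext :: "('k \<Rightarrow> fock) \<Rightarrow> ('k \<Rightarrow>\<^sub>0 complex) \<Rightarrow> fock" where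
  "lin_ext \<phi> f = (\<Sum>k\<in>Poly_Mapping.keys f. scalar (Poly_Mapping.lookup f k) * \<phi> k)"

lemma lin_ext_superset:
  assumes "finite K" "Poly_Mapping.keys f \<subseteq> K"
  shows "lin_ext \<phi> f = (\<Sum>k\<in>K. scalar (Poly_Mapping.lookup f k) * \<phi> k)"
  unfolding lin_ext_def by (rule sum.mono_neutral_left) (use assms in \<open>auto simp: in_keys_iff\<close>)

lemma lin_ext_add: "lin_ext \<phi> (f + g) = lin_ext \<phi> f + lin_ext \<phi> g"
proof -
  let ?K = "Poly_Mapping.keys f \<union> Poly_Mapping.keys g"
  have "lin_ext \<phi> (f + g) = (\<Sum>k\<in>?K. scalar (Poly_Mapping.lookup (f + g) k) * \<phi> k)"
    using keys_add[of f g] by (intro lin_ext_superset) auto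
  also have "\<dots> = lin_ext \<phi> f + lin_ext \<phi> g"
    by (simp add: lin_ext_superset[of ?K] lookup_add scalar_add distrib_right sum.distrib)
  finally show ?thesis .
qed

lemma lin_ext_zero [simp]: "lin_ext \<phi> 0 = 0" by (simp add: lin_ext_def)

lemma lin_ext_single: "lin_ext \<phi> (Poly_Mapping.single k c) = scalar c * \<phi> k"
  by (simp add: lin_ext_def)

lemma lin_ext_fun_add: "lin_ext (\<lambda>k. \<phi> k + \<psi> k) f = lin_ext \<phi> f + lin_ext \<psi> f"
  by (simp add: lin_ext_def sum.distrib distrib_left)

lemma lin_ext_fun_diff: "lin_ext (\<lambda>k. \<phi> k - \<psi> k) f = lin_ext \<phi> f - lin_ext \<psi> f"
  by (simp add: lin_ext_def sum_subtractf right_diff_distrib)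

lemma lin_ext_fun_mult: "lin_ext (\<lambda>k. c * \<phi> k) f = c * lin_ext \<phi> f"
  by (simp add: lin_ext_def sum_distrib_left mult.left_commute)

subsection \<open>Derivations given by their values on the variables\<close>

text \<open>\<open>D x\<^sup>a = x\<^sup>a \<Sum>\<^sub>t a\<^sub>t x\<^sub>t\<^sup>-\<^sup>1 D x\<^sub>t\<close>: logarithmic differentiation makes sense for complex exponents, and the
  sum is linear in the exponent \<open>a\<close>.\<close>

definition derivation :: "(rtree \<Rightarrow> fock) \<Rightarrow> fock \<Rightarrow> fock" where
  "derivation E = lin_ext (\<lambda>a. monomial a * lin_ext (\<lambda>t. tvar_inv t * E t) a)"

lemma derivation_add: "derivation E (f + g) = derivation E f + derivation E g"
  by (simp add: derivation_def lin_ext_add)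

lemma derivation_zero [simp]: "derivation E 0 = 0" by (simp add: derivation_def)

lemma derivation_const_monomial:
  "derivation E (scalar c * monomial a) = scalar c * (monomial a * lin_ext (\<lambda>t. tvar_inv t * E t) a)"
  unfolding single_eq[symmetric] derivation_def by (simp add: lin_ext_single)

lemma derivation_monomial: "derivation E (monomial a) = monomial a * lin_ext (\<lambda>t. tvar_inv t * E t) a"
  using derivation_const_monomial[of E 1 a] by simp

lemma derivation_const: "derivation E (scalar c * f) = scalar c * derivation E f"
proof (induction f rule: fock_induct)
  case (monomial b a)
  have "scalar c * (scalar b * monomial a) = scalar (c * b) * monomial a" by (simp add: scalar_mult mult.assoc)
  then show ?case by (simp only: derivation_const_monomial) (simp add: scalar_mult mult.assoc)
qed (simp_all add: derivation_add distrib_left)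

lemma derivation_of_nat: "derivation E (of_nat n * f) = of_nat n * derivation E f"
  using derivation_const[of E "of_nat n" f] by (simp add: scalar_of_nat)

lemma derivation_mult: "derivation E (f * g) = derivation E f * g + f * derivation E g"
proof (induction f rule: fock_induct)
  case (monomial c a)
  have "derivation E (monomial a * g) = derivation E (monomial a) * g + monomial a * derivation E g"
  proof (induction g rule: fock_induct)
    case (monomial d b)
    have eq: "monomial a * (scalar d * monomial b) = scalar d * monomial (a + b)"
      by (simp add: monomial_add mult.left_commute)
    show ?case unfolding eq derivation_const derivation_monomial lin_ext_add unfolding monomial_add
      by (simp add: algebra_simps)
  qed (simp_all add: derivation_add algebra_simps)
  then show ?case by (simp add: mult.assoc derivation_const distrib_left)
qed (simp_all add: derivation_add algebra_simps)

lemma derivation_sum: "derivation E (\<Sum>i\<in>I. f i) = (\<Sum>i\<in>I. derivation E (f i))"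
  by (induction I rule: infinite_finite_induct) (simp_all add: derivation_add)

lemma derivation_tvar: "derivation E (tvar t) = E t"
proof -
  have "derivation E (tvar t) = (tvar t * tvar_inv t) * E t"
    unfolding tvar_def derivation_monomial lin_ext_single by (simp add: mult.assoc)
  then show ?thesis by (simp add: tvar_tvar_inv)
qed

lemma derivation_tvar_inv: "derivation E (tvar_inv t) = - (tvar_inv t * tvar_inv t * E t)"
  unfolding tvar_inv_def derivation_monomial lin_ext_single scalar_uminus by (simp add: mult.assoc)

lemma derivation_lin: "derivation E (lin_ext \<phi> f) = lin_ext (\<lambda>k. derivation E (\<phi> k)) f"
  by (simp add: lin_ext_def derivation_sum derivation_const)

lemma derivation_fun_add: "derivation (\<lambda>t. E t + F t) f = derivation E f + derivation F f"
  unfolding derivation_def by (simp add: distrib_left lin_ext_fun_add)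

lemma derivation_fun_diff: "derivation (\<lambda>t. E t - F t) f = derivation E f - derivation F f"
  unfolding derivation_def by (simp add: right_diff_distrib lin_ext_fun_diff)

lemma derivation_fun_const: "derivation (\<lambda>t. scalar c * E t) f = scalar c * derivation E f"
  unfolding derivation_def by (simp add: mult.left_commute[of _ "scalar c"] lin_ext_fun_mult)

lemma derivation_fun_zero: "derivation (\<lambda>t. 0) f = 0"
  unfolding derivation_def by (simp add: lin_ext_def)

lemma derivation_fun_sum: "derivation (\<lambda>t. \<Sum>i\<in>I. E i t) f = (\<Sum>i\<in>I. derivation (E i) f)"
  by (induction I rule: infinite_finite_induct) (simp_all add: derivation_fun_add derivation_fun_zero)

text \<open>A commutator of derivations is again determined by its values on the variables. For complex exponents
  this does not follow from the product rule alone; it holds since the terms quadratic in the logarithmic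
  derivatives cancel, leaving an expression of the same logarithmic form.\<close>

lemma derivation_commutator:
  "derivation E (derivation F f) - derivation F (derivation E f) = derivation (\<lambda>t. derivation E (F t) - derivation F (E t)) f"
proof (induction f rule: fock_induct)
  case (monomial c a)
  have log: "derivation E (tvar_inv t * F t) = tvar_inv t * derivation E (F t) - tvar_inv t * E t * (tvar_inv t * F t)"
    for E F t by (simp add: derivation_mult derivation_tvar_inv algebra_simps)
  have two: "derivation E (derivation F (monomial a)) = monomial a * (lin_ext (\<lambda>t. tvar_inv t * E t) a * lin_ext (\<lambda>t. tvar_inv t * F t) a)
     + monomial a * lin_ext (\<lambda>t. tvar_inv t * derivation E (F t)) a
     - monomial a * lin_ext (\<lambda>t. tvar_inv t * E t * (tvar_inv t * F t)) a" for E F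
    unfolding derivation_monomial derivation_mult[of E "monomial a"] derivation_lin log lin_ext_fun_diff
    by (simp add: algebra_simps)
  have comm: "(\<lambda>t. tvar_inv t * F t * (tvar_inv t * E t)) = (\<lambda>t. tvar_inv t * E t * (tvar_inv t * F t))"
    by (simp add: mult.commute)
  have "derivation E (derivation F (monomial a)) - derivation F (derivation E (monomial a))
      = derivation (\<lambda>t. derivation E (F t) - derivation F (E t)) (monomial a)"
    unfolding two unfolding comm derivation_monomial right_diff_distrib lin_ext_fun_diff by (simp add: algebra_simps)
  then show ?case unfolding derivation_const right_diff_distrib[symmetric] by simp
qed (simp_all add: derivation_add algebra_simps)

subsection \<open>The insertion and elimination operators\<close>

text \<open>The operators on rooted trees that the presentation axiomatises, with \<open>x\<^sub>t\<close> in place of the tree \<open>t\<close>: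
  joining \<open>u\<close> in all ways, cutting off \<open>u\<close> in all ways, and counting vertices.\<close>

fun gen_field :: "gen \<Rightarrow> rtree \<Rightarrow> fock" where
  "gen_field (GPlus u) t = (\<Sum>v\<in>vertices t. tvar (join t v u))"
| "gen_field (GMinus u) t = (\<Sum>e\<in>edges t. if pruned_part e t = u then tvar (root_part e t) else 0)"
| "gen_field GD t = scalar (of_nat (tsize t)) * tvar t"

lemma sum_if_card:
  "finite A \<Longrightarrow> (\<Sum>a\<in>A. if P a then c else 0) = of_nat (card {a \<in> A. P a}) * (c :: 'a::comm_ring_1)"
  by (simp add: sum.If_cases Int_def)

lemma finite_cuts: "finite {t. cuts s u t \<noteq> 0}"
  by (rule finite_subset[OF _ finite_tsize[of "tsize s + tsize u"]]) (use cuts_tsize in blast)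

lemma finite_alpha: "finite {t. alpha s u t \<noteq> 0}"
proof (rule finite_subset)
  show "{t. alpha s u t \<noteq> 0} \<subseteq> (\<Union>n\<le>tsize u. {t. tsize t = n})"
    unfolding alpha_def using cuts_tsize by fastforce
qed (auto simp: finite_tsize)

lemma finite_beta: "finite {t. beta s u t \<noteq> 0}"
proof (rule finite_subset)
  show "{t. beta s u t \<noteq> 0} \<subseteq> (\<Union>n\<le>tsize s. {t. tsize t = n})"
    unfolding beta_def using joins_tsize by fastforce
qed (auto simp: finite_tsize)

lemma sum_select:
  fixes g :: "'b \<Rightarrow> 'c::comm_ring_1"
  assumes "finite A" "finite {t. card {a \<in> A. p a = t} \<noteq> 0}"
  shows "(\<Sum>t | card {a \<in> A. p a = t} \<noteq> 0. of_nat (card {a \<in> A. p a = t}) * g t) = (\<Sum>a\<in>A. g (p a))"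
proof -
  have "(\<Sum>a\<in>A. g (p a)) = (\<Sum>t\<in>p ` A. \<Sum>a | a \<in> A \<and> p a = t. g (p a))"
    by (rule sum.image_gen[OF assms(1)])
  also have "\<dots> = (\<Sum>t\<in>p ` A. of_nat (card {a \<in> A. p a = t}) * g t)"
    by (intro sum.cong HOL.refl) simp
  also have "p ` A = {t. card {a \<in> A. p a = t} \<noteq> 0}" using assms(1) by (auto simp: card_eq_0_iff)
  finally show ?thesis ..
qed

text \<open>The commutation relations of the algebra, checked on the variables; by \<open>derivation_commutator\<close> they
  then hold for the derivations.\<close>

lemma gen_field_comm_plus:
  "derivation (gen_field (GPlus a)) (gen_field (GPlus b) t) - derivation (gen_field (GPlus b)) (gen_field (GPlus a) t)
   = (\<Sum>v\<in>vertices b. gen_field (GPlus (join b v a)) t) - (\<Sum>v\<in>vertices a. gen_field (GPlus (join a v b)) t)"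
  using sum_join_join[of tvar a t b] sum_join_join[of tvar t b a]
  by (simp add: derivation_sum derivation_tvar)

lemma derivation_if: "derivation E (if P then f else 0) = (if P then derivation E f else 0)" by simp

lemma sum_if_else: "(if P then sum f A else 0) = (\<Sum>x\<in>A. if P then f x else 0)"
  by simp

lemma gen_field_comm_minus:
  "derivation (gen_field (GMinus a)) (gen_field (GMinus b) t) - derivation (gen_field (GMinus b)) (gen_field (GMinus a) t)
   = (\<Sum>u | cuts a b u \<noteq> 0. of_nat (cuts a b u) * gen_field (GMinus u) t)
     - (\<Sum>u | cuts b a u \<noteq> 0. of_nat (cuts b a u) * gen_field (GMinus u) t)"
proof -
  let ?k = "\<lambda>p q r. if q = b \<and> r = a then tvar p else 0"
  have one: "derivation (gen_field (GMinus a)) (gen_field (GMinus b) t) = (\<Sum>e\<in>edges t. \<Sum>f\<in>edges (root_part e t).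
     if pruned_part e t = b \<and> pruned_part f (root_part e t) = a then tvar (root_part f (root_part e t)) else 0)" for a b
    by (auto simp: derivation_sum derivation_if derivation_tvar sum_if_else intro!: sum.cong)
  have two: "(\<Sum>u | cuts a b u \<noteq> 0. of_nat (cuts a b u) * gen_field (GMinus u) t)
     = (\<Sum>f\<in>edges t. \<Sum>e\<in>edges (pruned_part f t). if pruned_part e (pruned_part f t) = b \<and> root_part e (pruned_part f t) = a
          then tvar (root_part f t) else 0)" for a b
  proof -
    have "(\<Sum>u | cuts a b u \<noteq> 0. of_nat (cuts a b u) * gen_field (GMinus u) t)
       = (\<Sum>f\<in>edges t. \<Sum>u | cuts a b u \<noteq> 0. if pruned_part f t = u then of_nat (cuts a b u) * tvar (root_part f t) else 0)"
      unfolding gen_field.simps sum_distrib_left by (subst sum.swap) (auto intro!: sum.cong)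
    also have "\<dots> = (\<Sum>f\<in>edges t. of_nat (cuts a b (pruned_part f t)) * tvar (root_part f t))"
      by (intro sum.cong HOL.refl) (subst sum.delta'[OF finite_cuts], simp)
    also have "\<dots> = (\<Sum>f\<in>edges t. \<Sum>e\<in>edges (pruned_part f t). if pruned_part e (pruned_part f t) = b \<and> root_part e (pruned_part f t) = a
          then tvar (root_part f t) else 0)"
      unfolding sum_if_card[OF finite_edges] cuts_def by (simp add: conj_commute)
    finally show ?thesis .
  qed
  show ?thesis unfolding one two
    using sum_cut_cut[of ?k t] by (simp add: conj_commute)
qed

lemma gen_field_comm_minus_plus:
  "derivation (gen_field (GMinus a)) (gen_field (GPlus b) t) - derivation (gen_field (GPlus b)) (gen_field (GMinus a) t)
   = (if a = b then gen_field GD t else 0)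
     + (\<Sum>u | alpha a b u \<noteq> 0. of_nat (alpha a b u) * gen_field (GPlus u) t)
     + (\<Sum>u | beta a b u \<noteq> 0. of_nat (beta a b u) * gen_field (GMinus u) t)"
proof -
  let ?h = "\<lambda>p q. if q = a then tvar p else 0"
  have A: "derivation (gen_field (GMinus a)) (gen_field (GPlus b) t)
     = (\<Sum>v\<in>vertices t. \<Sum>e\<in>edges (join t v b). ?h (root_part e (join t v b)) (pruned_part e (join t v b)))"
    by (simp add: derivation_sum derivation_tvar)
  have B: "derivation (gen_field (GPlus b)) (gen_field (GMinus a) t)
     = (\<Sum>e\<in>edges t. \<Sum>v\<in>vertices (root_part e t). ?h (join (root_part e t) v b) (pruned_part e t))"
    by (auto simp: derivation_sum derivation_if derivation_tvar sum_if_else intro!: sum.cong)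
  have D: "(\<Sum>v\<in>vertices t. ?h t b) = (if a = b then gen_field GD t else 0)"
    by (simp add: tsize_def scalar_of_nat)
  have al: "(\<Sum>u | alpha a b u \<noteq> 0. of_nat (alpha a b u) * gen_field (GPlus u) t)
     = (\<Sum>e\<in>edges b. \<Sum>v\<in>vertices t. ?h (join t v (root_part e b)) (pruned_part e b))"
  proof -
    let ?A = "{e \<in> edges b. pruned_part e b = a}"
    have c: "alpha a b u = card {e \<in> ?A. root_part e b = u}" for u
      unfolding alpha_def cuts_def by (intro arg_cong[of _ _ card]) auto
    have "(\<Sum>u | alpha a b u \<noteq> 0. of_nat (alpha a b u) * gen_field (GPlus u) t) = (\<Sum>e\<in>?A. gen_field (GPlus (root_part e b)) t)"
      unfolding c using finite_alpha[of a b, unfolded c] by (intro sum_select) (auto simp: finite_edges)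
    also have "\<dots> = (\<Sum>e\<in>edges b. if pruned_part e b = a then gen_field (GPlus (root_part e b)) t else 0)"
      by (rule sum.inter_filter[OF finite_edges])
    finally show ?thesis by (simp add: sum_if_else cong: sum.cong if_cong)
  qed
  have be: "(\<Sum>u | beta a b u \<noteq> 0. of_nat (beta a b u) * gen_field (GMinus u) t)
     = (\<Sum>e\<in>edges t. \<Sum>v\<in>vertices (pruned_part e t). ?h (root_part e t) (join (pruned_part e t) v b))"
  proof -
    have "(\<Sum>u | beta a b u \<noteq> 0. of_nat (beta a b u) * gen_field (GMinus u) t)
       = (\<Sum>f\<in>edges t. \<Sum>u | beta a b u \<noteq> 0. if pruned_part f t = u then of_nat (beta a b u) * tvar (root_part f t) else 0)"
      unfolding gen_field.simps sum_distrib_left by (subst sum.swap) (auto intro!: sum.cong)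
    also have "\<dots> = (\<Sum>f\<in>edges t. of_nat (beta a b (pruned_part f t)) * tvar (root_part f t))"
      by (intro sum.cong HOL.refl) (subst sum.delta'[OF finite_beta], simp)
    also have "\<dots> = (\<Sum>e\<in>edges t. \<Sum>v\<in>vertices (pruned_part e t). ?h (root_part e t) (join (pruned_part e t) v b))"
      unfolding sum_if_card[OF finite_vertices] beta_def joins_def ..
    finally show ?thesis .
  qed
  show ?thesis unfolding A sum_cut_join[where h = ?h] unfolding B D al be by simp
qed

lemma gen_field_comm_D_minus:
  "derivation (gen_field GD) (gen_field (GMinus a) t) - derivation (gen_field (GMinus a)) (gen_field GD t) = - (of_nat (tsize a) * gen_field (GMinus a) t)"
proof -
  have "(\<Sum>e\<in>edges t. derivation (gen_field GD) (if pruned_part e t = a then tvar (root_part e t) else 0))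
      = (\<Sum>e\<in>edges t. (of_nat (tsize t) - of_nat (tsize a)) * (if pruned_part e t = a then tvar (root_part e t) else 0))"
  proof (rule sum.cong[OF HOL.refl])
    fix e assume "e \<in> edges t"
    from tsize_cut[OF this, symmetric]
    show "derivation (gen_field GD) (if pruned_part e t = a then tvar (root_part e t) else 0)
      = (of_nat (tsize t) - of_nat (tsize a)) * (if pruned_part e t = a then tvar (root_part e t) else 0)"
      by (auto simp: derivation_tvar scalar_of_nat)
  qed
  then show ?thesis
    by (simp add: derivation_sum derivation_of_nat derivation_tvar scalar_of_nat sum_distrib_left sum_subtractf left_diff_distrib)
qed

lemma gen_field_comm_D_plus:
  "derivation (gen_field GD) (gen_field (GPlus a) t) - derivation (gen_field (GPlus a)) (gen_field GD t) = of_nat (tsize a) * gen_field (GPlus a) t"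
proof -
  have "(\<Sum>v\<in>vertices t. derivation (gen_field GD) (tvar (join t v a)))
      = (\<Sum>v\<in>vertices t. (of_nat (tsize t) + of_nat (tsize a)) * tvar (join t v a))"
    by (intro sum.cong HOL.refl) (simp add: derivation_tvar scalar_of_nat tsize_join scalar_add)
  then show ?thesis
    by (simp add: derivation_sum derivation_of_nat derivation_tvar scalar_of_nat sum_distrib_left sum.distrib distrib_right)
qed

subsection \<open>The action of the insertion-elimination Lie algebra\<close>

declare gen_field.simps [simp del]

primrec lterm_act :: "gen lterm \<Rightarrow> fock \<Rightarrow> fock" where
  "lterm_act (LGen g) = derivation (gen_field g)"
| "lterm_act LZero = (\<lambda>f. 0)"
| "lterm_act (LAdd s t) = (\<lambda>f. lterm_act s f + lterm_act t f)"
| "lterm_act (LScale c s) = (\<lambda>f. scalar c * lterm_act s f)"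
| "lterm_act (LBr s t) = (\<lambda>f. lterm_act s (lterm_act t f) - lterm_act t (lterm_act s f))"

lemma lterm_act_add: "lterm_act s (f + g) = lterm_act s f + lterm_act s g"
  by (induction s arbitrary: f g) (simp_all add: derivation_add algebra_simps)

lemma lterm_act_const: "lterm_act s (scalar c * f) = scalar c * lterm_act s f"
  by (induction s arbitrary: f) (simp_all add: derivation_const distrib_left right_diff_distrib mult.left_commute[of "scalar c"])

lemma lterm_act_zero: "lterm_act s 0 = 0"
  using lterm_act_add[of s 0 0] by simp

lemma lterm_act_diff: "lterm_act s (f - g) = lterm_act s f - lterm_act s g"
  using lterm_act_add[of s "f - g" g] by simp

lemma lterm_eq_act: "lterm_eq s t \<Longrightarrow> lterm_act s = lterm_act t"
proof (induction rule: lterm_eq.induct)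
  case (add_neg s)
  have "scalar (- 1) * f = - f" for f :: fock by (simp add: scalar_uminus)
  then show ?case by (simp add: fun_eq_iff)
qed (simp_all add: fun_eq_iff lterm_act_add lterm_act_diff lterm_act_const lterm_act_zero scalar_add scalar_mult
    distrib_left distrib_right right_diff_distrib mult.assoc)

lift_definition free_act :: "gen free_lie \<Rightarrow> fock \<Rightarrow> fock" is lterm_act
  by (rule lterm_eq_act)

lemma free_act_zero: "free_act 0 f = 0"
  by transfer simp

lemma free_act_add: "free_act (x + y) f = free_act x f + free_act y f"
  by transfer simp

lemma free_act_scale: "free_act (c *\<^sub>C x) f = scalar c * free_act x f"
  by transfer simp

lemma free_act_lie: "free_act (lie x y) f = free_act x (free_act y f) - free_act y (free_act x f)"
  by transfer simp

lemma free_act_gen: "free_act (fgen g) f = derivation (gen_field g) f"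
  by transfer simp

lemmas free_act_simps = free_act_zero free_act_add free_act_scale free_act_lie free_act_gen

lemma free_act_arg_zero: "free_act x 0 = 0"
  by transfer (rule lterm_act_zero)

lemma free_act_uminus: "free_act (- x) f = - free_act x f"
  using free_act_simps(2)[of x "- x" f] by (simp add: free_act_simps(1) eq_neg_iff_add_eq_0 add.commute)

lemma free_act_diff: "free_act (x - y) f = free_act x f - free_act y f"
  using free_act_simps(2)[of x "- y" f] by (simp add: free_act_uminus)

lemma free_act_sum: "free_act (\<Sum>i\<in>I. x i) f = (\<Sum>i\<in>I. free_act (x i) f)"
  by (induction I rule: infinite_finite_induct) (simp_all add: free_act_simps)

lemma relator_act:
  assumes "x \<in> ie_relators" shows "free_act x f = 0"
proof -
  note simps = free_act_simps free_act_diff free_act_sum scalar_of_nat scalar_uminus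
  have mult: "derivation (\<lambda>t. of_nat n * E t) f = of_nat n * derivation E f" for n E
    using derivation_fun_const[of "of_nat n" E] by (simp add: scalar_of_nat)
  note der = derivation_commutator derivation_fun_add derivation_fun_diff derivation_fun_sum mult
  show ?thesis
    using assms unfolding ie_relators_def
  proof (elim UnE CollectE exE conjE)
    fix a b assume x: "x = lie (fP a) (fP b) -
        ((\<Sum>v\<in>vertices b. fP (join b v a)) - (\<Sum>v\<in>vertices a. fP (join a v b)))"
    show ?thesis unfolding x simps unfolding der(1) gen_field_comm_plus unfolding der by simp
  next
    fix a b assume x: "x = lie (fM a) (fM b) -
        ((\<Sum>t | cuts a b t \<noteq> 0. of_nat (cuts a b t) *\<^sub>C fM t)
         - (\<Sum>t | cuts b a t \<noteq> 0. of_nat (cuts b a t) *\<^sub>C fM t))"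
    show ?thesis unfolding x simps unfolding der(1) gen_field_comm_minus unfolding der by simp
  next
    fix a b assume ab: "a \<noteq> b" and x: "x = lie (fM a) (fP b) -
        ((\<Sum>t | alpha a b t \<noteq> 0. of_nat (alpha a b t) *\<^sub>C fP t)
         + (\<Sum>t | beta a b t \<noteq> 0. of_nat (beta a b t) *\<^sub>C fM t))"
    show ?thesis unfolding x simps unfolding der(1) gen_field_comm_minus_plus unfolding der
      using ab by (simp add: derivation_fun_zero)
  next
    fix t assume x: "x = lie (fM t) (fP t) - fD"
    \<comment> \<open>The relation for \<open>[D\<^sup>-\<^sub>t, D\<^sup>+\<^sub>t]\<close> has no such terms, and for reasons of size they vanish in
        \<open>gen_field_comm_minus_plus\<close> too.\<close>
    have "alpha t t u = 0" for u
      using cuts_tsize[of u t t] tsize_pos[of u] unfolding alpha_def by linarith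
    moreover have "beta t t u = 0" for u
      using joins_tsize[of u t t] tsize_pos[of u] unfolding beta_def by linarith
    ultimately show ?thesis unfolding x simps unfolding der(1) gen_field_comm_minus_plus by simp
  next
    fix t assume x: "x = lie fD (fM t) - (- of_nat (tsize t)) *\<^sub>C fM t"
    have "derivation (\<lambda>u. - (of_nat (tsize t) * gen_field (GMinus t) u)) f = - (of_nat (tsize t) * derivation (gen_field (GMinus t)) f)"
      using derivation_fun_const[of "- of_nat (tsize t)" "gen_field (GMinus t)"] by (simp add: scalar_of_nat scalar_uminus)
    then show ?thesis unfolding x simps unfolding der(1) gen_field_comm_D_minus by simp
  next
    fix t assume x: "x = lie fD (fP t) - of_nat (tsize t) *\<^sub>C fP t"
    show ?thesis unfolding x simps unfolding der(1) gen_field_comm_D_plus unfolding der by simp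
  qed
qed

lemma lie_ideal_act: "x \<in> lie_ideal ie_relators \<Longrightarrow> free_act x f = 0"
  by (induction arbitrary: f rule: lie_ideal.induct)
    (simp_all add: relator_act free_act_simps free_act_arg_zero)

lift_definition ie_act :: "ie_lie \<Rightarrow> fock \<Rightarrow> fock" is free_act
proof
  fix x y :: "gen free_lie" and f
  assume "x - y \<in> lie_ideal ie_relators"
  from lie_ideal_act[OF this, of f] show "free_act x f = free_act y f" by (simp add: free_act_diff)
qed

lemma ie_act_zero: "ie_act 0 f = 0"
  by transfer (simp add: free_act_simps)

lemma ie_act_add: "ie_act (x + y) f = ie_act x f + ie_act y f"
  by transfer (simp add: free_act_simps)

lemma ie_act_scale: "ie_act (c *\<^sub>C x) f = scalar c * ie_act x f"
  by transfer (simp add: free_act_simps)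

lemma ie_act_lie: "ie_act (lie x y) f = ie_act x (ie_act y f) - ie_act y (ie_act x f)"
  by transfer (simp add: free_act_simps)

lemma ie_act_plus: "ie_act (D_plus t) f = derivation (gen_field (GPlus t)) f"
  by transfer (simp add: free_act_simps)

lemma ie_act_minus: "ie_act (D_minus t) f = derivation (gen_field (GMinus t)) f"
  by transfer (simp add: free_act_simps)

lemma ie_act_d: "ie_act d_elem f = derivation (gen_field GD) f"
  by transfer (simp add: free_act_simps)

lemmas ie_act_simps = ie_act_zero ie_act_add ie_act_scale ie_act_lie ie_act_plus ie_act_minus ie_act_d

lemma ie_act_arg_add: "ie_act x (f + g) = ie_act x f + ie_act x g"
  by (transfer, transfer, simp add: lterm_act_add lterm_act_const)

lemma ie_act_arg_const: "ie_act x (scalar c * f) = scalar c * ie_act x f"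
  by (transfer, transfer, simp add: lterm_act_add lterm_act_const)

lemmas ie_act_arg = ie_act_arg_add ie_act_arg_const

primrec uterm_act :: "ie_lie uterm \<Rightarrow> fock \<Rightarrow> fock" where
  "uterm_act (UInc x) = ie_act x"
| "uterm_act UZero = (\<lambda>f. 0)"
| "uterm_act UOne = (\<lambda>f. f)"
| "uterm_act (UAdd s t) = (\<lambda>f. uterm_act s f + uterm_act t f)"
| "uterm_act (UScale c s) = (\<lambda>f. scalar c * uterm_act s f)"
| "uterm_act (UMul s t) = (\<lambda>f. uterm_act s (uterm_act t f))"

lemma uterm_act_arg:
  "uterm_act s (f + g) = uterm_act s f + uterm_act s g" "uterm_act s (scalar c * f) = scalar c * uterm_act s f"
  by (induction s arbitrary: f g) (simp_all add: ie_act_arg distrib_left mult.left_commute[of "scalar c"])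

lift_definition uea_act :: "ie_lie uea \<Rightarrow> fock \<Rightarrow> fock" is uterm_act
proof -
  fix s t :: "ie_lie uterm"
  assume "uterm_eq s t"
  then show "uterm_act s = uterm_act t"
    by (induction rule: uterm_eq.induct)
      (simp_all add: fun_eq_iff uterm_act_arg ie_act_simps scalar_add scalar_mult scalar_uminus
        distrib_left distrib_right mult.assoc)
qed

lemma uea_act_zero: "uea_act 0 f = 0"
  by transfer simp

lemma uea_act_one: "uea_act 1 f = f"
  by transfer simp

lemma uea_act_add: "uea_act (u + v) f = uea_act u f + uea_act v f"
  by transfer simp

lemma uea_act_scale: "uea_act (c *\<^sub>C u) f = scalar c * uea_act u f"
  by transfer simp

lemma uea_act_mult: "uea_act (u * v) f = uea_act u (uea_act v f)"
  by transfer simp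

lemma uea_act_uinc: "uea_act (uinc x) f = ie_act x f"
  by transfer simp

lemmas uea_act_simps = uea_act_zero uea_act_one uea_act_add uea_act_scale uea_act_mult uea_act_uinc

lemma uea_act_arg_add: "uea_act u (f + g) = uea_act u f + uea_act u g"
  by transfer (simp add: uterm_act_arg)

lemma uea_act_arg_const: "uea_act u (scalar c * f) = scalar c * uea_act u f"
  by transfer (simp add: uterm_act_arg)

lemmas uea_act_arg = uea_act_arg_add uea_act_arg_const

subsection \<open>The lowest weight vector\<close>

text \<open>The power \<open>lam\<close> of the variable of the one-vertex tree. Having no edge, this tree is
  annihilated by all cutting operators, and it has size 1.\<close>

definition vacuum :: "complex \<Rightarrow> fock" where "vacuum lam = monomial (Poly_Mapping.single bullet lam)"

lemma scalar_vacuum_eq_0: "scalar c * vacuum lam = 0 \<longleftrightarrow> c = 0"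
proof -
  have "scalar c * vacuum lam = Poly_Mapping.single (Poly_Mapping.single bullet lam) c"
    by (simp add: single_eq vacuum_def)
  then show ?thesis by (metis lookup_single_eq lookup_zero single_zero)
qed

lemma n_minus_vacuum: "x \<in> n_minus \<Longrightarrow> ie_act x (vacuum lam) = 0"
  unfolding n_minus_def
proof (induction rule: lie_subalgebra.induct)
  case (base x)
  then show ?case
    by (auto simp: ie_act_simps vacuum_def derivation_monomial lin_ext_single bullet_facts gen_field.simps)
next
  case (lie x y)
  have "ie_act x 0 = 0" for x using ie_act_arg(1)[of x 0 0] by simp
  then show ?case by (simp add: ie_act_simps lie)
qed (simp_all add: ie_act_simps)

lemma d_vacuum: "ie_act d_elem (vacuum lam) = scalar lam * vacuum lam"
proof -
  have "ie_act d_elem (vacuum lam) = scalar lam * (tvar bullet * tvar_inv bullet) * vacuum lam"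
    unfolding ie_act_simps vacuum_def derivation_monomial lin_ext_single
    by (simp add: bullet_facts gen_field.simps mult.commute mult.left_commute)
  then show ?thesis by (simp add: tvar_tvar_inv)
qed

text \<open>The definite description in \<open>weight_char\<close> has a unique solution only if \<open>d\<close> is not in \<open>\<nn>\<^sub>-\<close>; the lowest weight vector of
  weight 1 tells them apart.\<close>

lemma d_component_unique:
  assumes "a *\<^sub>C d_elem + x = b *\<^sub>C d_elem + y" "x \<in> n_minus" "y \<in> n_minus"
  shows "a = b"
proof -
  have "scalar a * vacuum 1 = scalar b * vacuum 1"
    using arg_cong[OF assms(1), of "\<lambda>z. ie_act z (vacuum 1)"] assms(2,3)
    by (simp add: ie_act_simps(2,3) n_minus_vacuum d_vacuum)
  then have "scalar (a - b) * vacuum 1 = 0"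
    unfolding diff_conv_add_uminus scalar_add scalar_uminus by (simp add: algebra_simps)
  then show ?thesis by (simp add: scalar_vacuum_eq_0)
qed

lemma weight_char_eq:
  assumes "Rep_bsub_lie b = a *\<^sub>C d_elem + x" "x \<in> n_minus"
  shows "weight_char lam b = a * lam"
proof -
  have "(THE a. \<exists>x\<in>n_minus. Rep_bsub_lie b = a *\<^sub>C d_elem + x) = a"
    using assms d_component_unique by (intro the_equality) auto
  then show ?thesis by (simp add: weight_char_def)
qed

lemma Rep_bsub_cases:
  obtains a x where "Rep_bsub_lie b = a *\<^sub>C d_elem + x" "x \<in> n_minus"
  using Rep_bsub_lie[of b] bsubE by metis

lemma weight_char_act: "ie_act (Rep_bsub_lie b) (vacuum lam) = scalar (weight_char lam b) * vacuum lam"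
proof -
  obtain a x where b: "Rep_bsub_lie b = a *\<^sub>C d_elem + x" "x \<in> n_minus" by (rule Rep_bsub_cases)
  show ?thesis
    unfolding weight_char_eq[OF b] unfolding b(1)
    by (simp add: ie_act_simps(2,3) n_minus_vacuum[OF b(2)] d_vacuum scalar_mult mult.assoc)
qed

lemma weight_char_unique:
  assumes "ie_act (Rep_bsub_lie b) (vacuum lam) = scalar c * vacuum lam" shows "weight_char lam b = c"
proof -
  have "scalar (weight_char lam b - c) * vacuum lam = 0"
    using assms weight_char_act[of b lam] unfolding diff_conv_add_uminus scalar_add scalar_uminus
    by (simp add: algebra_simps)
  then show ?thesis by (simp add: scalar_vacuum_eq_0)
qed

lemma uinc_add: "uinc (x + y) = uinc x + uinc y"
  by transfer (rule uterm_eq.inc_add)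

lemma uinc_scale: "uinc (c *\<^sub>C x) = c *\<^sub>C uinc x"
  by transfer (rule uterm_eq.inc_scale)

lemma uinc_lie: "uinc (lie x y) = uinc x * uinc y - uinc y * uinc x"
  unfolding minus_uea_def by transfer (rule uterm_eq.inc_lie)

lemmas uinc_hom = uinc_add uinc_scale uinc_lie

lemma weight_char_add: "weight_char lam (x + y) = weight_char lam x + weight_char lam y"
  by (rule weight_char_unique)
    (simp add: plus_bsub_lie.rep_eq ie_act_add weight_char_act scalar_add distrib_right)

lemma weight_char_scale: "weight_char lam (c *\<^sub>C x) = c *\<^sub>C weight_char lam x"
  by (rule weight_char_unique)
    (simp add: scaleC_bsub_lie.rep_eq ie_act_scale weight_char_act scalar_mult scaleC_complex_def mult.assoc)

lemma weight_char_lie: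
  "weight_char lam (lie x y) = weight_char lam x * weight_char lam y - weight_char lam y * weight_char lam x"
  by (rule weight_char_unique)
    (simp add: lie_bsub_lie.rep_eq ie_act_lie ie_act_arg_const weight_char_act mult.left_commute)

lemmas weight_char_hom = weight_char_add weight_char_scale weight_char_lie

text \<open>Hence the map \<open>x \<otimes> z \<mapsto> x (z vacuum)\<close> respects the tensor relations.\<close>

lemma bsub_extend_act:
  "uea_act (uea_extend (\<lambda>b. uinc (Rep_bsub_lie b)) u) (vacuum lam)
   = scalar (uea_extend (weight_char lam) u) * vacuum lam"
proof -
  obtain s where u: "u = abs_uea s" using Quotient3_abs_rep[OF Quotient3_uea, of u] by metis
  have e1: "uea_extend (\<lambda>b. uinc (Rep_bsub_lie b)) u = uterm_eval (\<lambda>b. uinc (Rep_bsub_lie b)) s"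
    unfolding u by (rule uea_extend_abs)
      (simp_all add: uinc_hom plus_bsub_lie.rep_eq scaleC_bsub_lie.rep_eq lie_bsub_lie.rep_eq)
  have e2: "uea_extend (weight_char lam) u = uterm_eval (weight_char lam) s"
    unfolding u by (rule uea_extend_abs) (rule weight_char_hom)+
  show ?thesis unfolding e1 e2
    by (induction s) (simp_all add: uea_act_simps uea_act_arg weight_char_act scalar_add scalar_mult
        scaleC_complex_def distrib_right mult.assoc mult.left_commute)
qed

section \<open>The Verma module as a quotient of the enveloping algebra\<close>

abbreviation tensor_rels :: "complex \<Rightarrow> (ie_lie uea \<times> complex \<Rightarrow>\<^sub>0 int) set" where
  "tensor_rels lam \<equiv> tensor_subgroup U_right_act (C_act lam)"

abbreviation frags :: "(ie_lie uea \<times> complex \<Rightarrow>\<^sub>0 int) monoid" where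
  "frags \<equiv> free_Abelian_group UNIV"

lemma tensor_rels_subgroup: "subgroup (tensor_rels lam) frags"
  unfolding tensor_subgroup_def
  by (rule group.generate_is_subgroup[OF group_free_Abelian_group]) auto

lemma tensor_rels_zero: "0 \<in> tensor_rels lam"
  using subgroup.one_closed[OF tensor_rels_subgroup] by simp

lemma tensor_rels_add: "a \<in> tensor_rels lam \<Longrightarrow> b \<in> tensor_rels lam \<Longrightarrow> a + b \<in> tensor_rels lam"
  using subgroup.m_closed[OF tensor_rels_subgroup] by simp

lemma tensor_rels_uminus: "a \<in> tensor_rels lam \<Longrightarrow> - a \<in> tensor_rels lam"
  using subgroup.m_inv_closed[OF tensor_rels_subgroup, of a lam] by simp

lemma tensor_rels_diff: "a \<in> tensor_rels lam \<Longrightarrow> b \<in> tensor_rels lam \<Longrightarrow> a - b \<in> tensor_rels lam"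
  using tensor_rels_add[of a lam "- b"] tensor_rels_uminus[of b lam] by simp

lemma tensor_rels_base: "a \<in> tensor_relators U_right_act (C_act lam) \<Longrightarrow> a \<in> tensor_rels lam"
  unfolding tensor_subgroup_def by (rule generate.incl)

lemma tensor_rels_left: "frag_of (x + y, z) - (frag_of (x, z) + frag_of (y, z)) \<in> tensor_rels lam"
  by (rule tensor_rels_base) (unfold tensor_relators_def, blast)

lemma tensor_rels_balanced: "frag_of (U_right_act x r, z) - frag_of (x, C_act lam r z) \<in> tensor_rels lam"
  by (rule tensor_rels_base) (unfold tensor_relators_def, blast)

lemma tensor_rels_induct [consumes 1, case_names zero left right balanced diff]:
  assumes "a \<in> tensor_rels lam"
    and "P 0" "\<And>x y z. P (frag_of (x + y, z) - (frag_of (x, z) + frag_of (y, z)))"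
    "\<And>x z w. P (frag_of (x, z + w) - (frag_of (x, z) + frag_of (x, w)))"
    "\<And>x r z. P (frag_of (U_right_act x r, z) - frag_of (x, C_act lam r z))"
    "\<And>a b. P a \<Longrightarrow> P b \<Longrightarrow> P (a - b)"
  shows "P a"
proof -
  have rel: "P b" if "b \<in> tensor_relators U_right_act (C_act lam)" for b
    using that assms(3-5) unfolding tensor_relators_def by auto
  have um: "P (- b)" if "P b" for b using assms(6)[OF assms(2) that] by simp
  from assms(1) show ?thesis unfolding tensor_subgroup_def
  proof (induction rule: generate.induct)
    case (eng h1 h2)
    then show ?case using assms(6)[OF _ um, of h1 h2] by simp
  qed (use assms(2) rel um in auto)
qed

text \<open>The \<open>x\<close> with \<open>x \<otimes> 1 = 0\<close>: the Verma module is the quotient by this left ideal.\<close>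

definition verma_ideal :: "complex \<Rightarrow> ie_lie uea set" where
  "verma_ideal lam = {x. frag_of (x, 1) \<in> tensor_rels lam}"

lemma U_right_act_mult: "u * U_right_act x r = U_right_act (u * x) r"
  by (simp add: U_right_act_def mult.assoc)

definition left_act :: "ie_lie uea \<Rightarrow> (ie_lie uea \<times> complex \<Rightarrow>\<^sub>0 int) \<Rightarrow> (ie_lie uea \<times> complex \<Rightarrow>\<^sub>0 int)" where
  "left_act u = frag_extend (\<lambda>(x, z). frag_of (u * x, z))"

lemma left_act_frag_of: "left_act u (frag_of (x, z)) = frag_of (u * x, z)"
  by (simp add: left_act_def)

lemma left_act_diff: "left_act u (a - b) = left_act u a - left_act u b"
  by (simp add: left_act_def frag_extend_diff)

lemma left_act_add: "left_act u (a + b) = left_act u a + left_act u b"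
  by (simp add: left_act_def frag_extend_add)

lemma left_act_tensor_rels: "a \<in> tensor_rels lam \<Longrightarrow> left_act u a \<in> tensor_rels lam"
proof (induction rule: tensor_rels_induct)
  case zero
  then show ?case by (simp add: left_act_def tensor_rels_zero)
next
  case (left x y z)
  then show ?case using tensor_rels_left[of "u * x" "u * y" z lam]
    by (simp add: left_act_diff left_act_add left_act_frag_of distrib_left)
next
  case (right x z w)
  have "frag_of (u * x, z + w) - (frag_of (u * x, z) + frag_of (u * x, w)) \<in> tensor_rels lam"
    by (rule tensor_rels_base) (unfold tensor_relators_def, blast)
  then show ?case by (simp add: left_act_diff left_act_add left_act_frag_of)
next
  case (balanced x r z)
  then show ?case using tensor_rels_balanced[of "u * x" r z lam]
    by (simp add: left_act_diff left_act_add left_act_frag_of U_right_act_mult)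
next
  case (diff a b)
  then show ?case by (simp add: left_act_diff tensor_rels_diff)
qed

lemma verma_ideal_zero: "0 \<in> verma_ideal lam"
  using tensor_rels_uminus[OF tensor_rels_left[of 0 0 1 lam]] by (simp add: verma_ideal_def)

lemma verma_ideal_add: "x \<in> verma_ideal lam \<Longrightarrow> y \<in> verma_ideal lam \<Longrightarrow> x + y \<in> verma_ideal lam"
  using tensor_rels_add[OF tensor_rels_left[of x y 1 lam] tensor_rels_add[of "frag_of (x, 1)" lam "frag_of (y, 1)"]]
  by (simp add: verma_ideal_def)

lemma verma_ideal_mult: "x \<in> verma_ideal lam \<Longrightarrow> u * x \<in> verma_ideal lam"
  using left_act_tensor_rels[of "frag_of (x, 1)" lam u] by (simp add: verma_ideal_def left_act_frag_of)

lemma verma_ideal_bsub: "uinc (Rep_bsub_lie b) - weight_char lam b *\<^sub>C 1 \<in> verma_ideal lam"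
proof -
  have e1: "uea_extend (\<lambda>b. uinc (Rep_bsub_lie b)) (uinc b - weight_char lam b *\<^sub>C 1)
      = uinc (Rep_bsub_lie b) - weight_char lam b *\<^sub>C 1"
    and e2: "uea_extend (weight_char lam) (uinc b - weight_char lam b *\<^sub>C 1) = 0"
  proof -
    have r: "uinc b - weight_char lam b *\<^sub>C 1
       = abs_uea (UAdd (UInc b) (UScale (- 1) (UScale (weight_char lam b) UOne)))"
      unfolding minus_uea_def
      by (simp add: uinc.abs_eq one_uea.abs_eq scaleC_uea.abs_eq uminus_uea.abs_eq plus_uea.abs_eq)
    show "uea_extend (\<lambda>b. uinc (Rep_bsub_lie b)) (uinc b - weight_char lam b *\<^sub>C 1)
      = uinc (Rep_bsub_lie b) - weight_char lam b *\<^sub>C 1"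
      unfolding r by (subst uea_extend_abs)
        (simp_all add: uinc_hom plus_bsub_lie.rep_eq scaleC_bsub_lie.rep_eq lie_bsub_lie.rep_eq scaleC_minus_one)
    show "uea_extend (weight_char lam) (uinc b - weight_char lam b *\<^sub>C 1) = 0"
      unfolding r by (subst uea_extend_abs)
        (simp_all add: weight_char_hom scaleC_minus_one, simp add: scaleC_complex_def)
  qed
  have "frag_of (1 * uea_extend (\<lambda>b. uinc (Rep_bsub_lie b)) (uinc b - weight_char lam b *\<^sub>C 1), 1)
      - frag_of (1 :: ie_lie uea, 0) \<in> tensor_rels lam"
    using tensor_rels_balanced[of 1 "uinc b - weight_char lam b *\<^sub>C 1" 1 lam]
    by (simp add: U_right_act_def C_act_def e2)
  moreover have "frag_of (1 :: ie_lie uea, 0) \<in> tensor_rels lam"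
  proof -
    have "frag_of (1 :: ie_lie uea, 0 + 0) - (frag_of (1, 0) + frag_of (1, 0)) \<in> tensor_rels lam"
      by (rule tensor_rels_base) (unfold tensor_relators_def, blast)
    from tensor_rels_uminus[OF this] show ?thesis by simp
  qed
  ultimately show ?thesis unfolding verma_ideal_def e1
    using tensor_rels_add by fastforce
qed

lemma verma_ideal_D_minus: "uinc (D_minus t) \<in> verma_ideal lam"
proof -
  have n: "D_minus t \<in> n_minus" by (simp add: n_minus_def lie_subalgebra.base)
  then have b: "D_minus t \<in> bsub" by (rule bsubI[of _ _ 0]) (simp add: scaleC_zero_left)
  have r: "Rep_bsub_lie (Abs_bsub_lie (D_minus t)) = 0 *\<^sub>C d_elem + D_minus t"
    using b by (simp add: Abs_bsub_lie_inverse scaleC_zero_left)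
  show ?thesis
    using verma_ideal_bsub[of "Abs_bsub_lie (D_minus t)" lam] unfolding weight_char_eq[OF r n]
    by (simp add: scaleC_zero_left Abs_bsub_lie_inverse b)
qed

lemma verma_ideal_d: "uinc d_elem - lam *\<^sub>C 1 \<in> verma_ideal lam"
proof -
  have n: "0 \<in> n_minus" by (simp add: n_minus_def lie_subalgebra.zero)
  then have b: "d_elem \<in> bsub" by (rule bsubI[of _ _ 1]) (simp add: scaleC_one)
  have r: "Rep_bsub_lie (Abs_bsub_lie d_elem) = 1 *\<^sub>C d_elem + 0"
    using b by (simp add: Abs_bsub_lie_inverse scaleC_one)
  show ?thesis
    using verma_ideal_bsub[of "Abs_bsub_lie d_elem" lam] unfolding weight_char_eq[OF r n]
    by (simp add: Abs_bsub_lie_inverse b)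
qed

text \<open>The map \<open>x \<otimes> z \<mapsto> x (z vacuum)\<close> on formal combinations of pairs.\<close>

definition frag_act :: "complex \<Rightarrow> (ie_lie uea \<times> complex \<Rightarrow>\<^sub>0 int) \<Rightarrow> fock" where
  "frag_act lam w = (\<Sum>k\<in>Poly_Mapping.keys w. of_int (Poly_Mapping.lookup w k) * uea_act (fst k) (scalar (snd k) * vacuum lam))"

lemma frag_act_superset:
  assumes "finite K" "Poly_Mapping.keys f \<subseteq> K"
  shows "frag_act lam f = (\<Sum>k\<in>K. of_int (Poly_Mapping.lookup f k) * uea_act (fst k) (scalar (snd k) * vacuum lam))"
  unfolding frag_act_def by (rule sum.mono_neutral_left) (use assms in \<open>auto simp: in_keys_iff\<close>)

lemma frag_act_diff: "frag_act lam (f - g) = frag_act lam f - frag_act lam g"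
proof -
  let ?K = "Poly_Mapping.keys f \<union> Poly_Mapping.keys g"
  have "frag_act lam (f - g) = (\<Sum>k\<in>?K. of_int (Poly_Mapping.lookup (f - g) k) * uea_act (fst k) (scalar (snd k) * vacuum lam))"
    using keys_diff[of f g] by (intro frag_act_superset) auto
  also have "\<dots> = frag_act lam f - frag_act lam g"
    by (simp add: frag_act_superset[of ?K] lookup_minus left_diff_distrib sum_subtractf)
  finally show ?thesis .
qed

lemma frag_act_frag_of: "frag_act lam (frag_of (x, z)) = uea_act x (scalar z * vacuum lam)"
  by (simp add: frag_act_def)

lemma frag_act_tensor_rels: "a \<in> tensor_rels lam \<Longrightarrow> frag_act lam a = 0"
proof (induction rule: tensor_rels_induct)
  case zero
  then show ?case by (simp add: frag_act_def)
next
  case (balanced x r z)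
  then show ?case
    by (simp add: frag_act_diff frag_act_frag_of U_right_act_def C_act_def uea_act_simps uea_act_arg
        bsub_extend_act scalar_mult mult.assoc mult.left_commute)
qed (simp_all add: diff_diff_add[symmetric] frag_act_diff frag_act_frag_of uea_act_simps
    uea_act_arg scalar_add distrib_left distrib_right)

lemma verma_ideal_proper: "1 \<notin> verma_ideal lam"
proof
  assume "1 \<in> verma_ideal lam"
  then have "frag_act lam (frag_of (1, 1)) = 0" by (intro frag_act_tensor_rels) (simp add: verma_ideal_def)
  then show False using scalar_vacuum_eq_0[of 1 lam] by (simp add: frag_act_frag_of uea_act_simps)
qed

text \<open>Scalars in the second factor can be moved to the first one, so every tensor has the form \<open>x \<otimes> 1\<close>.\<close>

lemma frag_reduce: "\<exists>x. w - frag_of (x, 1) \<in> tensor_rels lam"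
proof -
  have "Poly_Mapping.keys w \<subseteq> UNIV" by simp
  then show ?thesis
  proof (induction rule: frag_induction)
    case zero
    then show ?case
      using verma_ideal_zero[of lam] tensor_rels_uminus by (intro exI[of _ 0]) (simp add: verma_ideal_def)
  next
    case (one k)
    obtain x z where k: "k = (x, z)" by (cases k)
    have "uea_extend (weight_char lam) (z *\<^sub>C 1) = z"
    proof -
      have "z *\<^sub>C (1 :: bsub_lie uea) = abs_uea (UScale z UOne)"
        by (simp add: one_uea.abs_eq scaleC_uea.abs_eq)
      moreover have "uea_extend (weight_char lam) (abs_uea (UScale z UOne)) = uterm_eval (weight_char lam) (UScale z UOne)"
        by (rule uea_extend_abs) (rule weight_char_hom)+
      ultimately show ?thesis by (simp add: scaleC_complex_def)
    qed
    then have "frag_of (U_right_act x (z *\<^sub>C 1), 1) - frag_of (x, z) \<in> tensor_rels lam"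
      using tensor_rels_balanced[of x "z *\<^sub>C 1" 1 lam] by (simp add: C_act_def)
    from tensor_rels_uminus[OF this] show ?case unfolding k by auto
  next
    case (diff a b)
    then obtain x y where xy: "a - frag_of (x, 1) \<in> tensor_rels lam" "b - frag_of (y, 1) \<in> tensor_rels lam" by blast
    have "frag_of (x - y + y, 1) - (frag_of (x - y, 1) + frag_of (y, 1)) \<in> tensor_rels lam"
      by (rule tensor_rels_left)
    from tensor_rels_add[OF tensor_rels_diff[OF xy] this]
    show ?case by (intro exI[of _ "x - y"]) (simp add: algebra_simps)
  qed
qed

text \<open>Submodules of the Verma module correspond to the left ideals \<open>L\<close> containing \<open>verma_ideal lam\<close>. A
  subgroup stable under the whole enveloping algebra is a submodule, because scalars act through it.\<close>

lemma irreducible_verma_if_maximal: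
  assumes max: "\<And>L x. verma_ideal lam \<subseteq> L \<Longrightarrow> (\<And>y z. y \<in> L \<Longrightarrow> z \<in> L \<Longrightarrow> y + z \<in> L)
      \<Longrightarrow> (\<And>u y. y \<in> L \<Longrightarrow> u * y \<in> L) \<Longrightarrow> x \<in> L \<Longrightarrow> x \<notin> verma_ideal lam \<Longrightarrow> 1 \<in> L"
  shows "irreducible_module (verma lam) (verma_act lam)"
proof -
  let ?H = "tensor_rels lam"
  define \<tau> where "\<tau> a = ?H #>\<^bsub>frags\<^esub> a" for a
  interpret G: comm_group frags by (rule abelian_free_Abelian_group)
  have carr: "a \<in> carrier frags" for a by simp
  have sub: "subgroup ?H frags" by (rule tensor_rels_subgroup)
  have nrm: "normal ?H frags" using G.subgroup_imp_normal[OF sub] .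
  have in_tau: "b \<in> \<tau> a \<longleftrightarrow> b - a \<in> ?H" for a b
  proof
    assume "b \<in> \<tau> a" then show "b - a \<in> ?H" by (auto simp: \<tau>_def r_coset_def)
  next
    assume "b - a \<in> ?H"
    then show "b \<in> \<tau> a" unfolding \<tau>_def r_coset_def by (auto intro!: bexI[of _ "b - a"])
  qed
  have tau_eq: "\<tau> a = \<tau> b \<longleftrightarrow> a - b \<in> ?H" for a b
  proof
    assume "\<tau> a = \<tau> b"
    moreover have "a \<in> \<tau> a" by (simp add: in_tau tensor_rels_zero)
    ultimately show "a - b \<in> ?H" by (simp add: in_tau)
  next
    assume ab: "a - b \<in> ?H"
    have "c - a \<in> ?H \<longleftrightarrow> c - b \<in> ?H" for c
      using tensor_rels_add[OF _ ab, of "c - a"] tensor_rels_diff[OF _ ab, of "c - b"] by auto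
    then show "\<tau> a = \<tau> b" by (auto simp: in_tau set_eq_iff)
  qed
  have tau0: "\<tau> 0 = ?H" by (auto simp: in_tau set_eq_iff)
  have tau_add: "\<tau> a <#>\<^bsub>frags\<^esub> \<tau> b = \<tau> (a + b)" for a b
    unfolding \<tau>_def using normal.rcos_sum[OF nrm carr carr, of a b] by simp
  have act: "verma_act lam u (\<tau> a) = \<tau> (left_act u a)" for u a
  proof -
    have "\<tau> (left_act u b) = \<tau> (left_act u a)" if "b \<in> \<tau> a" for b
      using left_act_tensor_rels[of "b - a" lam u] that by (simp add: tau_eq in_tau left_act_diff)
    moreover have "a \<in> \<tau> a" by (simp add: in_tau tensor_rels_zero)
    ultimately have "(\<Union>b\<in>\<tau> a. \<tau> (left_act u b)) = \<tau> (left_act u a)" by blast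
    then show ?thesis unfolding verma_act_def tensor_map_def left_act_def[symmetric] \<tau>_def[symmetric] .
  qed
  have carrier: "carrier (verma lam) = range \<tau>"
    unfolding verma_def tensor_product_def FactGroup_def RCOSETS_def \<tau>_def by auto
  have one: "\<one>\<^bsub>verma lam\<^esub> = ?H" by (simp add: verma_def tensor_product_def FactGroup_def)
  have mult: "X \<otimes>\<^bsub>verma lam\<^esub> Y = X <#>\<^bsub>frags\<^esub> Y" for X Y
    by (simp add: verma_def tensor_product_def FactGroup_def)
  have reduce: "\<exists>x. \<tau> a = \<tau> (frag_of (x, 1))" for a
    using frag_reduce[of a lam] by (simp add: tau_eq)
  have ideal: "\<tau> (frag_of (x, 1)) = ?H \<longleftrightarrow> x \<in> verma_ideal lam" for x
    using tau_eq[of "frag_of (x, 1)" 0] unfolding tau0 by (simp add: verma_ideal_def)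
  show ?thesis unfolding irreducible_module_def
  proof (intro conjI allI impI)
    show "carrier (verma lam) \<noteq> {\<one>\<^bsub>verma lam\<^esub>}"
      using verma_ideal_proper[of lam] ideal[of 1] unfolding carrier one by auto
    fix S assume S: "subgroup S (verma lam) \<and> (\<forall>u. \<forall>x\<in>S. verma_act lam u x \<in> S)"
    define L where "L = {x. \<tau> (frag_of (x, 1)) \<in> S}"
    have HS: "?H \<in> S" using subgroup.one_closed[of S "verma lam"] S one by simp
    have L1: "verma_ideal lam \<subseteq> L"
    proof
      fix x assume "x \<in> verma_ideal lam"
      then have "\<tau> (frag_of (x, 1)) = ?H" using ideal by blast
      then show "x \<in> L" using HS by (simp add: L_def)
    qed
    have L2: "y + z \<in> L" if "y \<in> L" "z \<in> L" for y z
    proof -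
      have "\<tau> (frag_of (y, 1)) \<otimes>\<^bsub>verma lam\<^esub> \<tau> (frag_of (z, 1)) \<in> S"
        using subgroup.m_closed[of S "verma lam"] S that by (simp add: L_def)
      moreover have "\<tau> (frag_of (y + z, 1)) = \<tau> (frag_of (y, 1) + frag_of (z, 1))"
        unfolding tau_eq by (rule tensor_rels_left)
      ultimately show ?thesis unfolding L_def mult tau_add by simp
    qed
    have L3: "u * y \<in> L" if "y \<in> L" for u y
    proof -
      have "verma_act lam u (\<tau> (frag_of (y, 1))) \<in> S" using S that by (simp add: L_def)
      then show ?thesis by (simp add: L_def act left_act_frag_of)
    qed
    show "S = {\<one>\<^bsub>verma lam\<^esub>} \<or> S = carrier (verma lam)"
    proof (cases "L \<subseteq> verma_ideal lam")
      case True
      have "X = ?H" if "X \<in> S" for X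
      proof -
        have "X \<in> carrier (verma lam)" using that S subgroup.subset by blast
        then obtain a where "X = \<tau> a" using carrier by auto
        then obtain x where x: "X = \<tau> (frag_of (x, 1))" using reduce[of a] by auto
        then have "x \<in> L" using that by (simp add: L_def)
        then have "x \<in> verma_ideal lam" using True by blast
        then show ?thesis unfolding x ideal .
      qed
      then have "S = {?H}" using HS by blast
      then show ?thesis by (simp add: one)
    next
      case False
      then obtain x where "x \<in> L" "x \<notin> verma_ideal lam" by blast
      from max[OF L1 L2 L3 this] have one_L: "1 \<in> L" by blast
      have "\<tau> a \<in> S" for a
      proof -
        obtain x where "\<tau> a = \<tau> (frag_of (x, 1))" using reduce by blast
        then show ?thesis using L3[OF one_L, of x] by (simp add: L_def)
      qed
      then have "carrier (verma lam) \<subseteq> S" using carrier by auto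
      then show ?thesis using S subgroup.subset by blast
    qed
  qed
qed

section \<open>Filtration of the Verma modules\<close>

abbreviation U_plus :: "rtree \<Rightarrow> ie_lie uea" where "U_plus t \<equiv> uinc (D_plus t)"
abbreviation U_minus :: "rtree \<Rightarrow> ie_lie uea" where "U_minus t \<equiv> uinc (D_minus t)"
abbreviation U_d :: "ie_lie uea" where "U_d \<equiv> uinc d_elem"

lemma abs_ie_lie_sum: "abs_ie_lie (\<Sum>i\<in>I. x i) = (\<Sum>i\<in>I. abs_ie_lie (x i))"
  by (induction I rule: infinite_finite_induct) (simp_all add: zero_ie_lie.abs_eq plus_ie_lie.abs_eq[symmetric])

lemma abs_relator: "x - y \<in> ie_relators \<Longrightarrow> abs_ie_lie x = abs_ie_lie y"
  by (simp add: ie_lie.abs_eq_iff lie_ideal.base)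

lemmas ie_abs = plus_ie_lie.abs_eq[symmetric] minus_ie_lie.abs_eq[symmetric] abs_ie_lie_sum
  scaleC_ie_lie.abs_eq[symmetric] lie_ie_lie.abs_eq[symmetric]
  D_plus.abs_eq[symmetric] D_minus.abs_eq[symmetric] d_elem.abs_eq[symmetric]

lemma lie_plus_plus:
  "lie (D_plus a) (D_plus b) = (\<Sum>v\<in>vertices b. D_plus (join b v a)) - (\<Sum>v\<in>vertices a. D_plus (join a v b))"
proof -
  have "lie (fP a) (fP b) - ((\<Sum>v\<in>vertices b. fP (join b v a)) - (\<Sum>v\<in>vertices a. fP (join a v b))) \<in> ie_relators"
    unfolding ie_relators_def by blast
  from abs_relator[OF this] show ?thesis by (simp only: ie_abs)
qed

lemma lie_minus_plus:
  assumes "a \<noteq> b"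
  shows "lie (D_minus a) (D_plus b) = (\<Sum>t | alpha a b t \<noteq> 0. of_nat (alpha a b t) *\<^sub>C D_plus t)
         + (\<Sum>t | beta a b t \<noteq> 0. of_nat (beta a b t) *\<^sub>C D_minus t)"
proof -
  have "lie (fM a) (fP b) -
        ((\<Sum>t | alpha a b t \<noteq> 0. of_nat (alpha a b t) *\<^sub>C fP t)
         + (\<Sum>t | beta a b t \<noteq> 0. of_nat (beta a b t) *\<^sub>C fM t)) \<in> ie_relators"
    unfolding ie_relators_def using assms by blast
  from abs_relator[OF this] show ?thesis by (simp only: ie_abs)
qed

lemma lie_minus_plus_same: "lie (D_minus t) (D_plus t) = d_elem"
proof -
  have "lie (fM t) (fP t) - fD \<in> ie_relators" unfolding ie_relators_def by blast
  from abs_relator[OF this] show ?thesis by (simp only: ie_abs)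
qed

lemma lie_d_plus: "lie d_elem (D_plus t) = of_nat (tsize t) *\<^sub>C D_plus t"
proof -
  have "lie fD (fP t) - of_nat (tsize t) *\<^sub>C fP t \<in> ie_relators" unfolding ie_relators_def by blast
  from abs_relator[OF this] show ?thesis by (simp only: ie_abs)
qed

lemma uinc_sum: "uinc (\<Sum>i\<in>I. x i) = (\<Sum>i\<in>I. uinc (x i))"
proof -
  have "uinc 0 = 0" using uinc_scale[of 0 0] by (simp add: scaleC_zero_left)
  then show ?thesis by (induction I rule: infinite_finite_induct) (simp_all add: uinc_add)
qed

lemma uinc_commute: "uinc x * uinc y = uinc y * uinc x + uinc (lie x y)"
  by (simp add: uinc_lie)

primrec plus_word :: "rtree list \<Rightarrow> ie_lie uea" where
  "plus_word [] = 1"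
| "plus_word (t # ts) = U_plus t * plus_word ts"

definition weight :: "rtree list \<Rightarrow> int" where "weight T = (\<Sum>t\<leftarrow>T. int (tsize t))"

lemma weight_simps [simp]: "weight [] = 0" "weight (t # T) = int (tsize t) + weight T"
  "weight (T @ T') = weight T + weight T'"
  by (simp_all add: weight_def)

lemma weight_nonneg: "weight T \<ge> 0"
  by (induction T) auto

lemma weight_zero_iff: "weight T = 0 \<longleftrightarrow> T = []"
  using tsize_pos weight_nonneg by (cases T) (auto, smt (verit) of_nat_0_less_iff)

lemma weight_cong: "mset S = mset T \<Longrightarrow> weight S = weight T"
  unfolding weight_def by (metis mset_map sum_mset_sum_list)

text \<open>Families of elements of the enveloping algebra, one for each \<open>lam\<close>, which modulo the ideals
  \<open>verma_ideal lam\<close> are combinations of words of weight \<open>n\<close> with coefficients polynomial in \<open>lam\<close>.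
  Families are needed since the dependence on \<open>lam\<close> is what the determinants will be about. The order
  \<open>m\<close> counts a letter once and a factor \<open>lam\<close> twice: replacing \<open>D\<^sup>-\<^sub>t D\<^sup>+\<^sub>t\<close> by \<open>lam\<close> then has order one more
  than the letter \<open>D\<^sup>+\<^sub>t\<close>, while every other term of a commutator keeps or lowers the order.\<close>

inductive_set filtered :: "int \<Rightarrow> int \<Rightarrow> (complex \<Rightarrow> ie_lie uea) set" for n m where
  word: "weight T = n \<Longrightarrow> 2 * int j + int (length T) \<le> m \<Longrightarrow> (\<lambda>lam. lam ^ j *\<^sub>C plus_word T) \<in> filtered n m"
| ideal: "(\<And>lam. x lam \<in> verma_ideal lam) \<Longrightarrow> x \<in> filtered n m"
| add: "x \<in> filtered n m \<Longrightarrow> y \<in> filtered n m \<Longrightarrow> (\<lambda>lam. x lam + y lam) \<in> filtered n m"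
| scale: "x \<in> filtered n m \<Longrightarrow> (\<lambda>lam. c *\<^sub>C x lam) \<in> filtered n m"

lemma filtered_zero: "(\<lambda>lam. 0) \<in> filtered n m"
  by (rule filtered.ideal) (rule verma_ideal_zero)

lemma filtered_diff: "x \<in> filtered n m \<Longrightarrow> y \<in> filtered n m \<Longrightarrow> (\<lambda>lam. x lam - y lam) \<in> filtered n m"
  using filtered.add[OF _ filtered.scale[of y n m "- 1"], of x] by (simp add: scaleC_minus_one)

lemma filtered_sum: "(\<And>i. i \<in> I \<Longrightarrow> x i \<in> filtered n m) \<Longrightarrow> (\<lambda>lam. \<Sum>i\<in>I. x i lam) \<in> filtered n m"
  by (induction I rule: infinite_finite_induct) (simp_all add: filtered_zero filtered.add)

lemma filtered_mono: "x \<in> filtered n m \<Longrightarrow> m \<le> m' \<Longrightarrow> x \<in> filtered n m'"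
  by (induction rule: filtered.induct) (auto intro: filtered.intros)

lemma filtered_plus_word: "weight T = n \<Longrightarrow> int (length T) \<le> m \<Longrightarrow> (\<lambda>lam. plus_word T) \<in> filtered n m"
  using filtered.word[of T n 0 m] by (simp add: scaleC_one)

lemma scaleC_mult: "c *\<^sub>C x = (c *\<^sub>C 1) * (x :: 'a::calgebra)"
  by (simp add: scaleC_mult_left)

lemma verma_ideal_scale: "x \<in> verma_ideal lam \<Longrightarrow> c *\<^sub>C x \<in> verma_ideal lam"
  by (subst scaleC_mult) (rule verma_ideal_mult)

lemma verma_ideal_diff: "x \<in> verma_ideal lam \<Longrightarrow> y \<in> verma_ideal lam \<Longrightarrow> x - y \<in> verma_ideal lam"
  using verma_ideal_add[OF _ verma_ideal_scale[of y lam "- 1"], of x] by (simp add: scaleC_minus_one)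

lemma filtered_lam_power: "x \<in> filtered n m \<Longrightarrow> (\<lambda>lam. lam ^ j *\<^sub>C x lam) \<in> filtered n (m + 2 * int j)"
proof (induction rule: filtered.induct)
  case (word T i)
  then have "(\<lambda>lam. lam ^ (j + i) *\<^sub>C plus_word T) \<in> filtered n (m + 2 * int j)" by (intro filtered.word) auto
  then show ?case by (simp add: scaleC_scaleC power_add)
next
  case (ideal x)
  then show ?case by (intro filtered.ideal verma_ideal_scale)
next
  case (add x y)
  from filtered.add[OF add.IH] show ?case by (simp add: scaleC_add_right)
next
  case (scale x c)
  from filtered.scale[OF scale.IH, of c] show ?case by (simp add: scaleC_scaleC mult.commute)
qed

lemma filtered_lam: "x \<in> filtered n m \<Longrightarrow> (\<lambda>lam. lam *\<^sub>C x lam) \<in> filtered n (m + 2)"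
  using filtered_lam_power[of x n m 1] by simp

text \<open>A bound for words extends to all families, since the ideals are left ideals and powers of \<open>lam\<close>
  shift the order uniformly.\<close>

lemma filtered_left_mult:
  assumes "\<And>T. weight T = n \<Longrightarrow> (\<lambda>lam. u * plus_word T) \<in> filtered n' (int (length T) + k)" and "x \<in> filtered n m"
  shows "(\<lambda>lam. u * x lam) \<in> filtered n' (m + k)"
  using assms(2)
proof (induction rule: filtered.induct)
  case (word T j)
  from filtered_lam_power[OF assms(1)[OF word(1)], of j] word(2)
  show ?case by (simp add: scaleC_mult_right) (erule filtered_mono, simp)
next
  case (ideal x)
  then show ?case by (intro filtered.ideal verma_ideal_mult)
next
  case (add x y)
  from filtered.add[OF add.IH] show ?case by (simp add: distrib_left)
next
  case (scale x c)
  from filtered.scale[OF scale.IH, of c] show ?case by (simp add: scaleC_mult_right)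
qed

lemma filtered_plus: "x \<in> filtered n m \<Longrightarrow> (\<lambda>lam. U_plus t * x lam) \<in> filtered (int (tsize t) + n) (m + 1)"
proof (rule filtered_left_mult)
  fix T assume "weight T = n"
  then show "(\<lambda>lam. U_plus t * plus_word T) \<in> filtered (int (tsize t) + n) (int (length T) + 1)"
    using filtered_plus_word[of "t # T"] by simp
qed

lemma d_plus_word: "U_d * plus_word T = of_int (weight T) *\<^sub>C plus_word T + plus_word T * U_d"
proof (induction T)
  case (Cons t T)
  have "U_d * (U_plus t * plus_word T) = U_plus t * (U_d * plus_word T) + of_nat (tsize t) *\<^sub>C (U_plus t * plus_word T)"
    using uinc_commute[of d_elem "D_plus t"]
    by (simp add: mult.assoc[symmetric] distrib_right lie_d_plus uinc_scale scaleC_mult_left)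
  then show ?case unfolding Cons.IH
    by (simp add: distrib_left scaleC_mult_right scaleC_add_left mult.assoc algebra_simps)
qed (simp add: scaleC_zero_left)

lemma verma_ideal_d_word: "U_d * plus_word T - (lam + of_int (weight T)) *\<^sub>C plus_word T \<in> verma_ideal lam"
proof -
  have "U_d * plus_word T - (lam + of_int (weight T)) *\<^sub>C plus_word T = plus_word T * (U_d - lam *\<^sub>C 1)"
    unfolding d_plus_word by (simp add: right_diff_distrib scaleC_mult_right scaleC_add_left)
  then show ?thesis using verma_ideal_mult[OF verma_ideal_d] by simp
qed

lemma filtered_d_word:
  "(\<lambda>lam. U_d * plus_word T - lam *\<^sub>C plus_word T) \<in> filtered (weight T) (int (length T))"
proof -
  have "(\<lambda>lam. (U_d * plus_word T - (lam + of_int (weight T)) *\<^sub>C plus_word T) + of_int (weight T) *\<^sub>C plus_word T)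
      \<in> filtered (weight T) (int (length T))"
    by (intro filtered.add filtered.ideal filtered.scale verma_ideal_d_word filtered_plus_word) auto
  then show ?thesis by (simp add: scaleC_add_left)
qed

lemma minus_plus_word: "U_minus s * plus_word (t # T)
    = U_plus t * (U_minus s * plus_word T) + uinc (lie (D_minus s) (D_plus t)) * plus_word T"
  using uinc_commute[of "D_minus s" "D_plus t"] by (simp add: mult.assoc[symmetric] distrib_right)

text \<open>The terms with \<open>alpha\<close> replace one letter by another, those with \<open>beta\<close> use up a letter and
  leave a smaller \<open>D\<^sup>-\<^sub>u\<close>. The bound for \<open>D\<^sup>-\<^sub>u\<close> is an assumption because it is an induction
  hypothesis at the first use.\<close>

lemma filtered_bracket_word:
  assumes "s \<noteq> t"
    and minus: "\<And>u. (\<lambda>lam. U_minus u * plus_word T) \<in> filtered (weight T - int (tsize u)) (int (length T) + 1)"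
  shows "(\<lambda>lam. uinc (lie (D_minus s) (D_plus t)) * plus_word T)
     \<in> filtered (weight (t # T) - int (tsize s)) (int (length T) + 1)" (is "_ \<in> filtered ?n ?m")
proof -
  have "(\<lambda>lam. (\<Sum>u | alpha s t u \<noteq> 0. of_nat (alpha s t u) *\<^sub>C (U_plus u * plus_word T))
     + (\<Sum>u | beta s t u \<noteq> 0. of_nat (beta s t u) *\<^sub>C (U_minus u * plus_word T))) \<in> filtered ?n ?m"
  proof (intro filtered.add filtered_sum filtered.scale)
    fix u assume "u \<in> {u. alpha s t u \<noteq> 0}"
    then have "tsize t = tsize u + tsize s" by (simp add: alpha_def cuts_tsize)
    then show "(\<lambda>lam. U_plus u * plus_word T) \<in> filtered ?n ?m"
      using filtered_plus_word[of "u # T" ?n] by simp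
  next
    fix u assume "u \<in> {u. beta s t u \<noteq> 0}"
    then have "tsize s = tsize u + tsize t" by (simp add: beta_def joins_tsize)
    then show "(\<lambda>lam. U_minus u * plus_word T) \<in> filtered ?n ?m" using minus[of u] by simp
  qed
  then show ?thesis
    by (simp add: lie_minus_plus[OF assms(1)] uinc_add uinc_sum uinc_scale distrib_right sum_distrib_right scaleC_mult_left)
qed

lemma filtered_minus_word:
  "(\<lambda>lam. U_minus s * plus_word T) \<in> filtered (weight T - int (tsize s)) (int (length T) + 1)"
proof (induction T arbitrary: s)
  case Nil
  then show ?case by (intro filtered.ideal) (simp add: verma_ideal_D_minus)
next
  case (Cons t T)
  let ?n = "weight (t # T) - int (tsize s)"
  have "(\<lambda>lam. U_plus t * (U_minus s * plus_word T)) \<in> filtered ?n (int (length T) + 2)"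
    using filtered_plus[OF Cons.IH[of s], of t] by (simp add: algebra_simps)
  moreover have "(\<lambda>lam. uinc (lie (D_minus s) (D_plus t)) * plus_word T) \<in> filtered ?n (int (length T) + 2)"
  proof (cases "s = t")
    case True
    have "(\<lambda>lam. (U_d * plus_word T - lam *\<^sub>C plus_word T) + lam *\<^sub>C plus_word T) \<in> filtered (weight T) (int (length T) + 2)"
      by (intro filtered.add filtered_lam filtered_plus_word filtered_mono[OF filtered_d_word]) auto
    then show ?thesis by (simp add: True lie_minus_plus_same)
  next
    case False
    show ?thesis by (rule filtered_mono[OF filtered_bracket_word[OF False Cons.IH]]) simp
  qed
  moreover have e: "int (length (t # T)) + 1 = int (length T) + 2" by simp
  ultimately show ?case unfolding minus_plus_word e by (intro filtered.add)
qed

lemma filtered_minus: "x \<in> filtered n m \<Longrightarrow> (\<lambda>lam. U_minus s * x lam) \<in> filtered (n - int (tsize s)) (m + 1)"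
  by (rule filtered_left_mult) (use filtered_minus_word in auto)

lemma filtered_swap:
  "(\<lambda>lam. plus_word (xs @ a # ys) - plus_word (a # xs @ ys)) \<in> filtered (weight (a # xs @ ys)) (int (length (xs @ ys)))"
proof (induction xs)
  case Nil
  then show ?case by (simp add: filtered_zero)
next
  case (Cons x xs)
  let ?n = "weight (a # (x # xs) @ ys)" and ?m = "int (length ((x # xs) @ ys))"
  have eq: "plus_word ((x # xs) @ a # ys) - plus_word (a # (x # xs) @ ys)
     = U_plus x * (plus_word (xs @ a # ys) - plus_word (a # xs @ ys)) + uinc (lie (D_plus x) (D_plus a)) * plus_word (xs @ ys)"
  proof -
    have "U_plus x * (U_plus a * plus_word (xs @ ys))
        = U_plus a * (U_plus x * plus_word (xs @ ys)) + uinc (lie (D_plus x) (D_plus a)) * plus_word (xs @ ys)"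
      using uinc_commute[of "D_plus x" "D_plus a"] by (simp add: mult.assoc[symmetric] distrib_right)
    then show ?thesis by (simp add: right_diff_distrib)
  qed
  have "(\<lambda>lam. U_plus x * (plus_word (xs @ a # ys) - plus_word (a # xs @ ys))) \<in> filtered ?n ?m"
    using filtered_plus[OF Cons.IH, of x] by (simp add: algebra_simps)
  moreover have "(\<lambda>lam. uinc (lie (D_plus x) (D_plus a)) * plus_word (xs @ ys)) \<in> filtered ?n ?m"
  proof -
    have "(\<lambda>lam. (\<Sum>v\<in>vertices a. U_plus (join a v x) * plus_word (xs @ ys)) - (\<Sum>v\<in>vertices x. U_plus (join x v a) * plus_word (xs @ ys)))
      \<in> filtered ?n ?m"
    proof (intro filtered_diff filtered_sum)
      fix v assume "v \<in> vertices a"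
      then show "(\<lambda>lam. U_plus (join a v x) * plus_word (xs @ ys)) \<in> filtered ?n ?m"
        using filtered_plus_word[of "join a v x # xs @ ys" ?n ?m] by (simp add: tsize_join)
    next
      fix v assume "v \<in> vertices x"
      then show "(\<lambda>lam. U_plus (join x v a) * plus_word (xs @ ys)) \<in> filtered ?n ?m"
        using filtered_plus_word[of "join x v a # xs @ ys" ?n ?m] by (simp add: tsize_join)
    qed
    moreover have "uinc (x - y) = uinc x - uinc y" for x y :: ie_lie
      using uinc_add[of "x - y" y] by simp
    ultimately show ?thesis by (simp add: lie_plus_plus uinc_sum left_diff_distrib sum_distrib_right)
  qed
  ultimately show ?case unfolding eq by (rule filtered.add)
qed

text \<open>The commutator of two letters \<open>D\<^sup>+\<close> is a combination of single letters, so permuting the letters changes a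
  word only by shorter ones.\<close>

lemma filtered_permute:
  assumes "mset S = mset T"
  shows "(\<lambda>lam. plus_word S - plus_word T) \<in> filtered (weight T) (int (length T) - 1)"
  using assms
proof (induction S arbitrary: T)
  case Nil
  then show ?case by (simp add: filtered_zero)
next
  case (Cons a S)
  then have "a \<in> set T" by (metis list.set_intros(1) set_mset_mset)
  then obtain xs ys where T: "T = xs @ a # ys" by (meson split_list)
  have m: "mset S = mset (xs @ ys)" using Cons.prems by (simp add: T)
  have w: "weight T = int (tsize a) + weight (xs @ ys)" by (simp add: T)
  have "(\<lambda>lam. U_plus a * (plus_word S - plus_word (xs @ ys))) \<in> filtered (weight T) (int (length T) - 1)"
    using filtered_plus[OF Cons.IH[OF m], of a] by (simp add: w) (simp add: T)
  moreover have "(\<lambda>lam. plus_word T - plus_word (a # xs @ ys)) \<in> filtered (weight T) (int (length T) - 1)"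
    using filtered_swap[of xs a ys] by (simp add: T algebra_simps)
  ultimately have "(\<lambda>lam. U_plus a * (plus_word S - plus_word (xs @ ys)) - (plus_word T - plus_word (a # xs @ ys)))
     \<in> filtered (weight T) (int (length T) - 1)" by (rule filtered_diff)
  then show ?case by (simp add: right_diff_distrib)
qed

text \<open>To leading order \<open>D\<^sup>-\<^sub>s\<close> acts on words as \<open>lam\<close> times the derivative with respect to the letter \<open>s\<close>.\<close>

lemma filtered_minus_lead:
  "(\<lambda>lam. U_minus s * plus_word T - (of_nat (count (mset T) s) * lam) *\<^sub>C plus_word (remove1 s T))
     \<in> filtered (weight T - int (tsize s)) (int (length T))"
proof (induction T)
  case Nil
  show ?case by (rule filtered.ideal) (simp add: scaleC_zero_left verma_ideal_D_minus)
next
  case (Cons t T)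
  let ?c = "of_nat (count (mset T) s) :: complex"
  let ?n = "weight (t # T) - int (tsize s)" and ?m = "int (length (t # T))"
  have IH: "(\<lambda>lam. U_plus t * (U_minus s * plus_word T) - (?c * lam) *\<^sub>C plus_word (t # remove1 s T)) \<in> filtered ?n ?m"
    using filtered_plus[OF Cons.IH, of t] by (simp add: algebra_simps scaleC_mult_right)
  show ?case
  proof (cases "s = t")
    case True
    have d: "(\<lambda>lam. U_d * plus_word T - lam *\<^sub>C plus_word T) \<in> filtered ?n ?m"
      using filtered_mono[OF filtered_d_word, of T ?m] by (simp add: True)
    have p: "(\<lambda>lam. (?c * lam) *\<^sub>C (plus_word (s # remove1 s T) - plus_word T)) \<in> filtered ?n ?m"
    proof (cases "s \<in> set T")
      case True
      then have "mset (s # remove1 s T) = mset T" by simp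
      from filtered_mono[OF filtered.scale[OF filtered_lam[OF filtered_permute[OF this]], of ?c], of ?m]
      show ?thesis by (simp add: scaleC_scaleC \<open>s = t\<close>)
    next
      case False
      then have c0: "?c = 0" by (simp add: count_mset_0_iff)
      show ?thesis unfolding c0 by (simp add: scaleC_zero_left filtered_zero)
    qed
    have "(\<lambda>lam. (U_plus t * (U_minus s * plus_word T) - (?c * lam) *\<^sub>C plus_word (t # remove1 s T))
       + (U_d * plus_word T - lam *\<^sub>C plus_word T)
       + (?c * lam) *\<^sub>C (plus_word (s # remove1 s T) - plus_word T)) \<in> filtered ?n ?m"
      by (rule filtered.add[OF filtered.add[OF IH d] p])
    moreover have "(U_plus t * (U_minus s * plus_word T) - (?c * lam) *\<^sub>C plus_word (t # remove1 s T))
       + (U_d * plus_word T - lam *\<^sub>C plus_word T)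
       + (?c * lam) *\<^sub>C (plus_word (s # remove1 s T) - plus_word T)
      = U_minus s * plus_word (t # T) - (of_nat (count (mset (t # T)) s) * lam) *\<^sub>C plus_word (remove1 s (t # T))" for lam
      unfolding minus_plus_word by (simp add: True lie_minus_plus_same scaleC_diff_right distrib_right scaleC_add_left algebra_simps)
    ultimately show ?thesis by simp
  next
    case False
    have "(\<lambda>lam. uinc (lie (D_minus s) (D_plus t)) * plus_word T) \<in> filtered ?n ?m"
      by (rule filtered_mono[OF filtered_bracket_word[OF False filtered_minus_word]]) simp
    from filtered.add[OF IH this] show ?thesis unfolding minus_plus_word using False
      by (simp add: algebra_simps)
  qed
qed

primrec minus_word :: "rtree list \<Rightarrow> ie_lie uea" where
  "minus_word [] = 1"
| "minus_word (s # S) = minus_word S * U_minus s"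

lemma filtered_minus_words: "x \<in> filtered n m \<Longrightarrow> (\<lambda>lam. minus_word S * x lam) \<in> filtered (n - weight S) (m + int (length S))"
proof (induction S arbitrary: x n m)
  case (Cons s S)
  from Cons.IH[OF filtered_minus[OF Cons.prems, of s]] show ?case by (simp add: mult.assoc algebra_simps)
qed simp

text \<open>Applying the letters of \<open>S\<close> one after another, the leading term survives only while the letter occurs in
  what is left of \<open>T\<close>. The weights being equal, it reaches the empty word exactly if \<open>S\<close> and \<open>T\<close>
  agree as multisets; the constant is a product of multiplicities. When both words are of length \<open>k\<close>,
  the leading term \<open>lam\<^sup>k\<close> has order \<open>2 k\<close>, just above the error.\<close>

lemma pairing_lead:
  assumes "weight S = weight T"
  shows "(mset S = mset T \<longrightarrow> (\<exists>c. c \<noteq> 0 \<and>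
      (\<lambda>lam. minus_word S * plus_word T - (c * lam ^ length S) *\<^sub>C 1) \<in> filtered 0 (2 * int (length S) - 1)))
    \<and> (mset S \<noteq> mset T \<longrightarrow>
      (\<lambda>lam. minus_word S * plus_word T) \<in> filtered 0 (int (length S) + int (length T) - 1))"
  using assms
proof (induction S arbitrary: T)
  case Nil
  then have "T = []" by (simp add: weight_zero_iff[symmetric])
  then show ?case by (auto intro!: exI[of _ 1] simp: scaleC_one filtered_zero)
next
  case (Cons s S)
  let ?c = "of_nat (count (mset T) s) :: complex" and ?T = "remove1 s T"
  let ?m = "int (length (s # S)) + int (length T) - 1"
  have A: "(\<lambda>lam. minus_word S * (U_minus s * plus_word T - (?c * lam) *\<^sub>C plus_word ?T)) \<in> filtered 0 ?m"
    using filtered_minus_words[OF filtered_minus_lead[of s T], of S] Cons.prems by (simp add: algebra_simps)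
  show ?case
  proof (cases "s \<in> set T")
    case True
    then have T: "mset T = mset (s # ?T)" by simp
    then have iff: "mset (s # S) = mset T \<longleftrightarrow> mset S = mset ?T" by (simp del: mset_remove1)
    have w: "weight S = weight ?T" using weight_cong[OF T] Cons.prems by simp
    have len: "length T = Suc (length ?T)" using arg_cong[OF T, of size] by (simp del: mset_remove1)
    show ?thesis
    proof (cases "mset S = mset ?T")
      case eq: True
      have lenS: "length ?T = length S" using arg_cong[OF eq, of size] by (simp del: mset_remove1)
      obtain c where c: "c \<noteq> 0"
        "(\<lambda>lam. minus_word S * plus_word ?T - (c * lam ^ length S) *\<^sub>C 1) \<in> filtered 0 (2 * int (length S) - 1)"
        using Cons.IH[OF w] eq by blast
      have E1: "(\<lambda>lam. minus_word S * (U_minus s * plus_word T - (?c * lam) *\<^sub>C plus_word ?T)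
          + ?c *\<^sub>C (lam *\<^sub>C (minus_word S * plus_word ?T - (c * lam ^ length S) *\<^sub>C 1)))
         \<in> filtered 0 (2 * int (length (s # S)) - 1)"
        by (intro filtered.add filtered.scale filtered_mono[OF A] filtered_mono[OF filtered_lam[OF c(2)]]) (simp_all add: len lenS)
      have E2: "minus_word S * (U_minus s * plus_word T - (?c * lam) *\<^sub>C plus_word ?T)
          + ?c *\<^sub>C (lam *\<^sub>C (minus_word S * plus_word ?T - (c * lam ^ length S) *\<^sub>C 1))
        = minus_word (s # S) * plus_word T - (?c * c * lam ^ length (s # S)) *\<^sub>C 1" for lam
        by (simp add: right_diff_distrib scaleC_mult_right scaleC_diff_right scaleC_scaleC mult.assoc mult.left_commute[of lam c])
      have "?c * c \<noteq> 0" using c(1) True by simp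
      then show ?thesis unfolding iff using eq E1[unfolded E2] by blast
    next
      case False
      then have IH: "(\<lambda>lam. minus_word S * plus_word ?T) \<in> filtered 0 (int (length S) + int (length ?T) - 1)"
        using Cons.IH[OF w] by blast
      have "(\<lambda>lam. minus_word S * (U_minus s * plus_word T - (?c * lam) *\<^sub>C plus_word ?T)
        + ?c *\<^sub>C (lam *\<^sub>C (minus_word S * plus_word ?T))) \<in> filtered 0 ?m"
        by (intro filtered.add filtered.scale A filtered_mono[OF filtered_lam[OF IH]]) (simp add: len)
      moreover have "minus_word S * (U_minus s * plus_word T - (?c * lam) *\<^sub>C plus_word ?T)
        + ?c *\<^sub>C (lam *\<^sub>C (minus_word S * plus_word ?T)) = minus_word (s # S) * plus_word T" for lam
        by (simp add: right_diff_distrib scaleC_mult_right scaleC_scaleC mult.assoc)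
      ultimately show ?thesis unfolding iff using False by simp
    qed
  next
    case False
    then have c0: "?c = 0" by (simp add: count_mset_0_iff)
    have ne: "mset (s # S) \<noteq> mset T" using False by (metis list.set_intros(1) set_mset_mset)
    show ?thesis using A ne unfolding c0 by (simp add: scaleC_zero_left mult.assoc)
  qed
qed

section \<open>Polynomial matrices with a dominant diagonal\<close>

text \<open>Half the bound is allowed as degree, so that rows and columns of a matrix can each contribute
  \<open>k i\<close> and \<open>k j\<close> to the bound \<open>k i + k j\<close> for the entries.\<close>

definition half_deg :: "nat \<Rightarrow> complex poly \<Rightarrow> bool" where
  "half_deg w p \<longleftrightarrow> (\<forall>d. coeff p d \<noteq> 0 \<longrightarrow> 2 * d \<le> w)"

lemma coeff_mult_nonzero:
  assumes "coeff (p * q :: complex poly) d \<noteq> 0"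
  obtains i j where "i + j = d" "coeff p i \<noteq> 0" "coeff q j \<noteq> 0"
proof -
  have "(\<Sum>i\<le>d. coeff p i * coeff q (d - i)) \<noteq> 0" using assms by (simp add: coeff_mult)
  then obtain i where "i \<le> d" "coeff p i * coeff q (d - i) \<noteq> 0"
    by (metis (mono_tags, lifting) atMost_iff sum.neutral)
  then show thesis using that[of i "d - i"] by auto
qed

lemma half_deg_prod:
  assumes "finite A" "\<And>a. a \<in> A \<Longrightarrow> half_deg (w a) (f a)"
  shows "half_deg (\<Sum>a\<in>A. w a) (\<Prod>a\<in>A. f a)"
  using assms
proof (induction A rule: finite_induct)
  case empty
  then show ?case by (auto simp: half_deg_def coeff_1 split: if_splits)
next
  case (insert a A)
  show ?case unfolding half_deg_def
  proof (intro allI impI)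
    fix d assume "coeff (\<Prod>a\<in>insert a A. f a) d \<noteq> 0"
    then have "coeff (f a * (\<Prod>a\<in>A. f a)) d \<noteq> 0" using insert by simp
    then obtain i j where "i + j = d" "coeff (f a) i \<noteq> 0" "coeff (\<Prod>a\<in>A. f a) j \<noteq> 0" by (rule coeff_mult_nonzero)
    then show "2 * d \<le> (\<Sum>a\<in>insert a A. w a)"
      using insert unfolding half_deg_def by (fastforce simp: algebra_simps)
  qed
qed

lemma coeff_mult_top:
  assumes "half_deg (2 * m) p" "half_deg (2 * n) q"
  shows "coeff (p * q) (m + n) = coeff p m * coeff q n"
proof -
  have z: "coeff p i * coeff q (m + n - i) = 0" if "i \<noteq> m" "i \<le> m + n" for i
  proof (rule ccontr)
    assume "\<not> ?thesis"
    then have "2 * i \<le> 2 * m" "2 * (m + n - i) \<le> 2 * n" using assms unfolding half_deg_def by auto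
    then show False using that by simp
  qed
  have "coeff (p * q) (m + n) = (\<Sum>i\<le>m + n. if i = m then coeff p m * coeff q n else 0)"
    unfolding coeff_mult by (rule sum.cong) (use z in auto)
  then show ?thesis by simp
qed

lemma coeff_prod_top:
  assumes "finite A" "\<And>a. a \<in> A \<Longrightarrow> half_deg (2 * k a) (f a)"
  shows "coeff (\<Prod>a\<in>A. f a) (\<Sum>a\<in>A. k a) = (\<Prod>a\<in>A. coeff (f a) (k a))"
  using assms
proof (induction A rule: finite_induct)
  case (insert a A)
  have "half_deg (2 * (\<Sum>a\<in>A. k a)) (\<Prod>a\<in>A. f a)"
    using half_deg_prod[of A "\<lambda>a. 2 * k a" f] insert by (simp add: sum_distrib_left)
  then show ?case using insert coeff_mult_top[of "k a" "f a"] by simp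
qed simp

text \<open>In the Leibniz expansion every product has degree at most \<open>\<Sum>i. k i\<close>, and only the identity permutation
  reaches it: any other one picks an entry off the diagonal, whose degree is strictly below its bound.\<close>

lemma poly_matrix_det_nonzero:
  fixes A :: "complex poly mat" and k :: "nat \<Rightarrow> nat"
  assumes A: "A \<in> carrier_mat n n"
    and deg: "\<And>i j. i < n \<Longrightarrow> j < n \<Longrightarrow> half_deg (k i + k j) (A $$ (i, j))"
    and diag: "\<And>i. i < n \<Longrightarrow> coeff (A $$ (i, i)) (k i) \<noteq> 0"
    and off: "\<And>i j d. i < n \<Longrightarrow> j < n \<Longrightarrow> i \<noteq> j \<Longrightarrow> 2 * d = k i + k j \<Longrightarrow> coeff (A $$ (i, j)) d = 0"
  shows "det A \<noteq> 0"
proof -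
  let ?K = "\<Sum>i = 0..<n. k i"
  let ?f = "\<lambda>p. \<Prod>i = 0..<n. A $$ (i, p i)"
  let ?S = "{p. p permutes {0..<n}}"
  have fin: "finite ?S" by (simp add: finite_permutations)
  have c: "coeff (signof p * q) d = signof p * coeff q d" for p :: "nat \<Rightarrow> nat" and q :: "complex poly" and d
    by (simp add: sign_def)
  have zero: "coeff (?f p) ?K = 0" if p: "p permutes {0..<n}" "p \<noteq> id" for p
  proof (rule ccontr)
    assume nz: "coeff (?f p) ?K \<noteq> 0"
    obtain i where i: "p i \<noteq> i" using p(2) by (auto simp: fun_eq_iff)
    then have i_n: "i \<in> {0..<n}" using p(1) by (meson permutes_not_in)
    have pn: "p j < n" if "j < n" for j using permutes_in_image[OF p(1), of j] that by simp
    have "?f p = A $$ (i, p i) * (\<Prod>j\<in>{0..<n} - {i}. A $$ (j, p j))"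
      using i_n by (simp add: prod.remove)
    then have "coeff (A $$ (i, p i) * (\<Prod>j\<in>{0..<n} - {i}. A $$ (j, p j))) ?K \<noteq> 0" using nz by simp
    then obtain a b where ab: "a + b = ?K" "coeff (A $$ (i, p i)) a \<noteq> 0"
      "coeff (\<Prod>j\<in>{0..<n} - {i}. A $$ (j, p j)) b \<noteq> 0"
      by (rule coeff_mult_nonzero)
    have "2 * a \<le> k i + k (p i)" using deg[of i "p i"] ab(2) i_n pn by (auto simp: half_deg_def)
    moreover have "2 * a \<noteq> k i + k (p i)" using off[of i "p i" a] ab(2) i_n pn i by auto
    moreover have "half_deg (\<Sum>j\<in>{0..<n} - {i}. k j + k (p j)) (\<Prod>j\<in>{0..<n} - {i}. A $$ (j, p j))"
      using deg pn by (intro half_deg_prod) auto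
    then have "2 * b \<le> (\<Sum>j\<in>{0..<n} - {i}. k j + k (p j))" using ab(3) by (auto simp: half_deg_def)
    moreover have "k i + k (p i) + (\<Sum>j\<in>{0..<n} - {i}. k j + k (p j)) = (\<Sum>j = 0..<n. k j + k (p j))"
      using i_n by (simp add: sum.remove)
    moreover have "(\<Sum>j = 0..<n. k j + k (p j)) = 2 * ?K"
    proof -
      have "(\<Sum>j = 0..<n. k (p j)) = ?K"
        using sum.permute[OF p(1), of k] by (simp add: comp_def)
      then show ?thesis by (simp add: sum.distrib)
    qed
    ultimately show False using ab(1) by linarith
  qed
  have id: "id \<in> ?S" by (simp add: permutes_id)
  have "coeff (det A) ?K = (\<Sum>p\<in>?S. signof p * coeff (?f p) ?K)"
    unfolding det_def'[OF A] coeff_sum c ..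
  also have "\<dots> = signof id * coeff (?f id) ?K + (\<Sum>p\<in>?S - {id}. signof p * coeff (?f p) ?K)"
    by (rule sum.remove[OF fin id])
  also have "(\<Sum>p\<in>?S - {id}. signof p * coeff (?f p) ?K) = 0"
    using zero by (intro sum.neutral) auto
  also have "coeff (?f id) ?K = (\<Prod>i = 0..<n. coeff (A $$ (i, i)) (k i))"
    unfolding id_apply by (rule coeff_prod_top) (use deg in \<open>auto simp: mult_2\<close>)
  also have "signof (id :: nat \<Rightarrow> nat) * (\<Prod>i = 0..<n. coeff (A $$ (i, i)) (k i)) + 0 \<noteq> (0 :: complex)"
    using diag by (simp add: sign_def)
  finally show ?thesis by auto
qed

lemma poly_matrix_kernel:
  fixes M :: "'i \<Rightarrow> 'i \<Rightarrow> complex poly" and k :: "'i \<Rightarrow> nat"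
  assumes I: "finite I"
    and deg: "\<And>i j. i \<in> I \<Longrightarrow> j \<in> I \<Longrightarrow> half_deg (k i + k j) (M i j)"
    and diag: "\<And>i. i \<in> I \<Longrightarrow> coeff (M i i) (k i) \<noteq> 0"
    and off: "\<And>i j d. i \<in> I \<Longrightarrow> j \<in> I \<Longrightarrow> i \<noteq> j \<Longrightarrow> 2 * d = k i + k j \<Longrightarrow> coeff (M i j) d = 0"
  shows "finite {z. \<exists>c. (\<exists>i\<in>I. c i \<noteq> 0) \<and> (\<forall>i\<in>I. (\<Sum>j\<in>I. poly (M i j) z * c j) = 0)}"
proof -
  obtain e :: "nat \<Rightarrow> 'i" and n where e: "bij_betw e {0..<n} I"
    using ex_bij_betw_nat_finite[OF I] by metis
  have eI: "e a \<in> I" if "a < n" for a using e that by (auto simp: bij_betw_def)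
  have einj: "e a = e b \<longleftrightarrow> a = b" if "a < n" "b < n" for a b
    using e that by (auto simp: bij_betw_def inj_on_def)
  define A where "A = mat n n (\<lambda>(a, b). M (e a) (e b))"
  have A: "A \<in> carrier_mat n n" by (simp add: A_def)
  have "det A \<noteq> 0"
    by (rule poly_matrix_det_nonzero[OF A, of "k \<circ> e"])
      (use deg diag off eI einj in \<open>auto simp: A_def\<close>)
  then have fin: "finite {z. poly (det A) z = 0}" by (rule poly_roots_finite)
  have "poly (det A) z = 0"
    if c: "\<exists>i\<in>I. c i \<noteq> 0" "\<forall>i\<in>I. (\<Sum>j\<in>I. poly (M i j) z * c j) = 0" for c z
  proof -
    interpret hom: comm_ring_hom "\<lambda>p. poly p z" by standard auto
    let ?A = "map_mat (\<lambda>p. poly p z) A" and ?v = "vec n (\<lambda>a. c (e a))"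
    have "?v \<noteq> 0\<^sub>v n"
    proof
      assume v: "?v = 0\<^sub>v n"
      obtain i where "i \<in> I" "c i \<noteq> 0" using c(1) by blast
      then obtain a where "a < n" "e a = i" using e by (auto simp: bij_betw_def)
      then have "?v $ a \<noteq> 0" using \<open>c i \<noteq> 0\<close> by simp
      then show False using v \<open>a < n\<close> by simp
    qed
    moreover have "?A *\<^sub>v ?v = 0\<^sub>v n"
    proof (rule eq_vecI)
      fix a assume "a < dim_vec (0\<^sub>v n :: complex vec)"
      then have a: "a < n" by simp
      have "(?A *\<^sub>v ?v) $ a = (\<Sum>b = 0..<n. poly (M (e a) (e b)) z * c (e b))"
        using a by (simp add: A_def scalar_prod_def)
      also have "\<dots> = (\<Sum>j\<in>I. poly (M (e a) j) z * c j)"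
        by (rule sum.reindex_bij_betw[OF e])
      finally show "(?A *\<^sub>v ?v) $ a = 0\<^sub>v n $ a" using c(2) eI[OF a] a by simp
    qed (simp add: A_def)
    moreover have "?A \<in> carrier_mat n n" using A by simp
    moreover have "?v \<in> carrier_vec n" by simp
    ultimately have "det ?A = 0" using det_0_iff_vec_prod_zero_field[of ?A n] by blast
    then show ?thesis by (simp add: hom.hom_det)
  qed
  then show ?thesis by (intro finite_subset[OF _ fin]) blast
qed

section \<open>The pairing of words of equal weight\<close>

text \<open>All trees are nonempty, so the empty word is the only word of weight 0.\<close>

lemma poly_of_weight_zero:
  assumes "x \<in> filtered 0 m"
  shows "\<exists>q. (\<forall>i. coeff q i \<noteq> 0 \<longrightarrow> 2 * int i \<le> m) \<and> (\<forall>lam. x lam - poly q lam *\<^sub>C 1 \<in> verma_ideal lam)"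
  using assms
proof (induction rule: filtered.induct)
  case (word T j)
  then have "T = []" by (simp add: weight_zero_iff)
  then show ?case using word
    by (intro exI[of _ "monom 1 j"]) (auto simp: poly_monom verma_ideal_zero split: if_splits)
next
  case (ideal x)
  then show ?case by (intro exI[of _ 0]) (simp add: scaleC_zero_left)
next
  case (add x y)
  then obtain p q where pq: "\<forall>i. coeff p i \<noteq> 0 \<longrightarrow> 2 * int i \<le> m" "\<forall>lam. x lam - poly p lam *\<^sub>C 1 \<in> verma_ideal lam"
    "\<forall>i. coeff q i \<noteq> 0 \<longrightarrow> 2 * int i \<le> m" "\<forall>lam. y lam - poly q lam *\<^sub>C 1 \<in> verma_ideal lam" by blast
  have "x lam + y lam - poly (p + q) lam *\<^sub>C 1 \<in> verma_ideal lam" for lam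
    using verma_ideal_add[OF pq(2)[rule_format, of lam] pq(4)[rule_format, of lam]]
    by (simp add: scaleC_add_left algebra_simps)
  moreover have "coeff (p + q) i \<noteq> 0 \<longrightarrow> 2 * int i \<le> m" for i using pq(1,3) by (metis add_0 coeff_add)
  ultimately show ?case by blast
next
  case (scale x c)
  then obtain p where p: "\<forall>i. coeff p i \<noteq> 0 \<longrightarrow> 2 * int i \<le> m" "\<forall>lam. x lam - poly p lam *\<^sub>C 1 \<in> verma_ideal lam" by blast
  have "c *\<^sub>C x lam - poly (smult c p) lam *\<^sub>C 1 \<in> verma_ideal lam" for lam
    using verma_ideal_scale[OF p(2)[rule_format, of lam], of c] by (simp add: scaleC_diff_right scaleC_scaleC)
  moreover have "coeff (smult c p) i \<noteq> 0 \<longrightarrow> 2 * int i \<le> m" for i using p(1) by auto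
  ultimately show ?case by blast
qed

lemma pairing_poly:
  assumes w: "weight S = weight T"
  shows "\<exists>q. (\<forall>lam. minus_word S * plus_word T - poly q lam *\<^sub>C 1 \<in> verma_ideal lam)
     \<and> half_deg (length S + length T) q
     \<and> (mset S = mset T \<longrightarrow> coeff q (length S) \<noteq> 0)
     \<and> (mset S \<noteq> mset T \<longrightarrow> (\<forall>d. 2 * d = length S + length T \<longrightarrow> coeff q d = 0))"
proof (cases "mset S = mset T")
  case True
  have len: "length T = length S" using arg_cong[OF True, of size] by simp
  obtain c where c: "c \<noteq> 0" "(\<lambda>lam. minus_word S * plus_word T - (c * lam ^ length S) *\<^sub>C 1) \<in> filtered 0 (2 * int (length S) - 1)"
    using pairing_lead[OF w] True by blast
  obtain r where r: "\<forall>i. coeff r i \<noteq> 0 \<longrightarrow> 2 * int i \<le> 2 * int (length S) - 1"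
    "\<forall>lam. minus_word S * plus_word T - (c * lam ^ length S) *\<^sub>C 1 - poly r lam *\<^sub>C 1 \<in> verma_ideal lam"
    using poly_of_weight_zero[OF c(2)] by blast
  let ?q = "monom c (length S) + r"
  have "minus_word S * plus_word T - poly ?q lam *\<^sub>C 1 \<in> verma_ideal lam" for lam
    using r(2)[rule_format, of lam] by (simp add: poly_monom scaleC_add_left diff_diff_add)
  moreover have "half_deg (length S + length T) ?q"
    unfolding half_deg_def using r(1) by (auto simp: len split: if_splits)
  moreover have "coeff r (length S) = 0"
  proof (rule ccontr)
    assume "coeff r (length S) \<noteq> 0"
    then have "2 * int (length S) \<le> 2 * int (length S) - 1" using r(1) by blast
    then show False by simp
  qed
  then have "coeff ?q (length S) \<noteq> 0" using c(1) by simp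
  ultimately show ?thesis using True by blast
next
  case False
  then have "(\<lambda>lam. minus_word S * plus_word T) \<in> filtered 0 (int (length S) + int (length T) - 1)"
    using pairing_lead[OF w] by blast
  from poly_of_weight_zero[OF this]
  obtain q where q: "\<forall>i. coeff q i \<noteq> 0 \<longrightarrow> 2 * int i \<le> int (length S) + int (length T) - 1"
    "\<forall>lam. minus_word S * plus_word T - poly q lam *\<^sub>C 1 \<in> verma_ideal lam" by blast
  have *: "2 * d < length S + length T" if "coeff q d \<noteq> 0" for d
    using q(1)[rule_format, OF that] by linarith
  have "half_deg (length S + length T) q"
    unfolding half_deg_def using * by (auto intro: less_imp_le)
  moreover have "\<forall>d. 2 * d = length S + length T \<longrightarrow> coeff q d = 0" using * by fastforce
  ultimately show ?thesis using q(2) False by blast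
qed

text \<open>A choice of an order of the letters; by \<open>filtered_permute\<close> another choice changes words only by shorter
  ones.\<close>

definition list_of :: "rtree multiset \<Rightarrow> rtree list" where "list_of A = (SOME xs. mset xs = A)"

lemma mset_list_of [simp]: "mset (list_of A) = A"
  unfolding list_of_def by (rule someI_ex) (rule ex_mset)

definition weight_basis :: "nat \<Rightarrow> rtree multiset set" where
  "weight_basis n = {A. weight (list_of A) = int n}"

lemma length_le_weight: "int (length T) \<le> weight T"
proof (induction T)
  case (Cons t T)
  then show ?case using tsize_pos[of t] by simp
qed simp

lemma tsize_le_weight: "t \<in> set T \<Longrightarrow> int (tsize t) \<le> weight T"
proof (induction T)
  case (Cons t T)
  then show ?case using weight_nonneg[of T] by auto
qed simp

lemma finite_weight_basis: "finite (weight_basis n)"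
proof (rule finite_subset)
  let ?X = "\<Union>m\<le>n. {t. tsize t = m}"
  show "weight_basis n \<subseteq> mset ` {xs. set xs \<subseteq> ?X \<and> length xs \<le> n}"
  proof
    fix A assume "A \<in> weight_basis n"
    then have w: "weight (list_of A) = int n" by (simp add: weight_basis_def)
    have "list_of A \<in> {xs. set xs \<subseteq> ?X \<and> length xs \<le> n}"
      using length_le_weight[of "list_of A"] tsize_le_weight[of _ "list_of A"] unfolding w by auto
    then show "A \<in> mset ` {xs. set xs \<subseteq> ?X \<and> length xs \<le> n}" 
      by (intro image_eqI[of _ mset "list_of A"]) simp_all
  qed
  have "finite ?X" by (simp add: finite_tsize)
  then show "finite (mset ` {xs. set xs \<subseteq> ?X \<and> length xs \<le> n})"
    by (intro finite_imageI finite_lists_length_le)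
qed

definition pairing :: "rtree multiset \<Rightarrow> rtree multiset \<Rightarrow> complex poly" where
  "pairing A B = (SOME q. (\<forall>lam. minus_word (list_of A) * plus_word (list_of B) - poly q lam *\<^sub>C 1 \<in> verma_ideal lam)
     \<and> half_deg (size A + size B) q
     \<and> (A = B \<longrightarrow> coeff q (size A) \<noteq> 0)
     \<and> (A \<noteq> B \<longrightarrow> (\<forall>d. 2 * d = size A + size B \<longrightarrow> coeff q d = 0)))"

lemma pairing_spec:
  assumes "A \<in> weight_basis n" "B \<in> weight_basis n"
  shows "minus_word (list_of A) * plus_word (list_of B) - poly (pairing A B) lam *\<^sub>C 1 \<in> verma_ideal lam" (is ?p1)
    "half_deg (size A + size B) (pairing A B)" (is ?p2)
    "A = B \<Longrightarrow> coeff (pairing A B) (size A) \<noteq> 0" (is "PROP ?p3")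
    "A \<noteq> B \<Longrightarrow> 2 * d = size A + size B \<Longrightarrow> coeff (pairing A B) d = 0" (is "PROP ?p4")
proof -
  have len: "length (list_of A) = size A" for A by (metis mset_list_of size_mset)
  have "weight (list_of A) = weight (list_of B)" using assms by (simp add: weight_basis_def)
  from someI_ex[OF pairing_poly[OF this, unfolded mset_list_of len], folded pairing_def]
  show ?p1 ?p2 "PROP ?p3" "PROP ?p4"
    by blast+
qed

definition degenerate :: "nat \<Rightarrow> complex set" where
  "degenerate n = {lam. \<exists>c. (\<exists>B\<in>weight_basis n. c B \<noteq> 0)
      \<and> (\<forall>A\<in>weight_basis n. (\<Sum>B\<in>weight_basis n. poly (pairing A B) lam * c B) = 0)}"

lemma finite_degenerate: "finite (degenerate n)"
  unfolding degenerate_def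
  by (rule poly_matrix_kernel[OF finite_weight_basis, where k = size]) (use pairing_spec in blast)+

section \<open>Weight spaces of the Verma modules\<close>

abbreviation basis_sum :: "nat \<Rightarrow> (rtree multiset \<Rightarrow> complex) \<Rightarrow> ie_lie uea" where
  "basis_sum n c \<equiv> \<Sum>A\<in>weight_basis n. c A *\<^sub>C plus_word (list_of A)"

definition weight_space :: "complex \<Rightarrow> nat \<Rightarrow> ie_lie uea set" where
  "weight_space lam n = {x. \<exists>c. x - basis_sum n c \<in> verma_ideal lam}"

lemma weight_space_ideal: "x \<in> verma_ideal lam \<Longrightarrow> x \<in> weight_space lam n"
  unfolding weight_space_def by (auto intro!: exI[of _ "\<lambda>_. 0"] simp: scaleC_zero_left)

lemma weight_space_add:
  assumes "x \<in> weight_space lam n" "y \<in> weight_space lam n" shows "x + y \<in> weight_space lam n"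
proof -
  obtain c d where "x - basis_sum n c \<in> verma_ideal lam"
    "y - basis_sum n d \<in> verma_ideal lam"
    using assms unfolding weight_space_def by blast
  from verma_ideal_add[OF this]
  have "x + y - basis_sum n (\<lambda>A. c A + d A) \<in> verma_ideal lam"
    by (simp add: scaleC_add_left sum.distrib algebra_simps)
  then show ?thesis unfolding weight_space_def by (auto intro: exI[of _ "\<lambda>A. c A + d A"])
qed

lemma scaleC_sum: "c *\<^sub>C (\<Sum>i\<in>I. x i) = (\<Sum>i\<in>I. c *\<^sub>C (x i :: 'a::cvector))"
  by (induction I rule: infinite_finite_induct) (simp_all add: scaleC_zero_right scaleC_add_right)

lemma weight_space_scale:
  assumes "x \<in> weight_space lam n" shows "a *\<^sub>C x \<in> weight_space lam n"
proof -
  obtain c where "x - basis_sum n c \<in> verma_ideal lam"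
    using assms unfolding weight_space_def by blast
  from verma_ideal_scale[OF this, of a]
  have "a *\<^sub>C x - basis_sum n (\<lambda>A. a * c A) \<in> verma_ideal lam"
    by (simp add: scaleC_diff_right scaleC_sum scaleC_scaleC)
  then show ?thesis unfolding weight_space_def by (auto intro: exI[of _ "\<lambda>A. a * c A"])
qed

text \<open>By induction on the length, as a word differs from its rearrangement by \<open>list_of\<close> only by shorter words of
  the same weight.\<close>

lemma plus_word_weight_space: "weight T = int n \<Longrightarrow> plus_word T \<in> weight_space lam n"
proof (induction "length T" arbitrary: T rule: less_induct)
  case less
  have filtered: "x lam \<in> weight_space lam n" if "x \<in> filtered (int n) m" "m < int (length T)" for x m
    using that
  proof (induction rule: filtered.induct)
    case (word S j)
    then show ?case by (intro weight_space_scale less.hyps) auto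
  qed (auto intro: weight_space_ideal weight_space_add weight_space_scale)
  let ?A = "mset T"
  have m: "mset (list_of ?A) = mset T" by simp
  have A: "?A \<in> weight_basis n" using weight_cong[OF m] less.prems by (simp add: weight_basis_def)
  have "basis_sum n (\<lambda>B. if B = ?A then 1 else 0) = plus_word (list_of ?A)"
  proof -
    have "basis_sum n (\<lambda>B. if B = ?A then 1 else 0)
       = (\<Sum>B\<in>weight_basis n. if B = ?A then plus_word (list_of B) else 0)"
      by (intro sum.cong) (auto simp: scaleC_one scaleC_zero_left)
    then show ?thesis using A finite_weight_basis by simp
  qed
  then have 1: "plus_word (list_of ?A) \<in> weight_space lam n"
    unfolding weight_space_def by (auto intro!: exI[of _ "\<lambda>B. if B = ?A then 1 else 0"] verma_ideal_zero)
  have 2: "plus_word (list_of ?A) - plus_word T \<in> weight_space lam n"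
    using filtered[OF filtered_permute[OF m, unfolded less.prems]] by simp
  have "plus_word T = plus_word (list_of ?A) + (- 1) *\<^sub>C (plus_word (list_of ?A) - plus_word T)"
    by (simp add: scaleC_minus_one)
  then show ?case using weight_space_add[OF 1 weight_space_scale[OF 2, of "- 1"]] by simp
qed

lemma weight_space_d:
  assumes "x \<in> weight_space lam n"
  shows "U_d * x - (lam + of_nat n) *\<^sub>C x \<in> verma_ideal lam"
proof -
  let ?X = "\<lambda>A. plus_word (list_of A)" and ?D = "\<lambda>x. U_d * x - (lam + of_nat n) *\<^sub>C x"
  obtain c where c: "x - basis_sum n c \<in> verma_ideal lam"
    using assms unfolding weight_space_def by blast
  have sum_closed: "(\<And>i. i \<in> I \<Longrightarrow> y i \<in> verma_ideal lam) \<Longrightarrow> (\<Sum>i\<in>I. y i) \<in> verma_ideal lam" for I :: "rtree multiset set" and y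
    by (induction I rule: infinite_finite_induct) (auto intro: verma_ideal_zero verma_ideal_add)
  have "?D (?X A) \<in> verma_ideal lam" if "A \<in> weight_basis n" for A
    using verma_ideal_d_word[of "list_of A" lam] that by (simp add: weight_basis_def)
  then have 1: "(\<Sum>A\<in>weight_basis n. c A *\<^sub>C ?D (?X A)) \<in> verma_ideal lam"
    by (intro sum_closed verma_ideal_scale)
  have 2: "?D (x - basis_sum n c) \<in> verma_ideal lam"
    by (intro verma_ideal_diff verma_ideal_mult verma_ideal_scale c)
  have "?D (basis_sum n c) = (\<Sum>A\<in>weight_basis n. c A *\<^sub>C ?D (?X A))"
    by (simp add: sum_distrib_left scaleC_sum scaleC_mult_right scaleC_diff_right scaleC_scaleC sum_subtractf mult.commute)
  moreover have "?D (x - y) + ?D y = ?D x" for y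
    by (simp add: right_diff_distrib scaleC_diff_right)
  ultimately show ?thesis using verma_ideal_add[OF 2 1] by metis
qed

text \<open>Only finitely many of the \<open>y n\<close> are nonzero, and \<open>N\<close> is any bound for them; this makes sums easy to
  add.\<close>

definition weight_sums :: "complex \<Rightarrow> ie_lie uea set" where
  "weight_sums lam = {x. \<exists>N y. (\<forall>n. y n \<in> weight_space lam n) \<and> (\<forall>n\<ge>N. y n = 0) \<and> x - (\<Sum>n<N. y n) \<in> verma_ideal lam}"

lemma weight_sums_ideal: "x \<in> verma_ideal lam \<Longrightarrow> x \<in> weight_sums lam"
  unfolding weight_sums_def
  by (auto intro!: exI[of _ 0] exI[of _ "\<lambda>_. 0"] weight_space_ideal verma_ideal_zero)

lemma weight_sums_word: "plus_word T \<in> weight_sums lam"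
proof -
  define n where "n = nat (weight T)"
  have n: "weight T = int n" using weight_nonneg by (simp add: n_def)
  let ?y = "\<lambda>m. if m = n then plus_word T else 0"
  have "?y m \<in> weight_space lam m" for m
    using plus_word_weight_space[OF n] by (auto intro: weight_space_ideal verma_ideal_zero)
  moreover have "(\<Sum>m<Suc n. ?y m) = plus_word T" by simp
  ultimately show ?thesis unfolding weight_sums_def
    by (auto intro!: exI[of _ "Suc n"] exI[of _ ?y] simp: verma_ideal_zero)
qed

lemma weight_sums_add:
  assumes "x \<in> weight_sums lam" "x' \<in> weight_sums lam" shows "x + x' \<in> weight_sums lam"
proof -
  obtain N y N' y' where y: "\<And>n. y n \<in> weight_space lam n" "\<And>n. n \<ge> N \<Longrightarrow> y n = 0" "x - (\<Sum>n<N. y n) \<in> verma_ideal lam"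
    and y': "\<And>n. y' n \<in> weight_space lam n" "\<And>n. n \<ge> N' \<Longrightarrow> y' n = 0" "x' - (\<Sum>n<N'. y' n) \<in> verma_ideal lam"
    using assms unfolding weight_sums_def by blast
  let ?N = "max N N'"
  have "(\<Sum>n<N. y n) = (\<Sum>n<?N. y n)" by (rule sum.mono_neutral_left) (auto intro!: y)
  moreover have "(\<Sum>n<N'. y' n) = (\<Sum>n<?N. y' n)" by (rule sum.mono_neutral_left) (auto intro!: y')
  ultimately have "x + x' - (\<Sum>n<?N. y n + y' n) \<in> verma_ideal lam"
    using verma_ideal_add[OF y(3) y'(3)] by (simp add: sum.distrib algebra_simps)
  moreover have "\<forall>n. y n + y' n \<in> weight_space lam n" using y(1) y'(1) weight_space_add by blast
  ultimately show ?thesis unfolding weight_sums_def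
    using y(2) y'(2) by (auto intro!: exI[of _ ?N] exI[of _ "\<lambda>n. y n + y' n"])
qed

lemma weight_sums_scale:
  assumes "x \<in> weight_sums lam" shows "c *\<^sub>C x \<in> weight_sums lam"
proof -
  obtain N y where y: "\<And>n. y n \<in> weight_space lam n" "\<And>n. n \<ge> N \<Longrightarrow> y n = 0" "x - (\<Sum>n<N. y n) \<in> verma_ideal lam"
    using assms unfolding weight_sums_def by blast
  have "c *\<^sub>C x - (\<Sum>n<N. c *\<^sub>C y n) \<in> verma_ideal lam"
    using verma_ideal_scale[OF y(3), of c] by (simp add: scaleC_diff_right scaleC_sum)
  then show ?thesis unfolding weight_sums_def
    using y weight_space_scale by (auto intro!: exI[of _ N] exI[of _ "\<lambda>n. c *\<^sub>C y n"] simp: scaleC_zero_right)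
qed

inductive_set word_span :: "complex \<Rightarrow> ie_lie uea set" for lam where
  word: "plus_word T \<in> word_span lam"
| ideal: "x \<in> verma_ideal lam \<Longrightarrow> x \<in> word_span lam"
| add: "x \<in> word_span lam \<Longrightarrow> y \<in> word_span lam \<Longrightarrow> x + y \<in> word_span lam"
| scale: "x \<in> word_span lam \<Longrightarrow> c *\<^sub>C x \<in> word_span lam"

lemma word_span_weight_sums: "x \<in> word_span lam \<Longrightarrow> x \<in> weight_sums lam"
  by (induction rule: word_span.induct)
    (auto intro: weight_sums_word weight_sums_ideal weight_sums_add weight_sums_scale)

lemma filtered_word_span: "x \<in> filtered n m \<Longrightarrow> x lam \<in> word_span lam"
  by (induction rule: filtered.induct) (auto intro: word_span.intros)

lemma word_span_left_mult:
  assumes "\<And>T. u * plus_word T \<in> word_span lam" "x \<in> word_span lam"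
  shows "u * x \<in> word_span lam"
  using assms(2)
  by (induction rule: word_span.induct)
    (auto simp: distrib_left scaleC_mult_right intro: assms(1) word_span.intros verma_ideal_mult)

lemma word_span_uinc: "x \<in> word_span lam \<Longrightarrow> uinc (abs_ie_lie (abs_free_lie t)) * x \<in> word_span lam"
proof (induction t arbitrary: x)
  case (LGen g)
  show ?case
  proof (rule word_span_left_mult[OF _ LGen])
    fix T
    show "uinc (abs_ie_lie (abs_free_lie (LGen g))) * plus_word T \<in> word_span lam"
      unfolding fgen.abs_eq[symmetric]
    proof (cases g)
      case (GPlus t)
      then show "uinc (abs_ie_lie (fgen g)) * plus_word T \<in> word_span lam"
        using word_span.word[of "t # T"] by (simp add: D_plus.abs_eq)
    next
      case (GMinus t)
      then show "uinc (abs_ie_lie (fgen g)) * plus_word T \<in> word_span lam"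
        using filtered_word_span[OF filtered_minus_word] by (simp add: D_minus.abs_eq)
    next
      case GD
      have "(U_d * plus_word T - (lam + of_int (weight T)) *\<^sub>C plus_word T) + (lam + of_int (weight T)) *\<^sub>C plus_word T \<in> word_span lam"
        by (intro word_span.add word_span.ideal word_span.scale word_span.word verma_ideal_d_word)
      then show "uinc (abs_ie_lie (fgen g)) * plus_word T \<in> word_span lam"
        using GD by (simp add: d_elem.abs_eq)
    qed
  qed
next
  case LZero
  have "uinc (0 :: ie_lie) = 0" using uinc_scale[of 0 "0 :: ie_lie"] by (simp add: scaleC_zero_left)
  then show ?case
    by (simp add: zero_free_lie.abs_eq[symmetric] zero_ie_lie.abs_eq[symmetric] word_span.ideal verma_ideal_zero)
next
  case (LAdd s t)
  then show ?case
    by (simp add: plus_free_lie.abs_eq[symmetric] plus_ie_lie.abs_eq[symmetric] uinc_add distrib_right word_span.add)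
next
  case (LScale c s)
  then show ?case
    by (simp add: scaleC_free_lie.abs_eq[symmetric] scaleC_ie_lie.abs_eq[symmetric] uinc_scale scaleC_mult_left word_span.scale)
next
  case (LBr s t)
  let ?s = "uinc (abs_ie_lie (abs_free_lie s))" and ?t = "uinc (abs_ie_lie (abs_free_lie t))"
  have "?s * (?t * x) + (- 1) *\<^sub>C (?t * (?s * x)) \<in> word_span lam"
    by (intro word_span.add word_span.scale LBr)
  then show ?case
    by (simp add: lie_free_lie.abs_eq[symmetric] lie_ie_lie.abs_eq[symmetric] uinc_lie left_diff_distrib
        scaleC_minus_one mult.assoc)
qed

text \<open>The words together with the ideal span the enveloping algebra: the span contains 1 and is stable under
  left multiplication by the generators, hence by everything.\<close>

lemma word_span_UNIV: "u \<in> word_span lam"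
proof -
  obtain t where u: "u = abs_uea t" using Quotient3_abs_rep[OF Quotient3_uea, of u] by metis
  have "abs_uea t * x \<in> word_span lam" if "x \<in> word_span lam" for x
    using that
  proof (induction t arbitrary: x)
    case (UInc y)
    obtain s where "y = abs_ie_lie (abs_free_lie s)"
      using Quotient3_abs_rep[OF Quotient3_ie_lie, of y] Quotient3_abs_rep[OF Quotient3_free_lie] by metis
    then show ?case using word_span_uinc[OF UInc, of s] by (simp add: uinc.abs_eq)
  next
    case UZero
    then show ?case by (simp add: zero_uea.abs_eq[symmetric] word_span.ideal verma_ideal_zero)
  next
    case UOne
    then show ?case by (simp add: one_uea.abs_eq[symmetric])
  next
    case (UAdd s t)
    then show ?case by (simp add: plus_uea.abs_eq[symmetric] distrib_right word_span.add)
  next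
    case (UScale c s)
    then show ?case by (simp add: scaleC_uea.abs_eq[symmetric] scaleC_mult_left word_span.scale)
  next
    case (UMul s t)
    then show ?case by (simp add: times_uea.abs_eq[symmetric] mult.assoc)
  qed
  from this[OF word_span.word[of "[]"]] show ?thesis by (simp add: u)
qed

section \<open>Irreducibility\<close>

text \<open>Weight components of an element of \<open>L\<close> lie in \<open>L\<close>, because \<open>d - (lam + N)\<close> kills the top component modulo
  the ideal and multiplies the others by nonzero numbers. A component outside the ideal is then paired with a
  suitable word in the \<open>D\<^sup>-\<close>.\<close>

lemma left_ideal_contains_one:
  assumes lam: "\<And>n. lam \<notin> degenerate n"
    and J: "verma_ideal lam \<subseteq> L" and add: "\<And>y z. y \<in> L \<Longrightarrow> z \<in> L \<Longrightarrow> y + z \<in> L"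
    and mult: "\<And>u y. y \<in> L \<Longrightarrow> u * y \<in> L" and x: "x \<in> L" "x \<notin> verma_ideal lam"
  shows "1 \<in> L"
proof -
  have scale: "c *\<^sub>C y \<in> L" if "y \<in> L" for c y
    using mult[OF that, of "c *\<^sub>C 1"] by (simp add: scaleC_mult_left)
  have diff: "y - z \<in> L" if "y \<in> L" "z \<in> L" for y z
    using add[OF that(1) scale[OF that(2), of "- 1"]] by (simp add: scaleC_minus_one)
  have components: "\<forall>n<N. y n \<in> L" if "(\<Sum>n<N. y n) \<in> L" "\<And>n. y n \<in> weight_space lam n" for N y
    using that
  proof (induction N arbitrary: y)
    case (Suc N)
    let ?s = "\<Sum>n<Suc N. y n" and ?D = "\<lambda>n y. U_d * y - (lam + of_nat n) *\<^sub>C y"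
    note yw = Suc.prems(2)
    have E0: "U_d * ?s - (lam + of_nat N) *\<^sub>C ?s \<in> L" using Suc.prems(1) by (intro diff mult scale)
    have E1: "U_d * ?s - (lam + of_nat N) *\<^sub>C ?s = (\<Sum>n<Suc N. ?D n (y n)) + (\<Sum>n<N. (of_nat n - of_nat N) *\<^sub>C y n)"
    proof -
      have "U_d * ?s - (lam + of_nat N) *\<^sub>C ?s = (\<Sum>n<Suc N. U_d * y n - (lam + of_nat N) *\<^sub>C y n)"
        by (simp only: sum_distrib_left scaleC_sum sum_subtractf)
      also have "\<dots> = (\<Sum>n<Suc N. ?D n (y n) + (of_nat n - of_nat N) *\<^sub>C y n)"
      proof (rule sum.cong[OF HOL.refl])
        fix n
        have "(lam + of_nat n) *\<^sub>C y n = (lam + of_nat N) *\<^sub>C y n + (of_nat n - of_nat N) *\<^sub>C y n"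
          by (simp add: scaleC_add_left[symmetric])
        then show "U_d * y n - (lam + of_nat N) *\<^sub>C y n = ?D n (y n) + (of_nat n - of_nat N) *\<^sub>C y n" by simp
      qed
      also have "\<dots> = (\<Sum>n<Suc N. ?D n (y n)) + (\<Sum>n<Suc N. (of_nat n - of_nat N) *\<^sub>C y n)"
        by (rule sum.distrib)
      finally show ?thesis by (simp add: scaleC_zero_left)
    qed
    have D: "(\<Sum>n<M. ?D n (y n)) \<in> L" for M
    proof (induction M)
      case 0
      show ?case using subsetD[OF J verma_ideal_zero] by simp
    next
      case (Suc M)
      have "?D M (y M) \<in> L" using J weight_space_d[OF yw] by blast
      from add[OF Suc this] show ?case by (simp only: sum.lessThan_Suc)
    qed
    from diff[OF E0 D[of "Suc N"]] have "(\<Sum>n<N. (of_nat n - of_nat N) *\<^sub>C y n) \<in> L"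
      unfolding E1 by (simp only: add_diff_cancel_left')
    from Suc.IH[OF this] have IH: "(of_nat n - of_nat N) *\<^sub>C y n \<in> L" if "n < N" for n
      using weight_space_scale Suc.prems(2) that by blast
    have low: "y n \<in> L" if "n < N" for n
    proof -
      have "(of_nat n - of_nat N :: complex) \<noteq> 0" using that by simp
      then have "y n = (1 / (of_nat n - of_nat N)) *\<^sub>C (of_nat n - of_nat N) *\<^sub>C y n"
        by (simp add: scaleC_scaleC scaleC_one)
      then show ?thesis using scale[OF IH[OF that], of "1 / (of_nat n - of_nat N)"] by simp
    qed
    have "(\<Sum>n<M. y n) \<in> L" if "M \<le> N" for M
      using that
    proof (induction M)
      case 0 then show ?case using subsetD[OF J verma_ideal_zero] by simp
    qed (simp add: add low)
    then have "?s - (\<Sum>n<N. y n) \<in> L" using Suc.prems(1) by (intro diff) auto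
    then have "y N \<in> L" by simp
    then show ?case using low by (auto simp: less_Suc_eq)
  qed simp
  have "x \<in> weight_sums lam" by (rule word_span_weight_sums[OF word_span_UNIV])
  then obtain N y where y: "\<And>n. y n \<in> weight_space lam n" "x - (\<Sum>n<N. y n) \<in> verma_ideal lam"
    unfolding weight_sums_def by blast
  from diff[OF x(1) subsetD[OF J y(2)]] have "(\<Sum>n<N. y n) \<in> L" by simp
  from components[OF this y(1)] have yL: "y n \<in> L" if "n < N" for n using that by blast
  have "\<exists>n<N. y n \<notin> verma_ideal lam"
  proof (rule ccontr)
    assume n: "\<not> ?thesis"
    have "(\<Sum>n<M. y n) \<in> verma_ideal lam" if "M \<le> N" for M
      using that by (induction M) (use n in \<open>auto intro: verma_ideal_zero verma_ideal_add\<close>)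
    then show False using verma_ideal_add[OF y(2), of "\<Sum>n<N. y n"] x(2) by simp
  qed
  then obtain n where n: "n < N" "y n \<notin> verma_ideal lam" by blast
  let ?X = "\<lambda>A. plus_word (list_of A)"
  obtain c where c: "y n - basis_sum n c \<in> verma_ideal lam"
    using y(1)[of n] unfolding weight_space_def by blast
  have "\<exists>B\<in>weight_basis n. c B \<noteq> 0"
  proof (rule ccontr)
    assume "\<not> ?thesis"
    then have "basis_sum n c = 0" by (intro sum.neutral) (simp add: scaleC_zero_left)
    then show False using c n(2) by simp
  qed
  then obtain A where A: "A \<in> weight_basis n" "(\<Sum>B\<in>weight_basis n. poly (pairing A B) lam * c B) \<noteq> 0"
    using lam[of n] unfolding degenerate_def by blast
  let ?u = "minus_word (list_of A)" and ?a = "\<Sum>B\<in>weight_basis n. poly (pairing A B) lam * c B"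
  have sumL: "(\<And>i. i \<in> I \<Longrightarrow> f i \<in> L) \<Longrightarrow> (\<Sum>i\<in>I. f i) \<in> L" for I :: "rtree multiset set" and f
    by (induction I rule: infinite_finite_induct) (use subsetD[OF J verma_ideal_zero] add in \<open>simp_all\<close>)
  have "y n - (y n - basis_sum n c) \<in> L"
    by (rule diff[OF yL[OF n(1)] subsetD[OF J c]])
  then have "?u * basis_sum n c \<in> L"
    by (intro mult) simp
  moreover have "(\<Sum>B\<in>weight_basis n. c B *\<^sub>C (?u * ?X B - poly (pairing A B) lam *\<^sub>C 1)) \<in> L"
    using pairing_spec(1)[OF A(1)] J by (intro sumL scale) blast
  moreover have "?u * basis_sum n c
      - (\<Sum>B\<in>weight_basis n. c B *\<^sub>C (?u * ?X B - poly (pairing A B) lam *\<^sub>C 1))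
    = (\<Sum>B\<in>weight_basis n. (poly (pairing A B) lam * c B) *\<^sub>C 1)"
    by (simp add: sum_distrib_left scaleC_mult_right scaleC_diff_right scaleC_scaleC sum_subtractf mult.commute)
  moreover have "(\<Sum>B\<in>weight_basis n. (poly (pairing A B) lam * c B) *\<^sub>C (1 :: ie_lie uea)) = ?a *\<^sub>C 1"
  proof -
    have "(\<Sum>i\<in>I. f i *\<^sub>C (1 :: ie_lie uea)) = (\<Sum>i\<in>I. f i) *\<^sub>C 1" for I :: "rtree multiset set" and f
      by (induction I rule: infinite_finite_induct) (simp_all add: scaleC_zero_left scaleC_add_left)
    then show ?thesis .
  qed
  ultimately have "?a *\<^sub>C 1 \<in> L" using diff by fastforce
  from scale[OF this, of "1 / ?a"] show "1 \<in> L" using A(2) by (simp add: scaleC_scaleC scaleC_one)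
qed

theorem theorem3p2:
  shows "\<exists>A :: complex set. countable A \<and> 0 \<in> A \<and>
    (\<forall>lam. lam \<notin> A \<longrightarrow> irreducible_module (verma lam) (verma_act lam))"
proof (intro exI conjI allI impI)
  let ?A = "insert 0 (\<Union>n. degenerate n)"
  show "countable ?A" by (simp add: countable_finite finite_degenerate)
  show "0 \<in> ?A" by simp
  fix lam assume "lam \<notin> ?A"
  then have "lam \<notin> degenerate n" for n by auto
  then show "irreducible_module (verma lam) (verma_act lam)"
    by (intro irreducible_verma_if_maximal left_ideal_contains_one)
qed

end
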